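(* The functions $g_1,g_2,g_3$ are algebraically independent over $\mathbb{C}$, and the algebra $M$ of (full) differential modular forms is freely generated by $g_1,g_2,g_3$ as a $\mathbb{C}$-algebra. In particular, each $M^n_m$ ($n,m\in\mathbb{Z}$, $n\ge 0$) is a finite dimensional $\mathbb{C}$-vector space.
   Context: Let $\mathbb{H}=\{z\in\mathbb{C}: \mathrm{Im}(z)>0\}$. For $A=\begin{pmatrix}a&b\\c&d\end{pmatrix}\in \mathrm{SL}(2,\mathbb{Z})$ put $c_A=c$, $j(A,z)=cz+d$, $Az=\frac{az+b}{cz+d}$, and $(f|_mA)(z)=j(A,z)^{-m}f(Az)$. Definition of $M^n_m$ ($n\ge 0$, $m\in\mathbb{Z}$), by induction on $n$. $M^0_m$ is the space of holomorphic $f:\mathbb{H}\to\mathbb{C}$ with $f|_mA=f$ for all $A\in \mathrm{SL}(2,\mathbb{Z})$ and such that $\lim_{\mathrm{Im}(z)\to+\infty}f(z)$ exists in $\mathbb{C}$ (classical modular forms of weight $m$). For $n\ge1$, a holomorphic $f:\mathbb{H}\to\mathbb{C}$ is in $M^n_m$ if: (1) there are functions $f_i\in M^{n-i}_{m-2i}$, $i=1,\dots,n$, with $f|_mA-f=\sum_{i=1}^n\binom{n}{i}c_A^i\,j(A,z)^{-i}f_i$ for all $A\in \mathrm{SL}(2,\mathbb{Z})$ (the $f_i$ are then uniquely determined by $f$, $n$ and $m$, and are called the associated functions of $f$); (2) writing, by induction, $f_i|_{m-2i}A-f_i=\sum_{j=1}^{n-i}\binom{n-i}{j}c_A^j\,j(A,z)^{-j}f_{ij}$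 with $f_{ij}\in M^{n-i-j}_{m-2i-2j}$, one has $f_{ij}=f_{i+j}$ for all $i,j\ge 1$, $i+j\le n$; (3) $\lim_{\mathrm{Im}(z)\to+\infty}f(z)$ exists in $\mathbb{C}$. $M$ denotes the $\mathbb{C}$-algebra of holomorphic functions on $\mathbb{H}$ given by the sum (inside the holomorphic functions on $\mathbb{H}$) of all the spaces $M^n_m$, $n,m\in\mathbb{Z}$, $n\ge0$; it is graded by $\deg f=m$ for $f\in M^n_m$. Eisenstein series: for $k=1,2,3$, $g_k(z)=a_k\Big(1+(-1)^k\frac{4k}{B_k}\sum_{n\ge1}\sigma_{2k-1}(n)e^{2\pi i zn}\Big)$, $z\in\mathbb{H}$, with $B_1=\frac16$, $B_2=\frac1{30}$, $B_3=\frac1{42}$, $\sigma_i(n)=\sum_{d\mid n}d^i$, and $(a_1,a_2,a_3)=\big(\frac{2\pi i}{12},\,12(\frac{2\pi i}{12})^2,\,8(\frac{2\pi i}{12})^3\big)$. *)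

theory Defs
  imports "HOL-Complex_Analysis.Complex_Analysis" "HOL-Library.Poly_Mapping"
    "HOL-Real_Asymp.Real_Asymp"
begin

subsection \<open>The algebra of holomorphic functions on the upper half plane\<close>

definition upper_half_plane :: "complex set" where
  "upper_half_plane = {z. Im z > 0}"

lemma open_upper_half_plane: "open upper_half_plane"
  unfolding upper_half_plane_def by (rule open_halfspace_Im_gt)

text \<open>A holomorphic function on the upper half plane is represented by its extension by zero, so
  that equality of elements of the type is equality of functions on the half plane.\<close>

typedef hol_fun = "{f :: complex \<Rightarrow> complex.
    f holomorphic_on upper_half_plane \<and> (\<forall>z. z \<notin> upper_half_plane \<longrightarrow> f z = 0)}"
  morphisms app_hol Abs_hol
  by (rule exI[of _ "\<lambda>_. 0"]) auto

setup_lifting type_definition_hol_fun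

instantiation hol_fun :: comm_ring_1
begin

lift_definition zero_hol_fun :: hol_fun is "\<lambda>_. 0"
  by auto

lift_definition one_hol_fun :: hol_fun is "\<lambda>z. if z \<in> upper_half_plane then 1 else 0"
proof -
  have "(\<lambda>_. 1 :: complex) holomorphic_on upper_half_plane"
    by simp
  then show "?thesis"
    by (auto cong: holomorphic_cong)
qed

lift_definition plus_hol_fun :: "hol_fun \<Rightarrow> hol_fun \<Rightarrow> hol_fun" is "\<lambda>f g z. f z + g z"
  by (auto intro: holomorphic_intros)

lift_definition minus_hol_fun :: "hol_fun \<Rightarrow> hol_fun \<Rightarrow> hol_fun" is "\<lambda>f g z. f z - g z"
  by (auto intro: holomorphic_intros)

lift_definition uminus_hol_fun :: "hol_fun \<Rightarrow> hol_fun" is "\<lambda>f z. - f z"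
  by (auto intro: holomorphic_intros)

lift_definition times_hol_fun :: "hol_fun \<Rightarrow> hol_fun \<Rightarrow> hol_fun" is "\<lambda>f g z. f z * g z"
  by (auto intro: holomorphic_intros)

instance
proof
  show "(0 :: hol_fun) \<noteq> 1"
  proof transfer
    have "\<i> \<in> upper_half_plane"
      by (simp add: upper_half_plane_def)
    then show "(\<lambda>_. 0 :: complex) \<noteq> (\<lambda>z. if z \<in> upper_half_plane then 1 else 0)"
      by (metis zero_neq_one)
  qed
qed (transfer; force simp: algebra_simps)+

end

lift_definition scale_hol :: "complex \<Rightarrow> hol_fun \<Rightarrow> hol_fun" is "\<lambda>c f z. c * f z"
  by (auto intro: holomorphic_intros)

interpretation hol: vector_space scale_hol
  by standard (transfer; force simp: algebra_simps)+

definition finite_dim_subspace :: "hol_fun set \<Rightarrow> bool" where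
  "finite_dim_subspace V \<longleftrightarrow> hol.subspace V \<and> (\<exists>B. finite B \<and> V = hol.span B)"

definition subalgebra :: "hol_fun set \<Rightarrow> bool" where
  "subalgebra R \<longleftrightarrow> hol.subspace R \<and> 1 \<in> R \<and> (\<forall>f\<in>R. \<forall>g\<in>R. f * g \<in> R)"


subsection \<open>Polynomial relations\<close>

text \<open>Complex polynomials are finitely supported maps from exponent vectors to coefficients.\<close>

type_synonym 'i polynomial = "('i \<Rightarrow>\<^sub>0 nat) \<Rightarrow>\<^sub>0 complex"

definition polynomials_in :: "'i set \<Rightarrow> 'i polynomial set" where
  "polynomials_in I = {p. \<forall>e\<in>Poly_Mapping.keys p. Poly_Mapping.keys e \<subseteq> I}"

definition poly_eval :: "('i \<Rightarrow> hol_fun) \<Rightarrow> 'i polynomial \<Rightarrow> hol_fun" where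
  "poly_eval x p = (\<Sum>e\<in>Poly_Mapping.keys p. scale_hol (Poly_Mapping.lookup p e)
     (\<Prod>i\<in>Poly_Mapping.keys e. x i ^ Poly_Mapping.lookup e i))"

definition algebraically_independent :: "'i set \<Rightarrow> ('i \<Rightarrow> hol_fun) \<Rightarrow> bool" where
  "algebraically_independent I x \<longleftrightarrow>
     (\<forall>p\<in>polynomials_in I. poly_eval x p = 0 \<longrightarrow> p = 0)"

text \<open>Evaluation at the generators is an isomorphism from the polynomial algebra onto \<open>R\<close>.\<close>

definition freely_generated_by :: "hol_fun set \<Rightarrow> 'i set \<Rightarrow> ('i \<Rightarrow> hol_fun) \<Rightarrow> bool" where
  "freely_generated_by R I x \<longleftrightarrow>
     subalgebra R \<and> bij_betw (poly_eval x) (polynomials_in I) R"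


subsection \<open>Differential modular forms\<close>

definition SL2Z :: "(int^2^2) set" where
  "SL2Z = {A. det A = 1}"

definition autj :: "int^2^2 \<Rightarrow> complex \<Rightarrow> complex" where
  "autj A z = of_int (A$2$1) * z + of_int (A$2$2)"

definition moebius_act :: "int^2^2 \<Rightarrow> complex \<Rightarrow> complex" where
  "moebius_act A z = (of_int (A$1$1) * z + of_int (A$1$2)) / (of_int (A$2$1) * z + of_int (A$2$2))"

definition slash :: "hol_fun \<Rightarrow> int \<Rightarrow> int^2^2 \<Rightarrow> complex \<Rightarrow> complex" where
  "slash f m A z = autj A z powi (- m) * app_hol f (moebius_act A z)"

text \<open>The limit as the imaginary part tends to infinity is uniform in the real part.\<close>

definition regular_at_infinity :: "hol_fun \<Rightarrow> bool" where
  "regular_at_infinity f \<longleftrightarrow> (\<exists>l. (app_hol f \<longlongrightarrow> l) (filtercomap Im at_top))"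

text \<open>The functional equation in which \<open>F 1, \<dots>, F n\<close> are the associated functions of \<open>f\<close>.\<close>

definition transforms_with :: "nat \<Rightarrow> int \<Rightarrow> hol_fun \<Rightarrow> (nat \<Rightarrow> hol_fun) \<Rightarrow> bool" where
  "transforms_with n m f F \<longleftrightarrow> (\<forall>A\<in>SL2Z. \<forall>z\<in>upper_half_plane.
     slash f m A z - app_hol f z =
       (\<Sum>i=1..n. of_nat (n choose i) * of_int (A$2$1) ^ i * autj A z powi (- int i)
                    * app_hol (F i) z))"

text \<open>In the recursive clause \<open>F i\<close> are the associated functions of \<open>f\<close> and \<open>G i j\<close> those of \<open>F i\<close>.
  Associated functions are unique, so quantifying them existentially or universally is the same.\<close>

fun diff_mod_forms :: "nat \<Rightarrow> int \<Rightarrow> hol_fun set" where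
  "diff_mod_forms 0 m = {f.
     (\<forall>A\<in>SL2Z. \<forall>z\<in>upper_half_plane. slash f m A z = app_hol f z) \<and> regular_at_infinity f}"
| "diff_mod_forms (Suc n) m = {f. \<exists>F G.
     (\<forall>i\<in>{1..Suc n}. F i \<in> diff_mod_forms (Suc n - i) (m - 2 * int i)) \<and>
     transforms_with (Suc n) m f F \<and>
     (\<forall>i\<in>{1..Suc n}.
        (\<forall>j\<in>{1..Suc n - i}.
           G i j \<in> diff_mod_forms (Suc n - i - j) (m - 2 * int i - 2 * int j)) \<and>
        transforms_with (Suc n - i) (m - 2 * int i) (F i) (G i) \<and>
        (\<forall>j\<in>{1..Suc n - i}. G i j = F (i + j))) \<and>
     regular_at_infinity f}"

text \<open>The linear span of the union of subspaces is their sum.\<close>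

definition diff_mod_form_algebra :: "hol_fun set" where
  "diff_mod_form_algebra = hol.span (\<Union>n. \<Union>m. diff_mod_forms n m)"


subsection \<open>Eisenstein series\<close>

definition divisor_sigma :: "nat \<Rightarrow> nat \<Rightarrow> nat" where
  "divisor_sigma i n = (\<Sum>d | d dvd n. d ^ i)"

definition eis_B :: "nat \<Rightarrow> complex" where
  "eis_B k = (if k = 1 then 1/6 else if k = 2 then 1/30 else if k = 3 then 1/42 else 0)"

definition eis_a :: "nat \<Rightarrow> complex" where
  "eis_a k = (if k = 1 then 2 * of_real pi * \<i> / 12
     else if k = 2 then 12 * (2 * of_real pi * \<i> / 12) ^ 2
     else if k = 3 then 8 * (2 * of_real pi * \<i> / 12) ^ 3 else 0)"

lemma divisor_sigma_le:
  assumes "n > 0"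
  shows "divisor_sigma i n \<le> n ^ Suc i"
proof -
  have "divisor_sigma i n \<le> (\<Sum>d\<in>{1..n}. d ^ i)"
    unfolding divisor_sigma_def using assms
    by (intro sum_mono2) (auto dest: dvd_imp_le intro: Suc_leI dvd_pos_nat)
  also have "\<dots> \<le> (\<Sum>d\<in>{1..n}. n ^ i)"
    by (intro sum_mono power_mono) auto
  finally show ?thesis
    by simp
qed

lemma summable_divisor_sigma:
  fixes w :: complex
  assumes "norm w < 1"
  shows "summable (\<lambda>n. of_nat (divisor_sigma i (Suc n)) * w ^ n)"
proof -
  let ?c = "\<lambda>n. of_nat (Suc n) ^ Suc i :: complex"
  have "conv_radius ?c = ereal 1"
  proof (rule conv_radius_ratio_limit_nonzero)
    have "(\<lambda>n. (real (Suc n) / real (Suc (Suc n))) ^ Suc i) \<longlonglongrightarrow> 1 ^ Suc i"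
      by (intro tendsto_power) real_asymp
    then show "(\<lambda>n. norm (?c n) / norm (?c (Suc n))) \<longlonglongrightarrow> 1"
      by (simp only: norm_power norm_of_nat power_divide power_one)
  qed auto
  then have "summable (\<lambda>n. norm (?c n * w ^ n))"
    using assms by (intro abs_summable_in_conv_radius) auto
  then show ?thesis
  proof (rule summable_comparison_test[rotated], intro exI[of _ 0] allI impI)
    fix n
    have "real (divisor_sigma i (Suc n)) \<le> real (Suc n ^ Suc i)"
      using divisor_sigma_le[of "Suc n" i] by (simp only: of_nat_le_iff zero_less_Suc)
    then have "real (divisor_sigma i (Suc n)) \<le> real (Suc n) ^ Suc i"
      by (simp only: of_nat_power)
    then show "norm (of_nat (divisor_sigma i (Suc n)) * w ^ n) \<le> norm (?c n * w ^ n)"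
      unfolding norm_mult norm_power norm_of_nat by (intro mult_right_mono) auto
  qed
qed

lemma holomorphic_divisor_sigma_series:
  "(\<lambda>z. suminf (\<lambda>n. of_nat (divisor_sigma i (Suc n)) *
      exp (2 * of_real pi * \<i> * z * of_nat (Suc n)))) holomorphic_on upper_half_plane"
proof -
  define S where "S = (\<lambda>w :: complex. suminf (\<lambda>n. of_nat (divisor_sigma i (Suc n)) * w ^ n))"
  define q where "q = (\<lambda>z. exp (2 * of_real pi * \<i> * z))"
  have q: "q z \<in> ball 0 1" if "z \<in> upper_half_plane" for z
    using that by (simp add: q_def upper_half_plane_def)
  have "S holomorphic_on ball 0 1"
    unfolding S_def using summable_divisor_sigma
    by (intro power_series_holomorphic[where a = "\<lambda>n. of_nat (divisor_sigma i (Suc n))"])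
      (auto intro!: summable_sums)
  then have "(S \<circ> q) holomorphic_on upper_half_plane"
    using q by (intro holomorphic_on_compose_gen[where t = "ball 0 1"])
      (auto simp: q_def intro!: holomorphic_intros)
  then have "(\<lambda>z. q z * S (q z)) holomorphic_on upper_half_plane"
    unfolding o_def by (intro holomorphic_on_mult) (auto simp: q_def intro!: holomorphic_intros)
  moreover have "q z * S (q z) = suminf (\<lambda>n. of_nat (divisor_sigma i (Suc n)) *
      exp (2 * of_real pi * \<i> * z * of_nat (Suc n)))" if "z \<in> upper_half_plane" for z
  proof -
    have "exp (2 * of_real pi * \<i> * z * of_nat (Suc n)) = q z * q z ^ n" for n
      unfolding q_def by (metis exp_of_nat_mult mult.commute power_Suc)
    moreover have "q z * S (q z) = suminf (\<lambda>n. q z * (of_nat (divisor_sigma i (Suc n)) * q z ^ n))"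
      unfolding S_def using summable_divisor_sigma q[OF that] by (intro suminf_mult[symmetric]) auto
    ultimately show ?thesis
      by (simp add: mult_ac)
  qed
  ultimately show ?thesis
    by (simp cong: holomorphic_cong)
qed

text \<open>Only the values at \<open>k \<in> {1, 2, 3}\<close> matter; the summation index is shifted to start at 0.\<close>

lift_definition eisenstein :: "nat \<Rightarrow> hol_fun" is
  "\<lambda>k z. if z \<in> upper_half_plane then
     eis_a k * (1 + (-1) ^ k * (4 * of_nat k / eis_B k) *
       suminf (\<lambda>n. of_nat (divisor_sigma (2 * k - 1) (Suc n)) *
          exp (2 * of_real pi * \<i> * z * of_nat (Suc n))))
   else 0"
proof -
  fix k :: nat
  have "(\<lambda>z. eis_a k * (1 + (-1) ^ k * (4 * of_nat k / eis_B k) *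
       suminf (\<lambda>n. of_nat (divisor_sigma (2 * k - 1) (Suc n)) *
          exp (2 * of_real pi * \<i> * z * of_nat (Suc n))))) holomorphic_on upper_half_plane"
    by (intro holomorphic_intros holomorphic_divisor_sigma_series)
  then show "?thesis k"
    by (auto cong: holomorphic_cong)
qed

end

theory Submission
  imports Defs
begin

text \<open>
  Why the theorem holds. Let \<open>j = c z + d\<close> and \<open>s = c / j\<close>. Together with its associated functions a form
  of weight \<open>m\<close> is a polynomial \<open>P(z, X)\<close> of degree at most \<open>n\<close> in \<open>X\<close>, the coefficient of \<open>X^i\<close> being the
  \<open>i\<close>-th associated function times \<open>n choose i\<close>, and the defining equations say
  \<open>P(A z, Y) = j^m P(z, s + Y / j^2)\<close>. Since \<open>g\<^sub>1(A z) = j^2 (g\<^sub>1(z) + s)\<close>, the substitution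
  \<open>X = Y - g\<^sub>1\<close> is compatible with this action, so the coefficients of \<open>P(z, Y - g\<^sub>1(z))\<close> are classical
  modular forms of weights \<open>m - 2 k\<close>. Setting \<open>Y = g\<^sub>1\<close> gives back the form itself: it is a polynomial
  in \<open>g\<^sub>1\<close> with classical modular forms as coefficients (\<open>quasi_family_decomposition\<close>). Classical
  modular forms of weight \<open>k\<close> are spanned by the monomials \<open>g\<^sub>2^b g\<^sub>3^c\<close> with \<open>4 b + 6 c = k\<close>
  (\<open>modular_form_in_span\<close>), and conversely every monomial in the three series is a differential
  modular form (\<open>quasi_monomials_subset\<close>). So each \<open>M^n_m\<close> is spanned by finitely many monomials, and
  the algebra by all of them.

  The analytic input is the behaviour of the three Eisenstein series under \<open>z \<mapsto> - 1 / z\<close>. It comes from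
  one function of a second variable \<open>u\<close>, the logarithmic derivative of a theta function for
  the lattice spanned by \<open>1\<close> and \<open>z\<close>: it is odd, has a simple pole at \<open>0\<close>, period \<open>1\<close> and quasi-period
  \<open>z\<close>. Rescaling the lattice by \<open>1 / z\<close> gives another such function, and their difference, corrected by a
  linear term, is doubly periodic and holomorphic, hence constant, hence \<open>0\<close>
  (\<open>theta_logderiv_reg_inversion\<close>). The Taylor coefficients of degrees \<open>1, 3, 5\<close> in \<open>u\<close> are the
  Eisenstein series, so comparing them yields all three transformation laws at once
  (\<open>eisenstein_inversion\<close>).

  For the structure of classical modular forms, the maximum principle shows that a form of weight \<open>0\<close> is
  constant. A primitive of the series \<open>g\<^sub>1\<close> exponentiates to a form of weight \<open>12\<close> without zeros in the
  half plane and with a simple zero at the cusp (\<open>exists_nonvanishing_cusp_form\<close>). Subtracting a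
  monomial and dividing by this form lowers the weight by \<open>12\<close>.

  For algebraic independence, a relation is evaluated at \<open>A z\<close> for many \<open>A\<close>. Being polynomial in \<open>c\<close> and
  \<open>j\<close>, it splits by degree in \<open>g\<^sub>1\<close> and by weight, and the surviving relations between \<open>g\<^sub>2\<close> and \<open>g\<^sub>3\<close> would
  force the quotient of \<open>g\<^sub>2^3\<close> by \<open>g\<^sub>3^2\<close> to take only finitely many values near the cusp
  (\<open>eis_monomials_independent\<close>).
\<close>

section \<open>Invariant functions on the upper half plane\<close>

abbreviation at_cusp :: "complex filter" where
  "at_cusp \<equiv> filtercomap Im at_top"

lemma eventually_at_cusp: "eventually P at_cusp \<longleftrightarrow> (\<exists>Y. \<forall>z. Im z > Y \<longrightarrow> P z)"
  by (simp add: eventually_filtercomap_at_top_dense)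

lemma at_cusp_neq_bot: "at_cusp \<noteq> bot"
proof
  assume "at_cusp = bot"
  then have "eventually (\<lambda>_. False) at_cusp"
    by simp
  then obtain Y where "\<forall>z. Im z > Y \<longrightarrow> False"
    by (auto simp: eventually_at_cusp)
  then show False
    by (auto dest: spec[of _ "Complex 0 (Y + 1)"])
qed

lemma eventually_upper_half_plane_at_cusp: "eventually (\<lambda>z. z \<in> upper_half_plane) at_cusp"
  by (auto simp: eventually_at_cusp upper_half_plane_def)

lemma convex_upper_half_plane: "convex upper_half_plane"
  unfolding upper_half_plane_def by (rule convex_halfspace_Im_gt)

lemma connected_upper_half_plane: "connected upper_half_plane"
  by (rule convex_connected[OF convex_upper_half_plane])

lemma upper_half_plane_nonzero: "z \<in> upper_half_plane \<Longrightarrow> z \<noteq> 0"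
  by (auto simp: upper_half_plane_def)

lemma Im_minus_inverse: "Im (- (1 / z)) = Im z / (cmod z)\<^sup>2"
  by (simp add: Im_divide cmod_power2)

lemma minus_inverse_in_upper_half_plane:
  assumes "z \<in> upper_half_plane"
  shows "- (1 / z) \<in> upper_half_plane"
  using assms upper_half_plane_nonzero[OF assms]
  unfolding upper_half_plane_def mem_Collect_eq Im_minus_inverse by (simp add: divide_pos_pos)

lemma add_of_int_in_upper_half_plane:
  "z + of_int n \<in> upper_half_plane \<longleftrightarrow> z \<in> upper_half_plane"
  by (simp add: upper_half_plane_def)

lemma periodic_of_int:
  fixes f :: "complex \<Rightarrow> 'a"
  assumes "\<And>z. z \<in> upper_half_plane \<Longrightarrow> f (z + 1) = f z" "z \<in> upper_half_plane"
  shows "f (z + of_int n) = f z"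
proof -
  have *: "f (w + of_nat k) = f w" if "w \<in> upper_half_plane" for w k
  proof (induction k)
    case (Suc k)
    have "w + of_nat k \<in> upper_half_plane"
      using that by (simp add: upper_half_plane_def)
    from assms(1)[OF this] Suc show ?case
      by (simp add: add_ac)
  qed auto
  show ?thesis
  proof (cases "n \<ge> 0")
    case True
    then show ?thesis
      using *[OF assms(2), of "nat n"] by simp
  next
    case False
    have "z + of_int n \<in> upper_half_plane"
      using assms(2) by (simp add: upper_half_plane_def)
    from *[OF this, of "nat (- n)"] False show ?thesis
      by simp
  qed
qed

text \<open>After a translation \<open>\<bar>Re z\<bar> \<le> 1 / 2\<close>. As long as \<open>Im z < 1 / 2\<close> this gives \<open>\<bar>z\<bar>\<^sup>2 \<le> 1 / 2\<close>, so the inversion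
  at least doubles the imaginary part, and finitely many rounds suffice.\<close>

lemma reduction_to_fundamental_domain:
  fixes f :: "complex \<Rightarrow> 'a"
  assumes T: "\<And>z. z \<in> upper_half_plane \<Longrightarrow> f (z + 1) = f z"
    and S: "\<And>z. z \<in> upper_half_plane \<Longrightarrow> f (- (1 / z)) = f z"
    and z: "z \<in> upper_half_plane"
  obtains w where "\<bar>Re w\<bar> \<le> 1 / 2" "Im w \<ge> 1 / 2" "f w = f z"
proof -
  have "\<exists>w. \<bar>Re w\<bar> \<le> 1 / 2 \<and> Im w \<ge> 1 / 2 \<and> f w = f z"
    if "2 ^ k * Im z \<ge> 1 / 2" "z \<in> upper_half_plane" for k z
    using that
  proof (induction k arbitrary: z)
    case 0
    define w where "w = z + of_int (- round (Re z))"
    have "\<bar>Re w\<bar> \<le> 1 / 2"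
      using of_int_round_abs_le[of "Re z"] by (simp add: w_def abs_minus_commute)
    moreover have "f w = f z"
      unfolding w_def using T 0(2) by (rule periodic_of_int)
    ultimately show ?case
      using 0 by (intro exI[of _ w]) (auto simp: w_def)
  next
    case (Suc k)
    define w where "w = z + of_int (- round (Re z))"
    have Re: "\<bar>Re w\<bar> \<le> 1 / 2"
      using of_int_round_abs_le[of "Re z"] by (simp add: w_def abs_minus_commute)
    have fw: "f w = f z"
      unfolding w_def using T Suc(3) by (rule periodic_of_int)
    have Im: "Im w = Im z"
      by (simp add: w_def)
    have w: "w \<in> upper_half_plane"
      using Suc(3) by (simp add: upper_half_plane_def Im)
    show ?case
    proof (cases "Im w \<ge> 1 / 2")
      case True
      then show ?thesis
        using Re fw by blast
    next
      case False
      have "(cmod w)\<^sup>2 \<le> 1 / 4 + 1 / 4"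
        unfolding cmod_power2
      proof (rule add_mono)
        show "(Re w)\<^sup>2 \<le> 1 / 4"
          using power_mono[OF Re, of 2] by (simp add: power2_eq_square)
        have "Im w > 0"
          using w by (simp add: upper_half_plane_def)
        then show "(Im w)\<^sup>2 \<le> 1 / 4"
          using False power_mono[of "Im w" "1 / 2" 2] by (simp add: power2_eq_square)
      qed
      moreover have "cmod w > 0" "Im w > 0"
        using w upper_half_plane_nonzero[OF w] by (auto simp: upper_half_plane_def)
      ultimately have "2 * Im w \<le> Im (- (1 / w))"
        unfolding Im_minus_inverse by (simp add: field_simps)
      then have "2 ^ k * (2 * Im w) \<le> 2 ^ k * Im (- (1 / w))"
        by (intro mult_left_mono) auto
      then have "1 / 2 \<le> 2 ^ k * Im (- (1 / w))"
        using Suc(2) Im by (simp add: mult_ac)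
      from Suc.IH[OF this minus_inverse_in_upper_half_plane[OF w]] S[OF w] fw show ?thesis
        by simp
    qed
  qed
  moreover obtain k where "2 ^ k * Im z \<ge> 1 / 2"
  proof -
    have "Im z > 0"
      using z by (simp add: upper_half_plane_def)
    obtain k where "1 / (2 * Im z) < 2 ^ k"
      using real_arch_pow[of 2 "1 / (2 * Im z)"] by auto
    then have "2 ^ k * Im z \<ge> 1 / 2"
      using \<open>Im z > 0\<close> by (simp add: field_simps)
    then show ?thesis
      by (rule that)
  qed
  ultimately show ?thesis
    using z that by blast
qed

text \<open>Near the cusp \<open>f\<close> is small and every orbit meets the strip \<open>\<bar>Re z\<bar> \<le> 1 / 2\<close>, \<open>Im z \<ge> 1 / 2\<close>, so the
  modulus of \<open>f\<close> would attain its supremum at a point of a compact part of the strip. By the maximum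
  principle \<open>f\<close> is then constant, and the constant is the limit \<open>0\<close>.\<close>

lemma invariant_vanishing_at_cusp_eq_0:
  assumes hol: "f holomorphic_on upper_half_plane"
    and T: "\<And>z. z \<in> upper_half_plane \<Longrightarrow> f (z + 1) = f z"
    and S: "\<And>z. z \<in> upper_half_plane \<Longrightarrow> f (- (1 / z)) = f z"
    and lim: "(f \<longlongrightarrow> 0) at_cusp"
    and z: "z \<in> upper_half_plane"
  shows "f z = 0"
proof (rule ccontr)
  assume nz: "f z \<noteq> 0"
  have "eventually (\<lambda>w. cmod (f w) < cmod (f z)) at_cusp"
    using lim nz by (auto simp: tendsto_iff dist_norm)
  then obtain Y where Y: "cmod (f w) < cmod (f z)" if "Im w > Y" for w
    by (auto simp: eventually_at_cusp)
  define K where "K = cbox (Complex (- 1 / 2) (1 / 2)) (Complex (1 / 2) Y)"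
  have K: "w \<in> K \<longleftrightarrow> \<bar>Re w\<bar> \<le> 1 / 2 \<and> 1 / 2 \<le> Im w \<and> Im w \<le> Y" for w
    unfolding K_def in_cbox_complex_iff abs_le_iff by auto
  have KH: "K \<subseteq> upper_half_plane"
    by (auto simp: K upper_half_plane_def)
  have red: "\<exists>w\<in>K. f w = f u" if u: "u \<in> upper_half_plane" and fu: "cmod (f u) \<ge> cmod (f z)" for u
  proof -
    obtain w where "\<bar>Re w\<bar> \<le> 1 / 2" "Im w \<ge> 1 / 2" "f w = f u"
      by (rule reduction_to_fundamental_domain[of f, OF T S u])
    moreover from this have "Im w \<le> Y"
      using Y[of w] fu by (cases "Im w \<le> Y") auto
    ultimately show ?thesis
      by (auto simp: K)
  qed
  have "K \<noteq> {}"
    using red[OF z] by auto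
  moreover have "continuous_on K (\<lambda>w. cmod (f w))"
    using holomorphic_on_imp_continuous_on[OF hol] KH
    by (intro continuous_on_norm) (rule continuous_on_subset)
  ultimately obtain p where p: "p \<in> K" "\<And>w. w \<in> K \<Longrightarrow> cmod (f w) \<le> cmod (f p)"
    using continuous_attains_sup[of K "\<lambda>w. cmod (f w)"] by (auto simp: K_def)
  have zp: "cmod (f z) \<le> cmod (f p)"
  proof -
    obtain w where "w \<in> K" "f w = f z"
      using red[OF z] by auto
    then show ?thesis
      using p(2)[of w] by simp
  qed
  have "cmod (f u) \<le> cmod (f p)" if u: "u \<in> upper_half_plane" for u
  proof (cases "cmod (f u) \<ge> cmod (f z)")
    case True
    then obtain w where "w \<in> K" "f w = f u"
      using red[OF u] by auto
    then show ?thesis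
      using p(2)[of w] by simp
  qed (use zp in auto)
  then have "f constant_on upper_half_plane"
    using hol open_upper_half_plane connected_upper_half_plane p(1) KH
    by (intro maximum_modulus_principle[of f upper_half_plane upper_half_plane p]) auto
  then obtain c where c: "\<And>u. u \<in> upper_half_plane \<Longrightarrow> f u = c"
    by (auto simp: constant_on_def)
  define u where "u = Complex 0 (\<bar>Y\<bar> + 1)"
  have "u \<in> upper_half_plane" "Im u > Y"
    by (auto simp: u_def upper_half_plane_def)
  with Y[of u] c[of u] c[of z] z show False
    by auto
qed

definition qexp :: "complex \<Rightarrow> complex" where
  "qexp z = exp (2 * of_real pi * \<i> * z)"

lemma qexp_add: "qexp (z + w) = qexp z * qexp w"
  by (simp add: qexp_def ring_distribs exp_add)

lemma qexp_minus: "qexp (- z) = inverse (qexp z)"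
  by (simp add: qexp_def exp_minus)

lemma qexp_nonzero [simp]: "qexp z \<noteq> 0"
  by (simp add: qexp_def)

lemma qexp_0 [simp]: "qexp 0 = 1"
  by (simp add: qexp_def)

lemma qexp_1 [simp]: "qexp 1 = 1"
  by (simp add: qexp_def)

lemma norm_qexp: "cmod (qexp z) = exp (- 2 * pi * Im z)"
  by (simp add: qexp_def)

lemma norm_qexp_less_1_iff: "cmod (qexp z) < 1 \<longleftrightarrow> z \<in> upper_half_plane"
  by (simp add: norm_qexp upper_half_plane_def zero_less_mult_iff)

lemma holomorphic_on_qexp [holomorphic_intros]:
  "f holomorphic_on A \<Longrightarrow> (\<lambda>z. qexp (f z)) holomorphic_on A"
  unfolding qexp_def by (intro holomorphic_intros)

lemma has_field_derivative_qexp: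
  "(qexp has_field_derivative 2 * of_real pi * \<i> * qexp z) (at z)"
  unfolding qexp_def by (auto intro!: derivative_eq_intros)

lemma qexp_tendsto_0_at_cusp: "(qexp \<longlongrightarrow> 0) at_cusp"
proof (rule tendsto_norm_zero_cancel)
  have "((\<lambda>y. exp (- 2 * pi * y)) \<longlongrightarrow> 0) at_top"
    by real_asymp
  then show "((\<lambda>z. cmod (qexp z)) \<longlongrightarrow> 0) at_cusp"
    unfolding norm_qexp by (rule filterlim_compose) (rule filterlim_filtercomap)
qed

text \<open>A periodic function is a holomorphic function \<open>h\<close> of \<open>qexp z\<close> on the punctured unit disc. When it
  tends to \<open>0\<close> at the cusp, the singularity of \<open>h\<close> at \<open>0\<close> is removable with \<open>h 0 = 0\<close>, and the limit
  claimed is the derivative of \<open>h\<close> at \<open>0\<close>.\<close>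

lemma periodic_vanishing_at_cusp:
  assumes hol: "f holomorphic_on upper_half_plane"
    and T: "\<And>z. z \<in> upper_half_plane \<Longrightarrow> f (z + 1) = f z"
    and lim: "(f \<longlongrightarrow> 0) at_cusp"
  obtains l where "((\<lambda>z. f z / qexp z) \<longlongrightarrow> l) at_cusp"
proof -
  define c where "c = 2 * of_real pi * \<i>"
  have [simp]: "c \<noteq> 0"
    by (simp add: c_def)
  define h where "h = (\<lambda>w. if w = 0 then 0 else f (Ln w / c))"
  have Im_c: "Im (w / c) = - Re w / (2 * pi)" for w
    by (simp add: c_def Im_divide power2_eq_square)
  have Ln_H: "Ln w / c \<in> upper_half_plane" if "w \<in> ball 0 1" "w \<noteq> 0" for w
    using that by (simp add: upper_half_plane_def Im_c divide_less_0_iff)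
  have h_exp: "h (exp (c * z)) = f z" if "z \<in> upper_half_plane" for z
  proof -
    have "exp (Ln (exp (c * z))) = exp (c * z)"
      by simp
    then obtain n where "Ln (exp (c * z)) = c * z + of_int (2 * n) * pi * \<i>"
      by (subst (asm) exp_eq) auto
    then have "Ln (exp (c * z)) / c = z + of_int n"
      by (simp add: c_def field_simps)
    then show ?thesis
      using periodic_of_int[of f z n] T that by (simp add: h_def)
  qed
  \<comment> \<open>The principal logarithm is holomorphic off the negative axis. Its translate by \<open>\<pi> \<i>\<close>, shifting the
    argument of \<open>f\<close> by \<open>1 / 2\<close>, serves off the positive axis; the two definitions of \<open>h\<close> agree by periodicity.\<close>
  have hol_pos: "h holomorphic_on ball 0 1 - \<real>\<^sub>\<le>\<^sub>0"
  proof -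
    have "(f \<circ> (\<lambda>w. Ln w / c)) holomorphic_on ball 0 1 - \<real>\<^sub>\<le>\<^sub>0"
    proof (rule holomorphic_on_compose_gen[OF _ hol])
      show "(\<lambda>w. Ln w / c) holomorphic_on ball 0 1 - \<real>\<^sub>\<le>\<^sub>0"
        by (intro holomorphic_intros) auto
      show "(\<lambda>w. Ln w / c) ` (ball 0 1 - \<real>\<^sub>\<le>\<^sub>0) \<subseteq> upper_half_plane"
        by (auto intro!: Ln_H)
    qed
    then show ?thesis
      by (rule holomorphic_transform) (auto simp: h_def)
  qed
  have hol_neg: "h holomorphic_on ball 0 1 - \<real>\<^sub>\<ge>\<^sub>0"
  proof -
    have *: "Ln (- w) / c + 1 / 2 \<in> upper_half_plane" if "w \<in> ball 0 1" "w \<noteq> 0" for w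
      using Ln_H[of "- w"] that by (simp add: upper_half_plane_def)
    have "(f \<circ> (\<lambda>w. Ln (- w) / c + 1 / 2)) holomorphic_on ball 0 1 - \<real>\<^sub>\<ge>\<^sub>0"
    proof (rule holomorphic_on_compose_gen[OF _ hol])
      show "(\<lambda>w. Ln (- w) / c + 1 / 2) holomorphic_on ball 0 1 - \<real>\<^sub>\<ge>\<^sub>0"
        by (intro holomorphic_intros) (auto simp: complex_nonpos_Reals_iff complex_nonneg_Reals_iff)
      show "(\<lambda>w. Ln (- w) / c + 1 / 2) ` (ball 0 1 - \<real>\<^sub>\<ge>\<^sub>0) \<subseteq> upper_half_plane"
        by (auto intro!: *)
    qed
    moreover have "f (Ln (- w) / c + 1 / 2) = h w" if "w \<in> ball 0 1 - \<real>\<^sub>\<ge>\<^sub>0" for w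
    proof -
      have w: "w \<in> ball 0 1" "w \<noteq> 0"
        using that by auto
      have "exp (c * (Ln (- w) / c + 1 / 2)) = - w * exp (of_real pi * \<i>)"
        using w(2) by (simp add: ring_distribs exp_add) (simp add: c_def)
      then have "exp (c * (Ln (- w) / c + 1 / 2)) = w"
        by simp
      with h_exp[OF *[OF w]] show ?thesis
        by simp
    qed
    ultimately show ?thesis
      by (auto intro: holomorphic_transform)
  qed
  have "h holomorphic_on (ball 0 1 - \<real>\<^sub>\<le>\<^sub>0) \<union> (ball 0 1 - \<real>\<^sub>\<ge>\<^sub>0)"
    using hol_pos hol_neg by (intro holomorphic_on_Un open_Diff) auto
  moreover have "(ball 0 1 - \<real>\<^sub>\<le>\<^sub>0) \<union> (ball 0 1 - \<real>\<^sub>\<ge>\<^sub>0) = ball 0 1 - {0 :: complex}"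
    by (auto simp: complex_nonpos_Reals_iff complex_nonneg_Reals_iff complex_eq_iff)
  ultimately have hol': "h holomorphic_on ball 0 1 - {0}"
    by simp
  have "(h \<longlongrightarrow> h 0) (at 0 within ball 0 1)"
  proof -
    have "filterlim (\<lambda>w. Im (Ln w / c)) at_top (at 0)"
    proof -
      have "filterlim (\<lambda>w. cmod w) (at_right 0) (at (0 :: complex))"
        by (auto simp: filterlim_at eventually_at_filter intro!: tendsto_eq_intros)
      then have "filterlim (\<lambda>w. ln (cmod w)) at_bot (at (0 :: complex))"
        by (rule filterlim_compose[OF ln_at_0])
      then have "filterlim (\<lambda>w. - ln (cmod w)) at_top (at (0 :: complex))"
        by (rule filterlim_compose[OF filterlim_uminus_at_top_at_bot])
      then have "filterlim (\<lambda>w. (1 / (2 * pi)) * (- ln (cmod w))) at_top (at (0 :: complex))"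
        by (rule filterlim_tendsto_pos_mult_at_top[OF tendsto_const, rotated]) simp
      moreover have "eventually (\<lambda>w. (1 / (2 * pi)) * (- ln (cmod w)) = Im (Ln w / c)) (at (0 :: complex))"
        by (auto simp: eventually_at_filter Im_c)
      ultimately show ?thesis
        by (simp cong: filterlim_cong)
    qed
    then have "filterlim (\<lambda>w. Ln w / c) at_cusp (at 0)"
      by (simp add: filterlim_filtercomap_iff o_def)
    then have "((\<lambda>w. f (Ln w / c)) \<longlongrightarrow> 0) (at 0)"
      by (rule filterlim_compose[OF lim])
    then have "(h \<longlongrightarrow> 0) (at 0)"
      by (rule Lim_transform_eventually) (auto simp: eventually_at_filter h_def)
    then show ?thesis
      by (auto simp: h_def intro: tendsto_within_subset)
  qed
  then have "h holomorphic_on ball 0 1"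
    by (intro no_isolated_singularity'[OF _ hol']) simp_all
  then have "(h has_field_derivative deriv h 0) (at 0)"
    by (rule holomorphic_derivI) simp_all
  moreover have "h 0 = 0"
    by (simp add: h_def)
  ultimately have lim0: "((\<lambda>w. h w / w) \<longlongrightarrow> deriv h 0) (at 0)"
    by (simp add: has_field_derivative_iff)
  have "filterlim (\<lambda>z. exp (c * z)) (at 0) at_cusp"
    unfolding filterlim_at c_def qexp_def[symmetric] using qexp_tendsto_0_at_cusp by auto
  then have "((\<lambda>z. h (exp (c * z)) / exp (c * z)) \<longlongrightarrow> deriv h 0) at_cusp"
    by (rule filterlim_compose[OF lim0])
  moreover have "eventually (\<lambda>z. h (exp (c * z)) / exp (c * z) = f z / exp (c * z)) at_cusp"
    using eventually_upper_half_plane_at_cusp by (rule eventually_mono) (simp add: h_exp)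
  ultimately have "((\<lambda>z. f z / exp (c * z)) \<longlongrightarrow> deriv h 0) at_cusp"
    by (rule Lim_transform_eventually)
  then show ?thesis
    unfolding c_def qexp_def[symmetric] by (rule that)
qed

section \<open>The Taylor coefficients of the cotangent\<close>

definition sinc_pi :: "complex \<Rightarrow> complex" where
  "sinc_pi u = (if u = 0 then of_real pi else sin (of_real pi * u) / u)"

definition cot_regular_num :: "complex \<Rightarrow> complex" where
  "cot_regular_num u = (let g = (\<lambda>v. of_real pi * cos (of_real pi * v) - sinc_pi v) in
     if u = 0 then deriv g 0 else g u / u)"

text \<open>This is \<open>\<pi> cot (\<pi> u) - 1 / u\<close> with the singularity at \<open>0\<close> removed. Writing it as a quotient of two entire
  functions, the denominator being \<open>sin (\<pi> u) / u\<close>, makes it visibly holomorphic near \<open>0\<close>.\<close>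

definition cot_regular :: "complex \<Rightarrow> complex" where
  "cot_regular u = cot_regular_num u / sinc_pi u"

lemma holomorphic_on_sinc_pi: "sinc_pi holomorphic_on UNIV"
proof -
  have "((\<lambda>u. sin (of_real pi * u)) has_field_derivative of_real pi) (at (0 :: complex))"
    by (auto intro!: derivative_eq_intros)
  then have "deriv (\<lambda>u. sin (of_real pi * u)) (0 :: complex) = of_real pi"
    by (rule DERIV_imp_deriv)
  then have "sinc_pi = (\<lambda>u. if u = 0 then deriv (\<lambda>u. sin (of_real pi * u)) 0
      else (sin (of_real pi * u) - sin (of_real pi * 0)) / (u - 0))"
    by (simp add: sinc_pi_def fun_eq_iff)
  moreover have "\<dots> holomorphic_on UNIV"
    by (intro pole_lemma_open holomorphic_intros open_UNIV)
  ultimately show ?thesis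
    by (simp only:)
qed

lemma holomorphic_on_cot_regular_num: "cot_regular_num holomorphic_on UNIV"
proof -
  define g where "g = (\<lambda>v. of_real pi * cos (of_real pi * v) - sinc_pi v)"
  have "g 0 = 0"
    by (simp add: g_def sinc_pi_def)
  then have "cot_regular_num = (\<lambda>u. if u = 0 then deriv g 0 else (g u - g 0) / (u - 0))"
    by (simp add: cot_regular_num_def fun_eq_iff Let_def g_def)
  moreover have "\<dots> holomorphic_on UNIV"
    unfolding g_def by (intro pole_lemma_open holomorphic_intros open_UNIV holomorphic_on_sinc_pi)
  ultimately show ?thesis
    by (simp only:)
qed

lemma holomorphic_on_cot_regular:
  assumes "\<And>u. u \<in> A \<Longrightarrow> u = 0 \<or> sin (of_real pi * u) \<noteq> 0"
  shows "cot_regular holomorphic_on A"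
proof -
  have "sinc_pi u \<noteq> 0" if "u \<in> A" for u
    using assms[OF that] by (auto simp: sinc_pi_def)
  then have "(\<lambda>u. cot_regular_num u / sinc_pi u) holomorphic_on A"
    using holomorphic_on_subset[OF holomorphic_on_cot_regular_num]
      holomorphic_on_subset[OF holomorphic_on_sinc_pi]
    by (intro holomorphic_on_divide) auto
  then show ?thesis
    by (simp add: cot_regular_def [abs_def])
qed

lemma cot_regular_eq:
  assumes "u \<noteq> 0" "sin (of_real pi * u) \<noteq> 0"
  shows "cot_regular u = of_real pi * cot (of_real pi * u) - 1 / u"
  using assms by (simp add: cot_regular_def cot_regular_num_def sinc_pi_def Let_def cot_def field_simps)

lemma sin_pi_nonzero_near_0:
  assumes "u \<in> ball 0 1" "u \<noteq> 0"
  shows "sin (of_real pi * u :: complex) \<noteq> 0"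
proof
  assume "sin (of_real pi * u) = 0"
  then obtain n :: int where "of_real pi * u = of_real (n * pi)"
    by (auto simp: sin_eq_0)
  then have "u = of_int n"
    by simp
  with assms show False
    by auto
qed

lemma holomorphic_on_cot_regular_ball: "cot_regular holomorphic_on ball 0 1"
  by (rule holomorphic_on_cot_regular) (use sin_pi_nonzero_near_0 in blast)

text \<open>The equation \<open>cot' = - 1 - cot\<^sup>2\<close>, rewritten for the regular part. It determines the Taylor coefficients
  at \<open>0\<close> recursively.\<close>

lemma cot_regular_riccati:
  assumes "u \<in> ball 0 1" "u \<noteq> 0"
  shows "u * deriv cot_regular u + 2 * cot_regular u = - u * (of_real pi ^ 2 + cot_regular u ^ 2)"
proof -
  have nz: "sin (of_real pi * u) \<noteq> 0"
    using assms by (rule sin_pi_nonzero_near_0)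
  have alg: "p * ((- s * p * s - c * (c * p)) / (s * s)) = - (p ^ 2) * (s ^ 2 + c ^ 2) / s ^ 2" for p s c :: complex
    by (simp add: power2_eq_square algebra_simps)
  have "((\<lambda>u. of_real pi * (cos (of_real pi * u) / sin (of_real pi * u)) - 1 / u) has_field_derivative
      of_real pi * ((- sin (of_real pi * u) * of_real pi * sin (of_real pi * u) -
        cos (of_real pi * u) * (cos (of_real pi * u) * of_real pi)) /
        (sin (of_real pi * u) * sin (of_real pi * u))) + 1 / u ^ 2) (at u)"
    using nz assms(2)
    by (auto intro!: derivative_eq_intros simp: power2_eq_square algebra_simps)
  also have "of_real pi * ((- sin (of_real pi * u) * of_real pi * sin (of_real pi * u) -
        cos (of_real pi * u) * (cos (of_real pi * u) * of_real pi)) /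
        (sin (of_real pi * u) * sin (of_real pi * u))) =
      - (of_real pi ^ 2) * (sin (of_real pi * u) ^ 2 + cos (of_real pi * u) ^ 2) / sin (of_real pi * u) ^ 2"
    by (rule alg)
  finally have "((\<lambda>u. of_real pi * cot (of_real pi * u) - 1 / u) has_field_derivative
      (- (of_real pi ^ 2) / sin (of_real pi * u) ^ 2 + 1 / u ^ 2)) (at u)"
    by (simp only: cot_def sin_cos_squared_add mult_1_right)
  moreover have "eventually (\<lambda>v. v \<in> ball 0 1 - {0 :: complex}) (nhds u)"
    using assms by (intro eventually_nhds_in_open) auto
  then have "eventually (\<lambda>v. of_real pi * cot (of_real pi * v) - 1 / v = cot_regular v) (nhds u)"
    by (rule eventually_mono) (use cot_regular_eq sin_pi_nonzero_near_0 in auto)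
  ultimately have "(cot_regular has_field_derivative
      (- (of_real pi ^ 2) / sin (of_real pi * u) ^ 2 + 1 / u ^ 2)) (at u)"
    by (subst DERIV_cong_ev[OF refl _ refl, symmetric])
  then have d: "deriv cot_regular u = - (of_real pi ^ 2) / sin (of_real pi * u) ^ 2 + 1 / u ^ 2"
    by (rule DERIV_imp_deriv)
  define s c where "s = sin (of_real pi * u)" and "c = cos (of_real pi * u)"
  have sc: "s ^ 2 + c ^ 2 = 1"
    by (simp add: s_def c_def)
  have e: "cot_regular u = of_real pi * (c / s) - 1 / u"
    using cot_regular_eq[OF assms(2) nz] by (simp add: cot_def s_def c_def)
  have k: "1 / s ^ 2 = 1 + (c / s) ^ 2"
    using sc nz by (simp add: s_def field_simps)
  have "deriv cot_regular u = - (of_real pi ^ 2) * (1 / s ^ 2) + 1 / u ^ 2"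
    unfolding d s_def by simp
  also have "\<dots> = - (of_real pi ^ 2) * (1 + (c / s) ^ 2) + 1 / u ^ 2"
    by (simp only: k)
  finally have "deriv cot_regular u = - (of_real pi ^ 2) * (1 + (c / s) ^ 2) + 1 / u ^ 2" .
  moreover have "u * (- (p ^ 2) * (1 + w ^ 2) + 1 / u ^ 2) + 2 * (p * w - 1 / u) =
      - u * (p ^ 2 + (p * w - 1 / u) ^ 2)" for p w
    using assms(2) by (simp add: field_simps power2_eq_square)
  ultimately show ?thesis
    unfolding e by (simp only:)
qed

lemma cot_regular_taylor:
  shows "deriv cot_regular 0 = - (of_real pi ^ 2) / 3"
    and "(deriv ^^ 3) cot_regular 0 = - 2 * of_real pi ^ 4 / 15"
    and "(deriv ^^ 5) cot_regular 0 = - 16 * of_real pi ^ 6 / 63"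
proof -
  define F where "F = fps_expansion cot_regular 0"
  define P :: complex where "P = of_real pi"
  have F: "cot_regular has_fps_expansion F"
    unfolding F_def using holomorphic_on_cot_regular_ball
    by (intro analytic_at_imp_has_fps_expansion_0) (auto simp: analytic_at intro!: exI[of _ "ball 0 1"])
  have lhs: "(\<lambda>u. u * deriv cot_regular u + 2 * cot_regular u) has_fps_expansion
      (fps_X * fps_deriv F + 2 * F)"
    by (intro fps_expansion_intros F)
  have rhs: "(\<lambda>u. - u * (P ^ 2 + cot_regular u ^ 2)) has_fps_expansion
      (- fps_X * (fps_const P ^ 2 + F ^ 2))"
    by (intro fps_expansion_intros F)
  have ev: "eventually (\<lambda>u. u * deriv cot_regular u + 2 * cot_regular u = - u * (P ^ 2 + cot_regular u ^ 2)) (at 0)"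
    using eventually_at_in_open[of "ball 0 1" "0 :: complex"]
    by (auto elim!: eventually_mono simp: P_def cot_regular_riccati)
  have "0 * deriv cot_regular 0 + 2 * cot_regular 0 = - 0 * (P ^ 2 + cot_regular 0 ^ 2)"
  proof (rule tendsto_unique)
    show "at (0 :: complex) \<noteq> bot" by simp
    have "((\<lambda>u. u * deriv cot_regular u + 2 * cot_regular u) \<longlongrightarrow> 0 * deriv cot_regular 0 + 2 * cot_regular 0) (at 0)"
      using has_fps_expansion_imp_continuous[OF lhs] by (simp add: continuous_within)
    then show "((\<lambda>u. - u * (P ^ 2 + cot_regular u ^ 2)) \<longlongrightarrow> 0 * deriv cot_regular 0 + 2 * cot_regular 0) (at 0)"
      using ev by (rule Lim_transform_eventually)
    show "((\<lambda>u. - u * (P ^ 2 + cot_regular u ^ 2)) \<longlongrightarrow> - 0 * (P ^ 2 + cot_regular 0 ^ 2)) (at 0)"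
      using has_fps_expansion_imp_continuous[OF rhs] by (simp add: continuous_within)
  qed
  with ev have "eventually (\<lambda>u. u * deriv cot_regular u + 2 * cot_regular u = - u * (P ^ 2 + cot_regular u ^ 2)) (nhds 0)"
    by (auto simp: eventually_nhds_conv_at)
  with lhs have "(\<lambda>u. - u * (P ^ 2 + cot_regular u ^ 2)) has_fps_expansion (fps_X * fps_deriv F + 2 * F)"
    by (rule has_fps_expansion_cong[THEN iffD1, rotated -1, OF _ _ refl])
  with rhs have eq: "fps_X * fps_deriv F + 2 * F = - fps_X * (fps_const P ^ 2 + F ^ 2)"
    using fps_expansion_unique_complex by blast
  \<comment> \<open>Comparing coefficients in the differential equation gives a recursion that starts with
    \<open>3 F\<^sub>1 = - \<pi>\<^sup>2\<close> and makes the even coefficients vanish.\<close>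
  have rec: "of_nat (n + 2) * fps_nth F n =
      - (if n = 0 then 0 else (if n = 1 then P ^ 2 else 0) + (\<Sum>i=0..n-1. fps_nth F i * fps_nth F (n - 1 - i)))" for n
  proof -
    define G where "G = fps_const P ^ 2 + F ^ 2"
    have G: "fps_nth G m = (if m = 0 then P ^ 2 else 0) + (\<Sum>i=0..m. fps_nth F i * fps_nth F (m - i))" for m
      unfolding G_def by (simp add: power2_eq_square fps_mult_nth[of F F])
    have "fps_X * fps_deriv F + fps_const 2 * F = - (fps_X * G)"
      using eq by (simp add: G_def numeral_fps_const)
    then have "fps_nth (fps_X * fps_deriv F + fps_const 2 * F) n = fps_nth (- (fps_X * G)) n"
      by simp
    then show ?thesis
      by (cases n) (simp_all add: fps_X_mult_nth G algebra_simps)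
  qed
  have F0: "fps_nth F 0 = 0"
    using rec[of 0] by simp
  have F1: "fps_nth F 1 = - (P ^ 2) / 3"
    using rec[of 1] F0 by (simp add: field_simps)
  have F2: "fps_nth F 2 = 0"
    using rec[of 2] F0 by (simp add: eval_nat_numeral)
  have F3: "fps_nth F 3 = - (P ^ 4) / 45"
  proof -
    have "5 * fps_nth F 3 = - (fps_nth F 1 * fps_nth F 1)"
      using rec[of 3] F0 F2 by (simp add: eval_nat_numeral)
    then show ?thesis
      unfolding F1 by (simp add: field_simps eval_nat_numeral)
  qed
  have F4: "fps_nth F 4 = 0"
    using rec[of 4] F0 F2 F1 F3 by (simp add: eval_nat_numeral)
  have F5: "fps_nth F 5 = - 2 * (P ^ 6) / 945"
  proof -
    have "7 * fps_nth F 5 = - (2 * (fps_nth F 1 * fps_nth F 3))"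
      using rec[of 5] F0 F2 F4 by (simp add: eval_nat_numeral eq_neg_iff_add_eq_0 algebra_simps)
    then show ?thesis
      unfolding F1 F3 by (simp add: field_simps eval_nat_numeral)
  qed
  have D: "(deriv ^^ n) cot_regular 0 = fact n * fps_nth F n" for n
    by (simp add: F_def fps_expansion_def)
  show "deriv cot_regular 0 = - (of_real pi ^ 2) / 3"
    using D[of 1] F1 by (simp add: P_def)
  show "(deriv ^^ 3) cot_regular 0 = - 2 * of_real pi ^ 4 / 15"
    using D[of 3] F3 by (simp add: P_def fact_numeral)
  show "(deriv ^^ 5) cot_regular 0 = - 16 * of_real pi ^ 6 / 63"
    using D[of 5] F5 by (simp add: P_def fact_numeral)
qed

section \<open>Quasi-periods of the logarithmic derivative of theta\<close>

text \<open>The summand for \<open>r = 0\<close> is \<open>0\<close>, because \<open>q ^ 0 / (1 - q ^ 0)\<close> is a division by zero. The series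
  thus effectively starts at \<open>r = 1\<close>.\<close>

definition lambert :: "nat \<Rightarrow> complex \<Rightarrow> complex \<Rightarrow> complex" where
  "lambert k q y = suminf (\<lambda>r. of_nat r ^ k * (q ^ r / (1 - q ^ r)) * y ^ r)"

lemma power_series_diff_summable:
  fixes a :: "nat \<Rightarrow> complex"
  assumes "\<And>y. cmod y < R \<Longrightarrow> summable (\<lambda>r. a r * y ^ r)" "cmod y < R"
  shows "(\<lambda>r. of_nat r * a r * y ^ r) sums (y * suminf (\<lambda>r. diffs a r * y ^ r))"
proof -
  have "summable (\<lambda>r. diffs a r * y ^ r)"
    using termdiff_converges[of y R a] assms by simp
  from sums_mult[OF diffs_equiv[OF this], of y]
  have "(\<lambda>r. y * (of_nat r * a r * y ^ (r - Suc 0))) sums (y * suminf (\<lambda>r. diffs a r * y ^ r))" .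
  moreover have "y * (of_nat r * a r * y ^ (r - Suc 0)) = of_nat r * a r * y ^ r" for r
    by (cases r) auto
  ultimately show ?thesis
    by simp
qed

lemma qexp_series_derivative:
  fixes a :: "nat \<Rightarrow> complex"
  assumes "\<And>y. cmod y < R \<Longrightarrow> summable (\<lambda>r. a r * y ^ r)" "cmod (qexp u) < R"
  shows "((\<lambda>u. suminf (\<lambda>r. a r * qexp u ^ r)) has_field_derivative
           2 * of_real pi * \<i> * suminf (\<lambda>r. of_nat r * a r * qexp u ^ r)) (at u)"
proof -
  have "((\<lambda>y. suminf (\<lambda>r. a r * y ^ r)) has_field_derivative suminf (\<lambda>r. diffs a r * qexp u ^ r)) (at (qexp u))"
    using assms by (intro termdiffs_strong'[of R]) auto
  note D = DERIV_chain2[OF this has_field_derivative_qexp]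
  have eq: "suminf (\<lambda>r. of_nat r * a r * qexp u ^ r) = qexp u * suminf (\<lambda>r. diffs a r * qexp u ^ r)"
    by (rule sums_unique[OF power_series_diff_summable[OF assms], symmetric])
  show ?thesis
    unfolding eq using D by (simp add: mult_ac)
qed

text \<open>Differentiation with respect to \<open>u\<close> multiplies the term \<open>qexp u ^ r\<close> by \<open>2 \<pi> \<i> r\<close>. This turns the
  parameter \<open>k\<close> of the Lambert series into an order of derivation.\<close>

lemma qexp_series_higher_deriv:
  fixes a :: "nat \<Rightarrow> complex"
  assumes "\<And>y. cmod y < R \<Longrightarrow> summable (\<lambda>r. a r * y ^ r)" "cmod (qexp u) < R"
  shows "(deriv ^^ k) (\<lambda>u. suminf (\<lambda>r. a r * qexp u ^ r)) u =
           (2 * of_real pi * \<i>) ^ k * suminf (\<lambda>r. of_nat r ^ k * a r * qexp u ^ r)"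
  using assms
proof (induction k arbitrary: u)
  case (Suc k)
  let ?F = "\<lambda>k u. (2 * of_real pi * \<i>) ^ k * suminf (\<lambda>r. of_nat r ^ k * a r * qexp u ^ r)"
  have summ: "summable (\<lambda>r. of_nat r ^ j * a r * y ^ r)" if "cmod y < R" for j y
    using that
  proof (induction j arbitrary: y)
    case (Suc j)
    from power_series_diff_summable[of R "\<lambda>r. of_nat r ^ j * a r", OF Suc]
    show ?case
      by (auto simp: sums_iff mult_ac)
  qed (use Suc.prems(1) in auto)
  have op: "open {u. cmod (qexp u) < R}"
    unfolding qexp_def by (intro open_Collect_less continuous_intros)
  have "eventually (\<lambda>u. u \<in> {u. cmod (qexp u) < R}) (nhds u)"
    using op Suc.prems(2) by (intro eventually_nhds_in_open) auto
  then have "eventually (\<lambda>u. (deriv ^^ k) (\<lambda>u. suminf (\<lambda>r. a r * qexp u ^ r)) u = ?F k u) (nhds u)"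
    by (rule eventually_mono) (use Suc.IH Suc.prems(1) in auto)
  then have "(deriv ^^ Suc k) (\<lambda>u. suminf (\<lambda>r. a r * qexp u ^ r)) u = deriv (?F k) u"
    unfolding funpow.simps o_def by (rule deriv_cong_ev) auto
  also have "\<dots> = ?F (Suc k) u"
    using qexp_series_derivative[of R "\<lambda>r. of_nat r ^ k * a r" u, OF summ Suc.prems(2)]
    by (intro DERIV_imp_deriv) (auto intro!: derivative_eq_intros simp: mult_ac)
  finally show ?case .
qed auto

lemma norm_one_minus_power_ge:
  assumes "cmod q < 1" "r > 0"
  shows "cmod (1 - q ^ r) \<ge> 1 - cmod q"
proof -
  have "cmod q ^ r \<le> cmod q ^ 1"
    using assms by (intro power_decreasing) auto
  then have "1 - cmod q \<le> cmod 1 - cmod (q ^ r)"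
    by (simp add: norm_power)
  also have "\<dots> \<le> cmod (1 - q ^ r)"
    by (rule norm_triangle_ineq2)
  finally show ?thesis .
qed

lemma summable_lambert_0:
  assumes "cmod q < 1" "cmod (q * y) < 1"
  shows "summable (\<lambda>r. q ^ r / (1 - q ^ r) * y ^ r)"
proof (rule summable_comparison_test)
  show "summable (\<lambda>r. 1 / (1 - cmod q) * cmod (q * y) ^ r)"
    using assms(2) by (intro summable_mult summable_geometric) simp
  have "cmod (q ^ r / (1 - q ^ r) * y ^ r) \<le> 1 / (1 - cmod q) * cmod (q * y) ^ r" for r
  proof (cases "r = 0")
    case False
    have "cmod (q ^ r / (1 - q ^ r) * y ^ r) = cmod (q * y) ^ r / cmod (1 - q ^ r)"
      by (simp add: norm_mult norm_divide norm_power power_mult_distrib)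
    also have "\<dots> \<le> cmod (q * y) ^ r / (1 - cmod q)"
      using norm_one_minus_power_ge[of q r] assms(1) False by (intro divide_left_mono mult_pos_pos) auto
    finally show ?thesis
      by simp
  qed (use assms(1) in auto)
  then show "\<exists>N. \<forall>r\<ge>N. cmod (q ^ r / (1 - q ^ r) * y ^ r) \<le> 1 / (1 - cmod q) * cmod (q * y) ^ r"
    by blast
qed

text \<open>The factor \<open>1 - q ^ r\<close> cancels the denominator and leaves a geometric series. This is the source of the
  quasi-period below.\<close>

lemma lambert_shift:
  assumes "cmod q < 1" "cmod (q * y) < 1"
  shows "lambert 0 q y - lambert 0 q (q * y) = q * y / (1 - q * y)"
proof -
  have "cmod (q * (q * y)) = cmod q * cmod (q * y)"
    by (simp add: norm_mult)
  also have "\<dots> < 1 * 1"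
    using assms by (intro mult_strict_mono') auto
  finally have "cmod (q * (q * y)) < 1"
    by simp
  then have "lambert 0 q y - lambert 0 q (q * y) =
      suminf (\<lambda>r. q ^ r / (1 - q ^ r) * y ^ r - q ^ r / (1 - q ^ r) * (q * y) ^ r)"
    unfolding lambert_def power_0 mult_1
    using assms by (intro suminf_diff summable_lambert_0)
  also have "\<dots> = suminf (\<lambda>r. (q * y) ^ r * (if r = 0 then 0 else 1))"
  proof (rule suminf_cong)
    fix r
    define c where "c = q ^ r / (1 - q ^ r)"
    have "c * (1 - q ^ r) = q ^ r" if "r > 0"
      using norm_one_minus_power_ge[of q r] assms(1) that by (auto simp: c_def)
    moreover have "c * y ^ r - c * (q * y) ^ r = c * (1 - q ^ r) * y ^ r"
      by (simp add: algebra_simps power_mult_distrib)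
    ultimately show "c * y ^ r - c * (q * y) ^ r = (q * y) ^ r * (if r = 0 then 0 else 1)"
      by (cases "r = 0") (auto simp: c_def power_mult_distrib)
  qed
  also have "\<dots> = q * y / (1 - q * y)"
  proof -
    have "(\<lambda>r. q * y * (q * y) ^ r) sums (q * y * (1 / (1 - q * y)))"
      using geometric_sums[OF assms(2)] by (rule sums_mult)
    then have "(\<lambda>r. (q * y) ^ Suc r * (if Suc r = 0 then 0 else 1)) sums (q * y / (1 - q * y))"
      by simp
    then have "(\<lambda>r. (q * y) ^ r * (if r = 0 then 0 else 1)) sums (q * y / (1 - q * y))"
      by (subst (asm) sums_Suc_iff) simp
    then show ?thesis
      by (simp add: sums_iff)
  qed
  finally show ?thesis .
qed

lemma holomorphic_on_lambert_0:
  assumes "cmod q < 1"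
  shows "lambert 0 q holomorphic_on {y. cmod (q * y) < 1}"
proof (cases "q = 0")
  case True
  have "q ^ r / (1 - q ^ r) * y ^ r = 0" for r y
    by (cases r) (auto simp: True)
  then have "lambert 0 q y = 0" for y
    by (simp only: lambert_def power_0 mult_1 suminf_zero)
  then have "lambert 0 q = (\<lambda>_. 0)"
    by (simp add: fun_eq_iff)
  then show ?thesis
    by simp
next
  case False
  then have eq: "{y. cmod (q * y) < 1} = ball 0 (1 / cmod q)"
    by (auto simp: norm_mult field_simps)
  show ?thesis
    unfolding eq
  proof (rule power_series_holomorphic)
    fix w :: complex
    assume "w \<in> ball 0 (1 / cmod q)"
    then have "cmod (q * w) < 1"
      using False by (simp add: norm_mult field_simps)
    from summable_sums[OF summable_lambert_0[OF assms this]]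
    show "(\<lambda>r. q ^ r / (1 - q ^ r) * (w - 0) ^ r) sums lambert 0 q w"
      by (simp add: lambert_def)
  qed
qed

text \<open>The logarithmic derivative in \<open>u\<close> of the odd Jacobi theta function, whose zeros are the points of the
  lattice spanned by \<open>1\<close> and \<open>z\<close>. The two Lambert series converge for
  \<open>\<bar>Im u\<bar> < Im z\<close>.\<close>

definition theta_logderiv :: "complex \<Rightarrow> complex \<Rightarrow> complex" where
  "theta_logderiv z u = of_real pi * cot (of_real pi * u) -
     2 * of_real pi * \<i> * (lambert 0 (qexp z) (qexp u) - lambert 0 (qexp z) (qexp (- u)))"

text \<open>The same function without its pole at \<open>u = 0\<close>.\<close>

definition theta_logderiv_reg :: "complex \<Rightarrow> complex \<Rightarrow> complex" where
  "theta_logderiv_reg z u = cot_regular u -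
     2 * of_real pi * \<i> * (lambert 0 (qexp z) (qexp u) - lambert 0 (qexp z) (qexp (- u)))"

lemma theta_logderiv_reg_eq:
  assumes "u \<noteq> 0" "sin (of_real pi * u) \<noteq> 0"
  shows "theta_logderiv_reg z u = theta_logderiv z u - 1 / u"
  using cot_regular_eq[OF assms] by (simp add: theta_logderiv_reg_def theta_logderiv_def)

lemma theta_logderiv_minus: "theta_logderiv z (- u) = - theta_logderiv z u"
  by (simp add: theta_logderiv_def cot_def algebra_simps)

lemma theta_logderiv_plus_1: "theta_logderiv z (u + 1) = theta_logderiv z u"
proof -
  have "cot (of_real pi * (u + 1)) = cot (of_real pi * u)"
    by (simp add: cot_def ring_distribs sin_add cos_add flip: sin_of_real cos_of_real)
  moreover have "qexp (u + 1) = qexp u" "qexp (- (u + 1)) = qexp (- u)"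
    unfolding qexp_minus by (simp_all add: qexp_add)
  ultimately show ?thesis
    by (simp add: theta_logderiv_def)
qed

lemma cot_pi_qexp:
  assumes "qexp u \<noteq> 1"
  shows "cot (of_real pi * u) = \<i> * (qexp u + 1) / (qexp u - 1)"
proof -
  define E where "E = exp (\<i> * (of_real pi * u))"
  have E: "qexp u = E ^ 2"
    unfolding E_def qexp_def exp_double[symmetric] by (simp add: mult_ac)
  have [simp]: "E \<noteq> 0"
    by (simp add: E_def)
  have "cos (of_real pi * u) = (E + inverse E) / 2" "sin (of_real pi * u) = (E - inverse E) / (2 * \<i>)"
    by (simp_all add: E_def cos_exp_eq sin_exp_eq exp_minus)
  moreover have "(A / 2) / (B / (2 * \<i>)) = \<i> * A / B" for A B
    by (cases "B = 0") (simp_all add: field_simps)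
  ultimately have "cot (of_real pi * u) = \<i> * (E + inverse E) / (E - inverse E)"
    by (simp only: cot_def)
  also have "\<dots> = \<i> * (E * (E + inverse E)) / (E * (E - inverse E))"
    by simp
  also have "\<dots> = \<i> * (E ^ 2 + 1) / (E ^ 2 - 1)"
    by (simp add: ring_distribs power2_eq_square del: mult_divide_mult_cancel_left_if)
  finally show ?thesis
    unfolding E .
qed

text \<open>The lower bound on \<open>Im u\<close> keeps both \<open>u\<close> and \<open>u + z\<close> in the strip of convergence. Put \<open>x = qexp u\<close> and
  \<open>q = qexp z\<close>. The change of the cotangent, a rational function of \<open>x\<close>, and the change of the Lambert
  series, evaluated by \<open>lambert_shift\<close>, add up to a constant.\<close>

lemma theta_logderiv_plus_period:
  assumes "- Im z < Im u" "Im u < 0"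
  shows "theta_logderiv z (u + z) = theta_logderiv z u - 2 * of_real pi * \<i>"
proof -
  define q x where "q = qexp z" and "x = qexp u"
  have [simp]: "x \<noteq> 0" "q \<noteq> 0"
    by (simp_all add: x_def q_def)
  have q1: "cmod q < 1"
    using assms by (simp add: q_def norm_qexp_less_1_iff upper_half_plane_def)
  have qx1: "cmod (q * x) < 1"
    using assms unfolding q_def x_def qexp_add[symmetric] norm_qexp_less_1_iff upper_half_plane_def by simp
  have x1: "cmod (inverse x) < 1"
    using assms unfolding x_def qexp_minus[symmetric] norm_qexp_less_1_iff upper_half_plane_def by simp
  have ne: "x \<noteq> 1" "q * x \<noteq> 1"
    using qx1 x1 by auto
  have a: "lambert 0 q x - lambert 0 q (q * x) = q * x / (1 - q * x)"
    using q1 qx1 by (rule lambert_shift)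
  have qx: "q * inverse (q * x) = inverse x"
    by simp
  have "lambert 0 q (inverse (q * x)) - lambert 0 q (q * inverse (q * x)) =
      q * inverse (q * x) / (1 - q * inverse (q * x))"
    using q1 x1 unfolding qx[symmetric] by (rule lambert_shift)
  from this[unfolded qx] have b: "lambert 0 q (inverse (q * x)) - lambert 0 q (inverse x) = inverse x / (1 - inverse x)" .
  have c: "cot (of_real pi * u) = \<i> * (x + 1) / (x - 1)"
    using cot_pi_qexp[of u] ne by (simp add: x_def)
  have d: "cot (of_real pi * (u + z)) = \<i> * (q * x + 1) / (q * x - 1)"
    using cot_pi_qexp[of "u + z"] ne by (simp add: x_def q_def qexp_add mult.commute)
  have x': "qexp (u + z) = q * x" "qexp (- (u + z)) = inverse (q * x)" "qexp (- u) = inverse x"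
    unfolding q_def x_def qexp_minus by (simp_all add: qexp_add mult.commute)
  have "theta_logderiv z (u + z) - theta_logderiv z u = of_real pi * (\<i> * (q * x + 1) / (q * x - 1) - \<i> * (x + 1) / (x - 1)) -
      2 * of_real pi * \<i> * (- (q * x / (1 - q * x)) - inverse x / (1 - inverse x))"
    unfolding theta_logderiv_def c d x' a[symmetric] b[symmetric] q_def[symmetric] x_def[symmetric]
    by (simp add: algebra_simps)
  also have "\<i> * (q * x + 1) / (q * x - 1) - \<i> * (x + 1) / (x - 1) = 2 * \<i> * (1 / (q * x - 1) - 1 / (x - 1))"
    using ne by (simp add: field_simps)
  also have "inverse x / (1 - inverse x) = 1 / (x - 1)"
    using ne by (simp add: field_simps)
  also have "q * x / (1 - q * x) = - 1 - 1 / (q * x - 1)"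
    using ne by (simp add: field_simps)
  finally show ?thesis
    by (simp add: algebra_simps)
qed

section \<open>Inversion of the lattice\<close>

text \<open>These are the points \<open>s + t z\<close> with \<open>\<bar>s\<bar>, \<bar>t\<bar> < 1\<close>, expressed through real and imaginary parts. The cell
  contains a closed fundamental parallelogram of the lattice, and \<open>0\<close> is the only lattice point in it. It
  lies in the strip of convergence, and dividing it by \<open>z\<close> gives the cell of \<open>- 1 / z\<close>.\<close>

definition cell :: "complex \<Rightarrow> complex set" where
  "cell z = {u. \<bar>Im u / Im z\<bar> < 1 \<and> \<bar>Re u - Im u / Im z * Re z\<bar> < 1}"

lemma in_cell_iff:
  assumes "z \<in> upper_half_plane"
  shows "of_real s + of_real t * z \<in> cell z \<longleftrightarrow> \<bar>s\<bar> < 1 \<and> \<bar>t\<bar> < 1"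
proof -
  have "Im (of_real s + of_real t * z) / Im z = t"
    using assms by (simp add: upper_half_plane_def)
  then show ?thesis
    unfolding cell_def mem_Collect_eq by (simp only:) auto
qed

lemma in_cellE:
  assumes "z \<in> upper_half_plane" "u \<in> cell z"
  obtains s t where "u = of_real s + of_real t * z" "\<bar>s\<bar> < 1" "\<bar>t\<bar> < 1"
proof
  show "u = of_real (Re u - Im u / Im z * Re z) + of_real (Im u / Im z) * z"
    using assms(1) by (simp add: complex_eq_iff upper_half_plane_def)
qed (use assms(2) in \<open>auto simp: cell_def\<close>)

lemma open_cell: "open (cell z)"
  unfolding cell_def divide_inverse by (intro open_Collect_conj open_Collect_less continuous_intros)

lemma connected_cell:
  assumes "z \<in> upper_half_plane"
  shows "connected (cell z)"
proof -
  have "cell z = (\<lambda>(s, t). of_real s + of_real t * z) ` ({-1<..<1} \<times> {-1<..<1})"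
    using assms by (auto simp: in_cell_iff abs_less_iff image_iff elim!: in_cellE[OF assms])
  moreover have "connected ((\<lambda>(s, t). of_real s + of_real t * z) ` ({-1<..<1} \<times> {-1<..<1}))"
    unfolding case_prod_unfold
    by (intro connected_continuous_image connected_Times continuous_intros) auto
  ultimately show ?thesis
    by simp
qed

lemma zero_in_cell: "0 \<in> cell z"
  by (simp add: cell_def)

lemma Im_in_cell:
  assumes "z \<in> upper_half_plane" "u \<in> cell z"
  shows "\<bar>Im u\<bar> < Im z"
  using assms by (auto simp: cell_def upper_half_plane_def field_simps)

lemma uminus_in_cell: "u \<in> cell z \<Longrightarrow> - u \<in> cell z"
  by (auto simp: cell_def abs_less_iff)

lemma divide_in_cell:
  assumes "z \<in> upper_half_plane" "u \<in> cell z"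
  shows "u / z \<in> cell (- (1 / z))"
proof -
  from assms obtain s t where u: "u = of_real s + of_real t * z" "\<bar>s\<bar> < 1" "\<bar>t\<bar> < 1"
    by (rule in_cellE)
  have "u / z = of_real t + of_real (- s) * (- (1 / z))"
    using upper_half_plane_nonzero[OF assms(1)] by (simp add: u field_simps)
  then show ?thesis
    using u(2,3) in_cell_iff[OF minus_inverse_in_upper_half_plane[OF assms(1)], of t "- s"] by simp
qed

lemma sin_pi_nonzero_in_cell:
  assumes "z \<in> upper_half_plane" "u \<in> cell z" "u \<noteq> 0"
  shows "sin (of_real pi * u) \<noteq> 0"
proof
  assume "sin (of_real pi * u) = 0"
  then obtain n :: int where "of_real pi * u = of_real (n * pi)"
    by (auto simp: sin_eq_0)
  then have "u = of_int n"
    by simp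
  with assms(2,3) show False
    by (auto simp: cell_def)
qed

lemma holomorphic_on_lambert_qexp:
  assumes "z \<in> upper_half_plane" "\<And>u. u \<in> A \<Longrightarrow> - Im z < Im u"
  shows "(\<lambda>u. lambert 0 (qexp z) (qexp u)) holomorphic_on A"
proof -
  have "(lambert 0 (qexp z) \<circ> qexp) holomorphic_on A"
  proof (rule holomorphic_on_compose_gen[OF _ holomorphic_on_lambert_0])
    show "cmod (qexp z) < 1"
      using assms(1) by (simp add: norm_qexp_less_1_iff)
    show "qexp ` A \<subseteq> {y. cmod (qexp z * y) < 1}"
      using assms(2) by (auto simp flip: qexp_add simp: norm_qexp_less_1_iff upper_half_plane_def dest!: assms(2))
    show "qexp holomorphic_on A"
      by (intro holomorphic_intros)
  qed
  then show ?thesis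
    by (simp add: o_def)
qed

lemma holomorphic_on_cell_parts:
  assumes "z \<in> upper_half_plane"
  shows "cot_regular holomorphic_on cell z"
    and "(\<lambda>u. lambert 0 (qexp z) (qexp u)) holomorphic_on cell z"
    and "(\<lambda>u. lambert 0 (qexp z) (qexp (- u))) holomorphic_on cell z"
proof -
  show "cot_regular holomorphic_on cell z"
    using sin_pi_nonzero_in_cell[OF assms] by (intro holomorphic_on_cot_regular) blast
  show *: "(\<lambda>u. lambert 0 (qexp z) (qexp u)) holomorphic_on cell z"
  proof (rule holomorphic_on_lambert_qexp[OF assms])
    show "- Im z < Im u" if "u \<in> cell z" for u
      using Im_in_cell[OF assms that] by linarith
  qed
  have "((\<lambda>u. lambert 0 (qexp z) (qexp u)) \<circ> uminus) holomorphic_on cell z"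
    by (rule holomorphic_on_compose_gen[OF _ *]) (auto intro: holomorphic_intros uminus_in_cell)
  then show "(\<lambda>u. lambert 0 (qexp z) (qexp (- u))) holomorphic_on cell z"
    by (simp add: o_def)
qed

lemma holomorphic_on_theta_logderiv_reg:
  assumes "z \<in> upper_half_plane"
  shows "theta_logderiv_reg z holomorphic_on cell z"
proof -
  have "(\<lambda>u. cot_regular u - 2 * of_real pi * \<i> *
      (lambert 0 (qexp z) (qexp u) - lambert 0 (qexp z) (qexp (- u)))) holomorphic_on cell z"
    by (intro holomorphic_intros holomorphic_on_cell_parts assms)
  then show ?thesis
    by (simp add: theta_logderiv_reg_def [abs_def])
qed

text \<open>Let \<open>J\<close> be the logarithmic derivative of theta for \<open>z\<close> and \<open>J'\<close> that for \<open>z' = - 1 / z\<close>. The function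
  \<open>L u = J u - J' (u / z) / z + 2 \<pi> \<i> u / z\<close> has no pole at \<open>0\<close>. The step \<open>1\<close> in \<open>u\<close> is the step \<open>- z'\<close> in
  \<open>u / z\<close>, the step \<open>z\<close> is the step \<open>1\<close>; in both cases the linear term compensates the quasi-period, so \<open>L\<close>
  has periods \<open>1\<close> and \<open>z\<close> as far as the cell allows. This is enough for the maximum principle: \<open>L\<close>
  attains on a closed parallelogram inside the open cell every value that it takes on the cell.
  Hence \<open>L\<close> is constant, and being odd it is \<open>0\<close>.\<close>

lemma theta_logderiv_reg_inversion:
  assumes z: "z \<in> upper_half_plane" and u: "u \<in> cell z"
  shows "theta_logderiv_reg z u = theta_logderiv_reg (- (1 / z)) (u / z) / z - 2 * of_real pi * \<i> * u / z"
proof -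
  define z' where "z' = - (1 / z)"
  define par where "par = (\<lambda>s t. of_real s + of_real t * z)"
  define L where "L = (\<lambda>u. theta_logderiv_reg z u - theta_logderiv_reg z' (u / z) / z + 2 * of_real pi * \<i> * u / z)"
  have z0: "z \<noteq> 0"
    using z by (rule upper_half_plane_nonzero)
  have z': "z' \<in> upper_half_plane"
    unfolding z'_def using z by (rule minus_inverse_in_upper_half_plane)
  have zz': "1 / z = - z'"
    by (simp add: z'_def)
  have Imz: "Im z > 0" "Im z' > 0"
    using z z' by (auto simp: upper_half_plane_def)
  have par_cell: "par s t \<in> cell z \<longleftrightarrow> \<bar>s\<bar> < 1 \<and> \<bar>t\<bar> < 1" for s t
    unfolding par_def using z by (rule in_cell_iff)
  have par_0: "par s t = 0 \<longleftrightarrow> s = 0 \<and> t = 0" for s t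
    using Imz by (auto simp: par_def complex_eq_iff)
  have par_z: "par s t / z = of_real t - of_real s * z'" for s t
    using z0 by (simp add: par_def z'_def field_simps)
  have hol: "L holomorphic_on cell z"
  proof -
    have "(theta_logderiv_reg z' \<circ> (\<lambda>u. u / z)) holomorphic_on cell z"
      using divide_in_cell[OF z] z0
      by (intro holomorphic_on_compose_gen[OF _ holomorphic_on_theta_logderiv_reg[OF z']] holomorphic_intros)
        (auto simp: z'_def)
    then show ?thesis
      unfolding L_def o_def using z0 by (intro holomorphic_intros holomorphic_on_theta_logderiv_reg[OF z]) auto
  qed
  have L_eq: "L u = theta_logderiv z u - theta_logderiv z' (u / z) / z + 2 * of_real pi * \<i> * u / z"
    if "u \<in> cell z" "u \<noteq> 0" for u
  proof -
    have "u / z \<in> cell z'" "u / z \<noteq> 0"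
      using divide_in_cell[OF z] that z0 by (auto simp: z'_def)
    then have e1: "theta_logderiv_reg z' (u / z) = theta_logderiv z' (u / z) - 1 / (u / z)"
      using sin_pi_nonzero_in_cell[OF z'] by (intro theta_logderiv_reg_eq) blast+
    have e2: "theta_logderiv_reg z u = theta_logderiv z u - 1 / u"
      using sin_pi_nonzero_in_cell[OF z] that by (intro theta_logderiv_reg_eq) auto
    have "1 / (u / z) / z = 1 / u"
      using z0 by simp
    then show ?thesis
      unfolding L_def e1 e2 diff_divide_distrib by simp
  qed
  have L_s: "L (par (s + 1) t) = L (par s t)" if "- 1 < s" "s < 0" "\<bar>t\<bar> < 1" for s t
  proof -
    define w where "w = par s t / z - z'"
    have w: "par (s + 1) t / z = w" "par s t / z = w + z'"
      by (simp_all add: w_def par_z algebra_simps)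
    have p: "par (s + 1) t = par s t + 1"
      by (simp add: par_def)
    have "Im w = (- s - 1) * Im z'"
      by (simp add: w_def par_z algebra_simps)
    moreover have "- 1 * Im z' < (- s - 1) * Im z'" "(- s - 1) * Im z' < 0"
      using that Imz by (intro mult_strict_right_mono mult_neg_pos; simp)+
    ultimately have e: "theta_logderiv z' (w + z') = theta_logderiv z' w - 2 * of_real pi * \<i>"
      by (intro theta_logderiv_plus_period) auto
    have a: "L (par (s + 1) t) = theta_logderiv z (par (s + 1) t) - theta_logderiv z' w / z + 2 * of_real pi * \<i> * par (s + 1) t / z"
      using that unfolding w(1)[symmetric] by (intro L_eq) (auto simp: par_cell par_0)
    have b: "L (par s t) = theta_logderiv z (par s t) - theta_logderiv z' (w + z') / z + 2 * of_real pi * \<i> * par s t / z"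
      using that unfolding w(2)[symmetric] by (intro L_eq) (auto simp: par_cell par_0)
    show ?thesis
      unfolding p b a[unfolded p theta_logderiv_plus_1 e] e using z0 by (simp add: field_simps)
  qed
  have L_t: "L (par s (t + 1)) = L (par s t)" if "- 1 < t" "t < 0" "\<bar>s\<bar> < 1" for s t
  proof -
    have w: "par s (t + 1) / z = par s t / z + 1"
      using z0 by (simp add: par_def field_simps)
    have p: "par s (t + 1) = par s t + z"
      by (simp add: par_def algebra_simps)
    have "Im (par s t) = t * Im z"
      by (simp add: par_def)
    moreover have "- 1 * Im z < t * Im z" "t * Im z < 0"
      using that Imz by (intro mult_strict_right_mono mult_neg_pos; simp)+
    ultimately have e: "theta_logderiv z (par s t + z) = theta_logderiv z (par s t) - 2 * of_real pi * \<i>"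
      by (intro theta_logderiv_plus_period) auto
    have a: "L (par s (t + 1)) = theta_logderiv z (par s (t + 1)) - theta_logderiv z' (par s t / z + 1) / z + 2 * of_real pi * \<i> * par s (t + 1) / z"
      using that unfolding w[symmetric] by (intro L_eq) (auto simp: par_cell par_0)
    have b: "L (par s t) = theta_logderiv z (par s t) - theta_logderiv z' (par s t / z) / z + 2 * of_real pi * \<i> * par s t / z"
      using that by (intro L_eq) (auto simp: par_cell par_0)
    show ?thesis
      unfolding p b a[unfolded p theta_logderiv_plus_1 e] e using z0 by (simp add: field_simps)
  qed
  define K where "K = (\<lambda>(s, t). par s t) ` ({-1/2..1/2} \<times> {-1/2..1/2})"
  have K_cell: "K \<subseteq> cell z"
    by (auto simp: K_def par_cell)
  have "compact K"
    unfolding K_def par_def case_prod_unfold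
    by (intro compact_continuous_image compact_Times continuous_intros compact_Icc)
  have red: "\<exists>v\<in>K. L v = L u" if u: "u \<in> cell z" for u
  proof -
    from z u obtain s t where st: "u = par s t" "\<bar>s\<bar> < 1" "\<bar>t\<bar> < 1"
      unfolding par_def by (rule in_cellE)
    have 1: "\<exists>s'. \<bar>s'\<bar> \<le> 1 / 2 \<and> L (par s' t) = L (par s t)"
    proof -
      consider "s < - 1 / 2" | "\<bar>s\<bar> \<le> 1 / 2" | "s > 1 / 2"
        by linarith
      then show ?thesis
      proof cases
        case 1
        then show ?thesis
          using L_s[of s t] st by (intro exI[of _ "s + 1"]) auto
      next
        case 2
        then show ?thesis
          by blast
      next
        case 3
        then show ?thesis
          using L_s[of "s - 1" t] st by (intro exI[of _ "s - 1"]) auto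
      qed
    qed
    then obtain s' where s': "\<bar>s'\<bar> \<le> 1 / 2" "L (par s' t) = L u"
      using st by auto
    have "\<exists>t'. \<bar>t'\<bar> \<le> 1 / 2 \<and> L (par s' t') = L (par s' t)"
    proof -
      consider "t < - 1 / 2" | "\<bar>t\<bar> \<le> 1 / 2" | "t > 1 / 2"
        by linarith
      then show ?thesis
      proof cases
        case 1
        then show ?thesis
          using L_t[of t s'] st s' by (intro exI[of _ "t + 1"]) auto
      next
        case 2
        then show ?thesis
          by blast
      next
        case 3
        then show ?thesis
          using L_t[of "t - 1" s'] st s' by (intro exI[of _ "t - 1"]) auto
      qed
    qed
    then obtain t' where "\<bar>t'\<bar> \<le> 1 / 2" "L (par s' t') = L u"
      using s' by auto
    moreover have "par s' t' \<in> K"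
      using s'(1) \<open>\<bar>t'\<bar> \<le> 1 / 2\<close> by (force simp: K_def abs_le_iff)
    ultimately show ?thesis
      by blast
  qed
  have "K \<noteq> {}"
    by (simp add: K_def)
  moreover have "continuous_on K (\<lambda>w. cmod (L w))"
    using holomorphic_on_imp_continuous_on[OF hol] K_cell
    by (intro continuous_on_norm) (rule continuous_on_subset)
  ultimately obtain p where p: "p \<in> K" "\<And>w. w \<in> K \<Longrightarrow> cmod (L w) \<le> cmod (L p)"
    using continuous_attains_sup[of K "\<lambda>w. cmod (L w)"] \<open>compact K\<close> by auto
  have "cmod (L u) \<le> cmod (L p)" if "u \<in> cell z" for u
    using red[OF that] p(2) by force
  then have "L constant_on cell z"
    using hol open_cell connected_cell[OF z] p(1) K_cell
    by (intro maximum_modulus_principle[of L "cell z" "cell z" p]) auto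
  then obtain c where c: "\<And>u. u \<in> cell z \<Longrightarrow> L u = c"
    by (auto simp: constant_on_def)
  have half: "par (1 / 2) 0 \<in> cell z" "par (1 / 2) 0 \<noteq> 0"
    by (auto simp: par_cell par_0)
  have "c = L (- par (1 / 2) 0)"
    using c uminus_in_cell[OF half(1)] by simp
  also have "\<dots> = - L (par (1 / 2) 0)"
    using L_eq[of "par (1 / 2) 0"] L_eq[of "- par (1 / 2) 0"] half uminus_in_cell[OF half(1)]
    by (simp add: theta_logderiv_minus)
  also have "\<dots> = - c"
    using c half(1) by simp
  finally have "c = 0"
    by (simp add: eq_neg_iff_add_eq_0 flip: mult_2)
  with c[OF u] show ?thesis
    by (simp add: L_def z'_def algebra_simps)
qed

section \<open>Lambert series as divisor sums\<close>

lemma summable_lambert_1: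
  assumes "cmod q < 1"
  shows "summable (\<lambda>r. of_nat r ^ k * (q ^ r / (1 - q ^ r)))"
proof (cases "q = 0")
  case True
  then have "of_nat r ^ k * (q ^ r / (1 - q ^ r)) = 0" for r
    by (cases r) auto
  then show ?thesis
    by (simp only: summable_zero)
next
  case False
  define R where "R = 1 / cmod q"
  have R: "cmod (q * y) < 1 \<longleftrightarrow> cmod y < R" for y
    using False by (simp add: R_def norm_mult field_simps)
  have "summable (\<lambda>r. of_nat r ^ k * (q ^ r / (1 - q ^ r)) * y ^ r)" if "cmod y < R" for y
    using that
  proof (induction k arbitrary: y)
    case 0
    then show ?case
      using summable_lambert_0[OF assms, of y] R by simp
  next
    case (Suc k)
    from power_series_diff_summable[of R "\<lambda>r. of_nat r ^ k * (q ^ r / (1 - q ^ r))", OF Suc]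
    show ?case
      by (auto simp: sums_iff mult_ac)
  qed
  from this[of 1] show ?thesis
    using R[of 1] assms by simp
qed

text \<open>The contributions of \<open>qexp u\<close> and \<open>qexp (- u)\<close> have opposite signs in odd degree, so they add up in
  the difference.\<close>

lemma theta_logderiv_reg_odd_deriv:
  assumes z: "z \<in> upper_half_plane" and k: "odd k"
  shows "(deriv ^^ k) (theta_logderiv_reg z) 0 =
           (deriv ^^ k) cot_regular 0 - 2 * (2 * of_real pi * \<i>) ^ Suc k * lambert k (qexp z) 1"
proof -
  define q where "q = qexp z"
  define R where "R = 1 / cmod q"
  define B where "B = (\<lambda>u. lambert 0 q (qexp u))"
  have q: "cmod q < 1" "q \<noteq> 0"
    using z by (simp_all add: q_def norm_qexp_less_1_iff)
  have R: "cmod (q * y) < 1 \<longleftrightarrow> cmod y < R" for y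
    using q by (simp add: R_def norm_mult field_simps)
  note hol = holomorphic_on_cell_parts[OF z, folded q_def]
  have B: "(deriv ^^ k) B 0 = (2 * of_real pi * \<i>) ^ k * lambert k q 1"
  proof -
    have "(deriv ^^ k) (\<lambda>u. suminf (\<lambda>r. (q ^ r / (1 - q ^ r)) * qexp u ^ r)) 0 = (2 * of_real pi * \<i>) ^ k *
        suminf (\<lambda>r. of_nat r ^ k * (q ^ r / (1 - q ^ r)) * qexp 0 ^ r)"
      using summable_lambert_0[OF q(1)] R R[of 1] q(1) by (intro qexp_series_higher_deriv[of R]) auto
    then show ?thesis
      by (simp add: B_def lambert_def)
  qed
  have B': "(deriv ^^ k) (\<lambda>u. B (- u)) 0 = - (deriv ^^ k) B 0"
  proof -
    have "(deriv ^^ k) (\<lambda>u. B (- 1 * u)) 0 = (- 1) ^ k * (deriv ^^ k) B (- 1 * 0)"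
      unfolding B_def
      by (rule higher_deriv_compose_linear[OF hol(2) open_cell[of z] open_cell zero_in_cell])
        (simp add: uminus_in_cell)
    then show ?thesis
      using k by simp
  qed
  have W: "theta_logderiv_reg z = (\<lambda>u. cot_regular u - 2 * of_real pi * \<i> * (B u - B (- u)))"
    by (simp add: theta_logderiv_reg_def B_def q_def fun_eq_iff)
  have holB: "B holomorphic_on cell z" "(\<lambda>u. B (- u)) holomorphic_on cell z"
    using hol by (simp_all add: B_def)
  have "(deriv ^^ k) (theta_logderiv_reg z) 0 = (deriv ^^ k) cot_regular 0 -
      (deriv ^^ k) (\<lambda>u. 2 * of_real pi * \<i> * (B u - B (- u))) 0"
    unfolding W by (rule higher_deriv_diff[of _ "cell z"])
      (intro holomorphic_intros hol holB open_cell zero_in_cell)+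
  also have "(deriv ^^ k) (\<lambda>u. 2 * of_real pi * \<i> * (B u - B (- u))) 0 =
      2 * of_real pi * \<i> * (deriv ^^ k) (\<lambda>u. B u - B (- u)) 0"
    by (rule higher_deriv_cmult[of _ "cell z"])
      (intro holomorphic_intros holB open_cell zero_in_cell)+
  also have "(deriv ^^ k) (\<lambda>u. B u - B (- u)) 0 = (deriv ^^ k) B 0 - (deriv ^^ k) (\<lambda>u. B (- u)) 0"
    by (rule higher_deriv_diff[of _ "cell z"])
      (intro holomorphic_intros holB open_cell zero_in_cell)+
  finally show ?thesis
    unfolding B' B q_def by simp
qed

lemma theta_logderiv_reg_odd_deriv_inversion:
  assumes z: "z \<in> upper_half_plane" and k: "odd k"
  shows "(deriv ^^ k) (theta_logderiv_reg z) 0 = (1 / z) ^ Suc k * (deriv ^^ k) (theta_logderiv_reg (- (1 / z))) 0 -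
           (if k = 1 then 2 * of_real pi * \<i> / z else 0)"
proof -
  define z' where "z' = - (1 / z)"
  have z': "z' \<in> upper_half_plane"
    unfolding z'_def using z by (rule minus_inverse_in_upper_half_plane)
  have sub: "1 / z * u \<in> cell z'" if "u \<in> cell z" for u
    using divide_in_cell[OF z that] by (simp add: z'_def)
  note hol = holomorphic_on_theta_logderiv_reg[OF z']
  have hol': "(\<lambda>u. theta_logderiv_reg z' (1 / z * u)) holomorphic_on cell z"
    using sub by (intro holomorphic_on_compose_gen[OF _ hol, unfolded o_def] holomorphic_intros) auto
  have h1: "(\<lambda>u. 1 / z * theta_logderiv_reg z' (1 / z * u)) holomorphic_on cell z"
    by (intro holomorphic_on_mult hol' holomorphic_on_const)
  have h2: "(\<lambda>u. (2 * of_real pi * \<i> / z) * u) holomorphic_on cell z"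
    by (intro holomorphic_on_mult holomorphic_on_const holomorphic_on_ident)
  have "(deriv ^^ k) (theta_logderiv_reg z) 0 =
      (deriv ^^ k) (\<lambda>u. 1 / z * theta_logderiv_reg z' (1 / z * u) - (2 * of_real pi * \<i> / z) * u) 0"
  proof (rule higher_deriv_transform_within_open[OF _ _ open_cell zero_in_cell])
    show "theta_logderiv_reg z holomorphic_on cell z"
      using z by (rule holomorphic_on_theta_logderiv_reg)
    show "(\<lambda>u. 1 / z * theta_logderiv_reg z' (1 / z * u) - (2 * of_real pi * \<i> / z) * u) holomorphic_on cell z"
      using h1 h2 by (rule holomorphic_on_diff)
    show "theta_logderiv_reg z u = 1 / z * theta_logderiv_reg z' (1 / z * u) - (2 * of_real pi * \<i> / z) * u" if "u \<in> cell z" for u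
      using theta_logderiv_reg_inversion[OF z that] by (simp add: z'_def)
  qed
  also have "\<dots> = (deriv ^^ k) (\<lambda>u. 1 / z * theta_logderiv_reg z' (1 / z * u)) 0 - (deriv ^^ k) (\<lambda>u. (2 * of_real pi * \<i> / z) * u) 0"
    by (rule higher_deriv_diff[OF h1 h2 open_cell zero_in_cell])
  also have "(deriv ^^ k) (\<lambda>u. 1 / z * theta_logderiv_reg z' (1 / z * u)) 0 = 1 / z * (deriv ^^ k) (\<lambda>u. theta_logderiv_reg z' (1 / z * u)) 0"
    by (rule higher_deriv_cmult[OF hol' zero_in_cell open_cell])
  also have "(deriv ^^ k) (\<lambda>u. theta_logderiv_reg z' (1 / z * u)) 0 = (1 / z) ^ k * (deriv ^^ k) (theta_logderiv_reg z') (1 / z * 0)"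
    by (rule higher_deriv_compose_linear[OF hol open_cell open_cell zero_in_cell sub])
  also have "(deriv ^^ k) (\<lambda>u. (2 * of_real pi * \<i> / z) * u) 0 = (if k = 1 then 2 * of_real pi * \<i> / z else 0)"
    using k by (simp only: higher_deriv_linear) auto
  finally show ?thesis
    by (simp add: z'_def)
qed

text \<open>Both sides are the sum of \<open>r ^ k * q ^ (r * m)\<close> over \<open>r, m \<ge> 1\<close>: summed over \<open>m\<close> first it is the Lambert
  series, and grouped by \<open>n = r * m\<close> it is the series of divisor sums. Absolute convergence of the double
  series follows from convergence of the Lambert series at \<open>\<bar>q\<bar>\<close>.\<close>

lemma lambert_eq_divisor_sigma_series:
  assumes q: "cmod q < 1"
  shows "lambert k q 1 = q * suminf (\<lambda>n. of_nat (divisor_sigma k (Suc n)) * q ^ n)"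
proof -
  define A :: "nat set" where "A = {1..}"
  define f :: "nat \<times> nat \<Rightarrow> complex" where "f = (\<lambda>(r, m). of_nat r ^ k * q ^ (r * m))"
  have geom: "((\<lambda>m. c * x ^ (r * m)) has_sum (c * (x ^ r / (1 - x ^ r)))) A"
    if "norm x < 1" "r \<in> A" for x c :: "'a :: {real_normed_field, banach}" and r
  proof -
    have r: "r > 0"
      using that by (simp add: A_def)
    have xr: "norm (x ^ r) < 1"
      using that r by (simp add: norm_power power_less_one_iff)
    have "((\<lambda>n. (c * x ^ r) * (x ^ r) ^ n) has_sum ((c * x ^ r) * (1 / (1 - x ^ r)))) UNIV"
    proof (rule norm_summable_imp_has_sum)
      show "summable (\<lambda>n. norm ((c * x ^ r) * (x ^ r) ^ n))"
        unfolding norm_mult norm_power[of "x ^ r"] using xr by (intro summable_mult summable_geometric) simp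
      show "(\<lambda>n. (c * x ^ r) * (x ^ r) ^ n) sums ((c * x ^ r) * (1 / (1 - x ^ r)))"
        using geometric_sums[OF xr] by (rule sums_mult)
    qed
    also have "?this \<longleftrightarrow> ((\<lambda>m. c * x ^ (r * m)) has_sum ((c * x ^ r) * (1 / (1 - x ^ r)))) A"
    proof (rule has_sum_reindex_bij_witness[of _ "\<lambda>m. m - 1" Suc])
      show "c * x ^ (r * Suc n) = c * x ^ r * (x ^ r) ^ n" for n
        by (simp add: power_add flip: power_mult)
    qed (auto simp: A_def)
    finally show ?thesis
      by simp
  qed
  have row: "((\<lambda>m. f (r, m)) has_sum (of_nat r ^ k * (q ^ r / (1 - q ^ r)))) A" if "r \<in> A" for r
    unfolding f_def prod.case using q that by (rule geom)
  have to_A: "(g has_sum s) A" if "summable (\<lambda>n. norm (g n))" "g sums s" "g 0 = 0" for g and s :: "'a :: banach"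
  proof -
    have "(g has_sum s) UNIV"
      using that by (intro norm_summable_imp_has_sum)
    also have "?this \<longleftrightarrow> ?thesis"
      using that(3) by (intro has_sum_cong_neutral) (auto simp: A_def not_less_eq_eq Suc_le_eq)
    finally show ?thesis .
  qed
  have summ_f: "(\<lambda>x. norm (f x)) summable_on A \<times> A"
  proof (rule summable_on_SigmaI)
    show "((\<lambda>m. norm (f (r, m))) has_sum (of_nat r ^ k * (cmod q ^ r / (1 - cmod q ^ r)))) A" if "r \<in> A" for r
      using geom[of "cmod q" r "of_nat r ^ k"] q that by (simp add: f_def norm_mult norm_power)
    have "summable (\<lambda>r. of_nat r ^ k * ((of_real (cmod q) :: complex) ^ r / (1 - of_real (cmod q) ^ r)))"
        using q by (intro summable_lambert_1) simp
      then have "summable (\<lambda>r. of_real (of_nat r ^ k * (cmod q ^ r / (1 - cmod q ^ r))) :: complex)"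
        by simp
      then have "summable (\<lambda>r. real r ^ k * (cmod q ^ r / (1 - cmod q ^ r)))"
        by (simp only: summable_complex_of_real)
      moreover have "real r ^ k * (cmod q ^ r / (1 - cmod q ^ r)) \<ge> 0" for r
        using q by (intro mult_nonneg_nonneg divide_nonneg_nonneg) (auto simp: power_le_one)
      ultimately have "(\<lambda>r. real r ^ k * (cmod q ^ r / (1 - cmod q ^ r))) summable_on UNIV"
        by (subst summable_on_UNIV_nonneg_real_iff)
      then show "(\<lambda>r. real r ^ k * (cmod q ^ r / (1 - cmod q ^ r))) summable_on A"
        by (rule summable_on_subset_banach) auto
  qed auto
  then have summ: "f summable_on A \<times> A"
    by (rule abs_summable_summable)
  have 1: "infsum f (A \<times> A) = lambert k q 1"
  proof -
    have "((\<lambda>r. of_nat r ^ k * (q ^ r / (1 - q ^ r))) has_sum infsum f (A \<times> A)) A"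
      using has_sum_infsum[OF summ] row by (rule has_sum_SigmaD)
    also have "?this \<longleftrightarrow> ((\<lambda>r. of_nat r ^ k * (q ^ r / (1 - q ^ r))) has_sum infsum f (A \<times> A)) UNIV"
      by (rule has_sum_cong_neutral) (auto simp: A_def not_less_eq_eq Suc_le_eq)
    finally have "(\<lambda>r. of_nat r ^ k * (q ^ r / (1 - q ^ r))) sums infsum f (A \<times> A)"
      by (rule has_sum_imp_sums)
    then show ?thesis
      by (simp add: lambert_def sums_iff)
  qed
  have "(f has_sum infsum f (A \<times> A)) (A \<times> A)"
    by (rule has_sum_infsum[OF summ])
  also have "?this \<longleftrightarrow> ((\<lambda>(n, d). of_nat d ^ k * q ^ n) has_sum infsum f (A \<times> A)) (Sigma A (\<lambda>n. {d. d dvd n}))"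
    by (rule has_sum_reindex_bij_witness[of _ "\<lambda>(n, d). (d, n div d)" "\<lambda>(r, m). (r * m, r)"])
      (auto simp: A_def f_def Suc_le_eq elim!: dvdE)
  finally have "((\<lambda>(n, d). of_nat d ^ k * q ^ n) has_sum infsum f (A \<times> A)) (Sigma A (\<lambda>n. {d. d dvd n}))" .
  moreover have "((\<lambda>d. case (n, d) of (n, d) \<Rightarrow> of_nat d ^ k * q ^ n) has_sum (of_nat (divisor_sigma k n) * q ^ n)) {d. d dvd n}"
    if "n \<in> A" for n
  proof -
    have "finite {d. d dvd n}"
      using that by (intro finite_divisors_nat) (auto simp: A_def)
    then show ?thesis
      by (intro has_sum_finiteI) (auto simp: divisor_sigma_def sum_distrib_right)
  qed
  ultimately have "((\<lambda>n. of_nat (divisor_sigma k n) * q ^ n) has_sum infsum f (A \<times> A)) A"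
    by (rule has_sum_SigmaD)
  also have "?this \<longleftrightarrow> ((\<lambda>n. q * (of_nat (divisor_sigma k (Suc n)) * q ^ n)) has_sum infsum f (A \<times> A)) UNIV"
    by (rule has_sum_reindex_bij_witness[of _ Suc "\<lambda>n. n - 1"])
      (auto simp: A_def simp flip: power_Suc)
  finally have "(\<lambda>n. q * (of_nat (divisor_sigma k (Suc n)) * q ^ n)) sums infsum f (A \<times> A)"
    by (rule has_sum_imp_sums)
  then have "infsum f (A \<times> A) = suminf (\<lambda>n. q * (of_nat (divisor_sigma k (Suc n)) * q ^ n))"
    by (rule sums_unique)
  also have "\<dots> = q * suminf (\<lambda>n. of_nat (divisor_sigma k (Suc n)) * q ^ n)"
    using summable_divisor_sigma[OF q] by (rule suminf_mult)
  finally show ?thesis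
    using 1 by simp
qed

section \<open>The Eisenstein series under inversion\<close>

lemmas app_hol_simps [simp] = zero_hol_fun.rep_eq plus_hol_fun.rep_eq minus_hol_fun.rep_eq
  uminus_hol_fun.rep_eq times_hol_fun.rep_eq scale_hol.rep_eq

lemma app_hol_one [simp]: "z \<in> upper_half_plane \<Longrightarrow> app_hol 1 z = 1"
  by (simp add: one_hol_fun.rep_eq)

lemma app_hol_power [simp]: "z \<in> upper_half_plane \<Longrightarrow> app_hol (f ^ n) z = app_hol f z ^ n"
  by (induction n) auto

lemma app_hol_sum [simp]: "app_hol (\<Sum>i\<in>A. f i) z = (\<Sum>i\<in>A. app_hol (f i) z)"
  by (induction A rule: infinite_finite_induct) auto

lemma hol_fun_eqI:
  assumes "\<And>z. z \<in> upper_half_plane \<Longrightarrow> app_hol f z = app_hol g z"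
  shows "f = g"
proof -
  have "app_hol f z = app_hol g z" for z
    using assms app_hol[of f] app_hol[of g] by (cases "z \<in> upper_half_plane") auto
  then show ?thesis
    by (simp add: app_hol_inject[symmetric] fun_eq_iff)
qed

lemma holomorphic_on_app_hol: "app_hol f holomorphic_on upper_half_plane"
  using app_hol[of f] by simp

text \<open>Used to build elements of the function algebra pointwise, in particular quotients.\<close>

lemma obtain_hol_fun:
  assumes "f holomorphic_on upper_half_plane"
  obtains h where "\<And>z. z \<in> upper_half_plane \<Longrightarrow> app_hol h z = f z"
proof
  have "(\<lambda>z. if z \<in> upper_half_plane then f z else 0) holomorphic_on upper_half_plane"
    using assms by (rule holomorphic_transform) simp
  then show "app_hol (Abs_hol (\<lambda>z. if z \<in> upper_half_plane then f z else 0)) z = f z"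
    if "z \<in> upper_half_plane" for z
    using that by (simp add: Abs_hol_inverse)
qed

lemma span_mult:
  assumes AB: "\<And>x y. x \<in> A \<Longrightarrow> y \<in> B \<Longrightarrow> x * y \<in> C"
    and f: "f \<in> hol.span A" and g: "g \<in> hol.span B"
  shows "f * g \<in> hol.span C"
  using f
proof (induction rule: hol.span_induct)
  case base
  show ?case
  proof (rule hol.subspaceI)
    show "0 \<in> {f. f * g \<in> hol.span C}"
      by (simp add: hol.span_zero)
  next
    fix x y assume "x \<in> {f. f * g \<in> hol.span C}" "y \<in> {f. f * g \<in> hol.span C}"
    then show "x + y \<in> {f. f * g \<in> hol.span C}"
      by (simp add: ring_distribs hol.span_add)
  next
    fix c x assume "x \<in> {f. f * g \<in> hol.span C}"
    moreover have "scale_hol c x * g = scale_hol c (x * g)"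
      by (rule hol_fun_eqI) simp
    ultimately show "scale_hol c x \<in> {f. f * g \<in> hol.span C}"
      by (simp add: hol.span_scale)
  qed
next
  case (step x)
  show ?case
    using g
  proof (induction rule: hol.span_induct)
    case base
    show ?case
    proof (rule hol.subspaceI)
      show "0 \<in> {g. x * g \<in> hol.span C}"
        by (simp add: hol.span_zero)
    next
      fix u v assume "u \<in> {g. x * g \<in> hol.span C}" "v \<in> {g. x * g \<in> hol.span C}"
      then show "u + v \<in> {g. x * g \<in> hol.span C}"
        by (simp add: ring_distribs hol.span_add)
    next
      fix c u assume "u \<in> {g. x * g \<in> hol.span C}"
      moreover have "x * scale_hol c u = scale_hol c (x * u)"
        by (rule hol_fun_eqI) simp
      ultimately show "scale_hol c u \<in> {g. x * g \<in> hol.span C}"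
        by (simp add: hol.span_scale)
    qed
  next
    case (step y)
    then show ?case
      using AB \<open>x \<in> A\<close> by (simp add: hol.span_base)
  qed
qed

definition sigma_series :: "nat \<Rightarrow> complex \<Rightarrow> complex" where
  "sigma_series k w = suminf (\<lambda>n. of_nat (divisor_sigma k (Suc n)) * w ^ n)"

lemma holomorphic_on_sigma_series: "sigma_series k holomorphic_on ball 0 1"
  unfolding sigma_series_def using summable_divisor_sigma
  by (intro power_series_holomorphic[where a = "\<lambda>n. of_nat (divisor_sigma k (Suc n))"])
    (auto intro!: summable_sums)

lemma sigma_series_0: "sigma_series k 0 = 1"
proof -
  have "sigma_series k 0 = of_nat (divisor_sigma k 1)"
    unfolding sigma_series_def by (subst powser_zero) simp
  then show ?thesis
    by (simp add: divisor_sigma_def)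
qed

lemma lambert_eq_sigma_series: "cmod q < 1 \<Longrightarrow> lambert k q 1 = q * sigma_series k q"
  by (simp add: lambert_eq_divisor_sigma_series sigma_series_def)

lemma eisenstein_eq:
  assumes "z \<in> upper_half_plane"
  shows "app_hol (eisenstein k) z = eis_a k * (1 + (- 1) ^ k * (4 * of_nat k / eis_B k) *
    (qexp z * sigma_series (2 * k - 1) (qexp z)))"
proof -
  have q: "cmod (qexp z) < 1"
    using assms by (simp add: norm_qexp_less_1_iff)
  have e: "exp (2 * of_real pi * \<i> * z * of_nat (Suc n)) = qexp z * qexp z ^ n" for n
    unfolding qexp_def by (metis exp_of_nat_mult mult.commute power_Suc)
  have "suminf (\<lambda>n. of_nat (divisor_sigma (2 * k - 1) (Suc n)) *
      exp (2 * of_real pi * \<i> * z * of_nat (Suc n))) =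
      suminf (\<lambda>n. qexp z * (of_nat (divisor_sigma (2 * k - 1) (Suc n)) * qexp z ^ n))"
    unfolding e by (simp add: mult_ac)
  also have "\<dots> = qexp z * sigma_series (2 * k - 1) (qexp z)"
    unfolding sigma_series_def using summable_divisor_sigma[OF q] by (rule suminf_mult)
  finally show ?thesis
    using assms by (simp add: eisenstein.rep_eq)
qed

lemma eisenstein_plus_1:
  assumes "z \<in> upper_half_plane"
  shows "app_hol (eisenstein k) (z + 1) = app_hol (eisenstein k) z"
  using assms add_of_int_in_upper_half_plane[of z 1] by (simp add: eisenstein_eq qexp_add)

lemma sigma_series_at_cusp: "((\<lambda>z. sigma_series k (qexp z)) \<longlongrightarrow> 1) at_cusp"
proof -
  have "isCont (sigma_series k) 0"
    using holomorphic_on_imp_continuous_on[OF holomorphic_on_sigma_series]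
    by (rule continuous_on_interior) simp
  then have "((\<lambda>z. sigma_series k (qexp z)) \<longlongrightarrow> sigma_series k 0) at_cusp"
    using qexp_tendsto_0_at_cusp by (rule isCont_tendsto_compose)
  then show ?thesis
    by (simp add: sigma_series_0)
qed

lemma tendsto_cong_at_cusp:
  assumes "(g \<longlongrightarrow> l) at_cusp" "\<And>z. z \<in> upper_half_plane \<Longrightarrow> g z = f z"
  shows "(f \<longlongrightarrow> l) at_cusp"
  using assms(1)
proof (rule Lim_transform_eventually)
  show "eventually (\<lambda>z. g z = f z) at_cusp"
    using eventually_upper_half_plane_at_cusp by (rule eventually_mono) (rule assms(2))
qed

lemma eisenstein_at_cusp: "(app_hol (eisenstein k) \<longlongrightarrow> eis_a k) at_cusp"
proof (rule tendsto_cong_at_cusp)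
  show "((\<lambda>z. eis_a k * (1 + (- 1) ^ k * (4 * of_nat k / eis_B k) *
      (qexp z * sigma_series (2 * k - 1) (qexp z)))) \<longlongrightarrow> eis_a k) at_cusp"
    by (rule tendsto_eq_intros sigma_series_at_cusp qexp_tendsto_0_at_cusp refl)+ simp
qed (simp add: eisenstein_eq)

lemma eis_a_nonzero: "k \<in> {1, 2, 3} \<Longrightarrow> eis_a k \<noteq> 0"
  by (auto simp: eis_a_def)

text \<open>The coefficients of the cotangent supply the constant terms, and the Lambert series the rest. The ratios
  \<open>- 24\<close>, \<open>240\<close> and \<open>- 504\<close> of the two contributions are those of the Eisenstein series.\<close>

lemma theta_logderiv_reg_deriv_eisenstein:
  assumes z: "z \<in> upper_half_plane"
  shows "deriv (theta_logderiv_reg z) 0 = 2 * of_real pi * \<i> * app_hol (eisenstein 1) z"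
    and "(deriv ^^ 3) (theta_logderiv_reg z) 0 = - 2 * of_real pi ^ 4 / 15 / eis_a 2 * app_hol (eisenstein 2) z"
    and "(deriv ^^ 5) (theta_logderiv_reg z) 0 = - 16 * of_real pi ^ 6 / 63 / eis_a 3 * app_hol (eisenstein 3) z"
proof -
  have q: "cmod (qexp z) < 1"
    using z by (simp add: norm_qexp_less_1_iff)
  define P where "P = (of_real pi :: complex)"
  have e: "\<i> ^ 2 = - 1" "\<i> ^ 4 = 1" "\<i> ^ 6 = - 1"
    by (simp_all add: eval_nat_numeral)
  note L = lambert_eq_sigma_series[OF q]
  define s1 s3 s5 where "s1 = lambert 1 (qexp z) 1" and "s3 = lambert 3 (qexp z) 1" and "s5 = lambert 5 (qexp z) 1"
  have E: "app_hol (eisenstein 1) z = eis_a 1 * (1 - 24 * s1)"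
    "app_hol (eisenstein 2) z = eis_a 2 * (1 + 240 * s3)"
    "app_hol (eisenstein 3) z = eis_a 3 * (1 - 504 * s5)"
    unfolding s1_def s3_def s5_def L by (simp_all add: eisenstein_eq[OF z] eis_B_def)
  have 1: "deriv (theta_logderiv_reg z) 0 = deriv cot_regular 0 - 2 * (2 * of_real pi * \<i>) ^ 2 * s1"
    using theta_logderiv_reg_odd_deriv[OF z, of 1] by (simp add: s1_def eval_nat_numeral)
  have 3: "(deriv ^^ 3) (theta_logderiv_reg z) 0 = (deriv ^^ 3) cot_regular 0 - 2 * (2 * of_real pi * \<i>) ^ 4 * s3"
    using theta_logderiv_reg_odd_deriv[OF z, of 3] by (simp add: s3_def)
  have 5: "(deriv ^^ 5) (theta_logderiv_reg z) 0 = (deriv ^^ 5) cot_regular 0 - 2 * (2 * of_real pi * \<i>) ^ 6 * s5"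
    using theta_logderiv_reg_odd_deriv[OF z, of 5] by (simp add: s5_def)
  have "2 * P * \<i> * (2 * P * \<i> / 12 * (1 - 24 * s1)) = - (P ^ 2) / 3 - 2 * (2 * P * \<i>) ^ 2 * s1"
    unfolding power_mult_distrib e by (simp add: field_simps power2_eq_square)
  then show "deriv (theta_logderiv_reg z) 0 = 2 * of_real pi * \<i> * app_hol (eisenstein 1) z"
    unfolding 1 E cot_regular_taylor(1) by (simp add: eis_a_def P_def)
  show "(deriv ^^ 3) (theta_logderiv_reg z) 0 = - 2 * of_real pi ^ 4 / 15 / eis_a 2 * app_hol (eisenstein 2) z"
    unfolding 3 E cot_regular_taylor(2) power_mult_distrib e using eis_a_nonzero[of 2]
    by (simp add: field_simps)
  show "(deriv ^^ 5) (theta_logderiv_reg z) 0 = - 16 * of_real pi ^ 6 / 63 / eis_a 3 * app_hol (eisenstein 3) z"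
    unfolding 5 E cot_regular_taylor(3) power_mult_distrib e using eis_a_nonzero[of 3]
    by (simp add: field_simps)
qed

text \<open>Degrees \<open>1, 3, 5\<close> of the inversion formula in \<open>u\<close>. The linear term \<open>2 \<pi> \<i> u / z\<close> only affects degree \<open>1\<close>,
  which is why \<open>g\<^sub>1\<close> alone fails to be modular.\<close>

lemma eisenstein_inversion:
  assumes z: "z \<in> upper_half_plane"
  shows "app_hol (eisenstein 1) (- (1 / z)) = z ^ 2 * app_hol (eisenstein 1) z + z"
    and "app_hol (eisenstein 2) (- (1 / z)) = z ^ 4 * app_hol (eisenstein 2) z"
    and "app_hol (eisenstein 3) (- (1 / z)) = z ^ 6 * app_hol (eisenstein 3) z"
proof -
  have z0: "z \<noteq> 0"
    using z by (rule upper_half_plane_nonzero)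
  note D = theta_logderiv_reg_deriv_eisenstein[OF z] theta_logderiv_reg_deriv_eisenstein[OF minus_inverse_in_upper_half_plane[OF z]]
  have "(2 * of_real pi * \<i>) * app_hol (eisenstein 1) z =
      (2 * of_real pi * \<i>) * ((1 / z) ^ 2 * app_hol (eisenstein 1) (- (1 / z)) - 1 / z)"
    using theta_logderiv_reg_odd_deriv_inversion[OF z, of 1] D by (simp add: algebra_simps power2_eq_square)
  then have "app_hol (eisenstein 1) z = (1 / z) ^ 2 * app_hol (eisenstein 1) (- (1 / z)) - 1 / z"
    by (subst (asm) mult_cancel_left) auto
  then show "app_hol (eisenstein 1) (- (1 / z)) = z ^ 2 * app_hol (eisenstein 1) z + z"
    using z0 by (simp add: field_simps power2_eq_square)
  have "(- 2 * of_real pi ^ 4 / 15 / eis_a 2) * app_hol (eisenstein 2) z =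
      (- 2 * of_real pi ^ 4 / 15 / eis_a 2) * ((1 / z) ^ 4 * app_hol (eisenstein 2) (- (1 / z)))"
    using theta_logderiv_reg_odd_deriv_inversion[OF z, of 3] unfolding D by (simp add: mult_ac)
  then have "app_hol (eisenstein 2) z = (1 / z) ^ 4 * app_hol (eisenstein 2) (- (1 / z))"
    by (subst (asm) mult_cancel_left) (use eis_a_nonzero[of 2] in auto)
  then show "app_hol (eisenstein 2) (- (1 / z)) = z ^ 4 * app_hol (eisenstein 2) z"
    using z0 by (simp add: power_divide)
  have "(- 16 * of_real pi ^ 6 / 63 / eis_a 3) * app_hol (eisenstein 3) z =
      (- 16 * of_real pi ^ 6 / 63 / eis_a 3) * ((1 / z) ^ 6 * app_hol (eisenstein 3) (- (1 / z)))"
    using theta_logderiv_reg_odd_deriv_inversion[OF z, of 5] unfolding D by (simp add: mult_ac)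
  then have "app_hol (eisenstein 3) z = (1 / z) ^ 6 * app_hol (eisenstein 3) (- (1 / z))"
    by (subst (asm) mult_cancel_left) (use eis_a_nonzero[of 3] in auto)
  then show "app_hol (eisenstein 3) (- (1 / z)) = z ^ 6 * app_hol (eisenstein 3) z"
    using z0 by (simp add: power_divide)
qed

section \<open>Modular forms and the discriminant\<close>

text \<open>Invariance is only required for the translation and the inversion, which generate the modular group. This
  keeps matrices out of the classical theory.\<close>

definition modular_form :: "int \<Rightarrow> hol_fun \<Rightarrow> bool" where
  "modular_form k f \<longleftrightarrow>
     (\<forall>z\<in>upper_half_plane. app_hol f (z + 1) = app_hol f z) \<and>
     (\<forall>z\<in>upper_half_plane. app_hol f (- (1 / z)) = z powi k * app_hol f z) \<and>
     (\<exists>l. (app_hol f \<longlongrightarrow> l) at_cusp)"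

lemma modular_form_translate: "modular_form k f \<Longrightarrow> z \<in> upper_half_plane \<Longrightarrow> app_hol f (z + 1) = app_hol f z"
  by (simp add: modular_form_def)

lemma modular_form_inversion:
  "modular_form k f \<Longrightarrow> z \<in> upper_half_plane \<Longrightarrow> app_hol f (- (1 / z)) = z powi k * app_hol f z"
  by (simp add: modular_form_def)

lemma modular_form_at_cusp:
  assumes "modular_form k f"
  obtains l where "(app_hol f \<longlongrightarrow> l) at_cusp"
  using assms by (auto simp: modular_form_def)

lemma tendsto_app_hol_mult:
  assumes "(app_hol f \<longlongrightarrow> a) at_cusp" "(app_hol g \<longlongrightarrow> b) at_cusp"
  shows "(app_hol (f * g) \<longlongrightarrow> a * b) at_cusp"
  using tendsto_mult[OF assms] by simp

lemma tendsto_app_hol_one: "(app_hol 1 \<longlongrightarrow> 1) at_cusp"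
  by (rule tendsto_cong_at_cusp[OF tendsto_const]) simp

lemma tendsto_app_hol_power:
  assumes "(app_hol f \<longlongrightarrow> a) at_cusp"
  shows "(app_hol (f ^ n) \<longlongrightarrow> a ^ n) at_cusp"
  by (induction n) (auto intro!: tendsto_app_hol_one tendsto_mult assms)

lemma modular_form_mult:
  assumes "modular_form j f" "modular_form k g"
  shows "modular_form (j + k) (f * g)"
proof -
  obtain a b where "(app_hol f \<longlongrightarrow> a) at_cusp" "(app_hol g \<longlongrightarrow> b) at_cusp"
    using assms by (auto simp: modular_form_def)
  then have "(app_hol (f * g) \<longlongrightarrow> a * b) at_cusp"
    by (rule tendsto_app_hol_mult)
  moreover have "z powi (j + k) = z powi j * z powi k" if "z \<in> upper_half_plane" for z
    using upper_half_plane_nonzero[OF that] by (simp add: power_int_add)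
  ultimately show ?thesis
    using assms unfolding modular_form_def by auto
qed

lemma modular_form_one: "modular_form 0 1"
  unfolding modular_form_def
proof (intro conjI ballI exI)
  fix z assume z: "z \<in> upper_half_plane"
  then show "app_hol 1 (z + 1) = app_hol 1 z"
    using add_of_int_in_upper_half_plane[of z 1] by simp
  show "app_hol 1 (- (1 / z)) = z powi 0 * app_hol 1 z"
    using z minus_inverse_in_upper_half_plane[OF z] by simp
qed (rule tendsto_app_hol_one)

lemma modular_form_power:
  assumes "modular_form k f"
  shows "modular_form (int n * k) (f ^ n)"
proof (induction n)
  case (Suc n)
  have "modular_form (k + int n * k) (f * f ^ n)"
    using assms Suc by (rule modular_form_mult)
  then show ?case
    by (simp add: algebra_simps)
qed (auto intro: modular_form_one)

lemma modular_form_scale: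
  assumes "modular_form k f"
  shows "modular_form k (scale_hol c f)"
proof -
  obtain l where "(app_hol f \<longlongrightarrow> l) at_cusp"
    using assms by (rule modular_form_at_cusp)
  then have "(app_hol (scale_hol c f) \<longlongrightarrow> c * l) at_cusp"
    by (auto intro!: tendsto_intros)
  with assms show ?thesis
    unfolding modular_form_def by auto
qed

lemma modular_form_diff:
  assumes "modular_form k f" "modular_form k g"
  shows "modular_form k (f - g)"
proof -
  obtain a b where "(app_hol f \<longlongrightarrow> a) at_cusp" "(app_hol g \<longlongrightarrow> b) at_cusp"
    using assms by (auto simp: modular_form_def)
  then have "(app_hol (f - g) \<longlongrightarrow> a - b) at_cusp"
    by (auto intro!: tendsto_intros)
  with assms show ?thesis
    unfolding modular_form_def by (auto simp: algebra_simps)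
qed

lemma modular_form_eisenstein: "modular_form 4 (eisenstein 2)" "modular_form 6 (eisenstein 3)"
  by (auto simp: modular_form_def eisenstein_plus_1 eisenstein_inversion intro!: exI eisenstein_at_cusp)

lemma modular_form_weight_0_cusp:
  assumes "modular_form 0 f" "(app_hol f \<longlongrightarrow> 0) at_cusp"
  shows "f = 0"
proof (rule hol_fun_eqI)
  fix z assume "z \<in> upper_half_plane"
  then show "app_hol f z = app_hol 0 z"
    using invariant_vanishing_at_cusp_eq_0[of "app_hol f" z] assms holomorphic_on_app_hol[of f]
    by (simp add: modular_form_def)
qed

lemma modular_form_weight_0:
  assumes "modular_form 0 f"
  obtains c where "f = scale_hol c 1"
proof -
  obtain l where l: "(app_hol f \<longlongrightarrow> l) at_cusp"
    using assms by (rule modular_form_at_cusp)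
  have "((\<lambda>z. app_hol f z - l * app_hol 1 z) \<longlongrightarrow> l - l * 1) at_cusp"
    by (intro tendsto_intros l tendsto_app_hol_one)
  then have "f - scale_hol l 1 = 0"
    using assms modular_form_one
    by (intro modular_form_weight_0_cusp modular_form_diff modular_form_scale) auto
  then show ?thesis
    using that[of l] by simp
qed

text \<open>The form is the 24th power of the Dedekind eta function. Written as \<open>q exp (- 24 F q)\<close>, where \<open>F\<close> is a
  primitive of \<open>\<Sum>n. \<sigma>\<^sub>1(n + 1) q ^ n\<close>, it plainly has no zeros, and its logarithmic derivative is \<open>12 g\<^sub>1\<close>. The
  inversion law of \<open>g\<^sub>1\<close> says that \<open>d (- 1 / z)\<close> and \<open>z ^ 12 * d z\<close> have the same logarithmic derivative,
  so they are proportional, and at the fixed point \<open>\<i>\<close> they agree.\<close>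

lemma exists_nonvanishing_cusp_form:
  obtains d l where "modular_form 12 d" "\<forall>z\<in>upper_half_plane. app_hol d z \<noteq> 0"
    "((\<lambda>z. app_hol d z / qexp z) \<longlongrightarrow> l) at_cusp" "l \<noteq> 0"
proof -
  obtain F where F: "(F has_field_derivative sigma_series 1 w) (at w within ball 0 1)" if "w \<in> ball 0 1" for w
    using holomorphic_convex_primitive'[OF convex_ball open_ball holomorphic_on_sigma_series[of 1]] by metis
  have F': "(F has_field_derivative sigma_series 1 w) (at w)" if "cmod w < 1" for w
    using F[of w] that by (simp add: at_within_open[of _ "ball 0 1"])
  define D where "D = (\<lambda>z. qexp z * exp (- 24 * F (qexp z)))"
  have D': "(D has_field_derivative 12 * app_hol (eisenstein 1) z * D z) (at z)" if z: "z \<in> upper_half_plane" for z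
  proof -
    have q: "cmod (qexp z) < 1"
      using z by (simp add: norm_qexp_less_1_iff)
    have "((\<lambda>z. F (qexp z)) has_field_derivative
        sigma_series 1 (qexp z) * (2 * of_real pi * \<i> * qexp z)) (at z)"
      by (rule DERIV_chain2[OF F'[OF q] has_field_derivative_qexp])
    then have "(D has_field_derivative
        2 * of_real pi * \<i> * (1 - 24 * (qexp z * sigma_series 1 (qexp z))) * D z) (at z)"
      unfolding D_def
      by (auto intro!: derivative_eq_intros has_field_derivative_qexp simp: algebra_simps)
    also have "2 * of_real pi * \<i> * (1 - 24 * (qexp z * sigma_series 1 (qexp z))) = 12 * app_hol (eisenstein 1) z"
      by (simp add: eisenstein_eq[OF z] eis_B_def eis_a_def)
    finally show ?thesis .
  qed
  have "D holomorphic_on upper_half_plane"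
    using D' open_upper_half_plane by (auto simp: holomorphic_on_open)
  then obtain d where d: "\<And>z. z \<in> upper_half_plane \<Longrightarrow> app_hol d z = D z"
    using obtain_hol_fun by blast
  have D0: "D z \<noteq> 0" for z
    by (simp add: D_def)
  have "isCont F 0"
    using DERIV_isCont[OF F'[of 0]] by simp
  then have "((\<lambda>z. F (qexp z)) \<longlongrightarrow> F 0) at_cusp"
    using qexp_tendsto_0_at_cusp by (rule isCont_tendsto_compose)
  then have "((\<lambda>z. exp (- 24 * F (qexp z))) \<longlongrightarrow> exp (- 24 * F 0)) at_cusp"
    by (intro tendsto_intros)
  then have l: "((\<lambda>z. app_hol d z / qexp z) \<longlongrightarrow> exp (- 24 * F 0)) at_cusp"
    by (rule tendsto_cong_at_cusp) (simp add: d D_def)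
  have "((\<lambda>z. (app_hol d z / qexp z) * qexp z) \<longlongrightarrow> exp (- 24 * F 0) * 0) at_cusp"
    using l qexp_tendsto_0_at_cusp by (rule tendsto_mult)
  then have lim: "(app_hol d \<longlongrightarrow> 0) at_cusp"
    by simp
  have inv: "D (- (1 / z)) = z ^ 12 * D z" if z: "z \<in> upper_half_plane" for z
  proof -
    define Q where "Q = (\<lambda>z. D (- (1 / z)) / (z ^ 12 * D z))"
    have Q': "(Q has_field_derivative 0) (at w within upper_half_plane)" if w: "w \<in> upper_half_plane" for w
    proof -
      have w0: "w \<noteq> 0"
        using w by (rule upper_half_plane_nonzero)
      have "((\<lambda>w. - (1 / w)) has_field_derivative 1 / w ^ 2) (at w)"
        using w0 by (auto intro!: derivative_eq_intros simp: power2_eq_square)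
      note * = DERIV_chain2[OF D'[OF minus_inverse_in_upper_half_plane[OF w]] this]
      have N: "((\<lambda>w. D (- (1 / w))) has_field_derivative
          12 * (app_hol (eisenstein 1) w + 1 / w) * D (- (1 / w))) (at w)"
        by (rule DERIV_cong[OF *], unfold eisenstein_inversion[OF w])
          (use w0 in \<open>simp add: field_simps power2_eq_square\<close>)
      have "((\<lambda>w. w ^ 12 * D w) has_field_derivative
          12 * w ^ 11 * D w + w ^ 12 * (12 * app_hol (eisenstein 1) w * D w)) (at w)"
        by (auto intro!: derivative_eq_intros D'[OF w])
      also have "12 * w ^ 11 * D w + w ^ 12 * (12 * app_hol (eisenstein 1) w * D w) =
          12 * (app_hol (eisenstein 1) w + 1 / w) * (w ^ 12 * D w)"
        using w0 by (simp add: field_simps eval_nat_numeral)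
      finally have M: "((\<lambda>w. w ^ 12 * D w) has_field_derivative
          12 * (app_hol (eisenstein 1) w + 1 / w) * (w ^ 12 * D w)) (at w)" .
      have "w ^ 12 * D w \<noteq> 0"
        using w0 D0 by simp
      from DERIV_divide[OF N M this] have "(Q has_field_derivative 0) (at w)"
        unfolding Q_def by (simp add: algebra_simps)
      then show ?thesis
        by (rule has_field_derivative_at_within)
    qed
    then obtain c where c: "\<And>w. w \<in> upper_half_plane \<Longrightarrow> Q w = c"
      using has_field_derivative_zero_constant[OF convex_upper_half_plane, of Q] by blast
    have "\<i> \<in> upper_half_plane"
      by (simp add: upper_half_plane_def)
    moreover have "Q \<i> = 1"
      using D0[of \<i>] by (simp add: Q_def eval_nat_numeral)
    ultimately have "Q z = 1"
      using c z by metis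
    then show ?thesis
      using D0[of z] upper_half_plane_nonzero[OF z] by (simp add: Q_def field_simps)
  qed
  show ?thesis
  proof (rule that[of d "exp (- 24 * F 0)"])
    have "D (z + 1) = D z" for z
      by (simp add: D_def qexp_add)
    then show "modular_form 12 d"
      using lim inv add_of_int_in_upper_half_plane[of _ 1] minus_inverse_in_upper_half_plane
      by (auto simp: modular_form_def d)
  qed (use l d D0 in auto)
qed

text \<open>With the normalisation of the series at hand, \<open>27\<close> is the factor for which the constant terms cancel.\<close>

definition discriminant :: hol_fun where
  "discriminant = eisenstein 2 ^ 3 - scale_hol 27 (eisenstein 3 ^ 2)"

lemma modular_form_discriminant: "modular_form 12 discriminant"
  using modular_form_power[OF modular_form_eisenstein(1), of 3] modular_form_power[OF modular_form_eisenstein(2), of 2]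
  unfolding discriminant_def by (intro modular_form_diff modular_form_scale) auto

text \<open>The coefficient of \<open>q\<close> is \<open>3 \<cdot> 240 + 2 \<cdot> 504 = 1728\<close> times the common value of \<open>eis_a 2 ^ 3\<close> and
  \<open>27 * eis_a 3 ^ 2\<close>.\<close>

lemma discriminant_at_cusp:
  obtains l where "((\<lambda>z. app_hol discriminant z / qexp z) \<longlongrightarrow> l) at_cusp" "l \<noteq> 0"
proof
  define a :: complex where "a = (2 * of_real pi * \<i> / 12)"
  define s t where "s = (\<lambda>z. sigma_series 3 (qexp z))" and "t = (\<lambda>z. sigma_series 5 (qexp z))"
  have e: "eis_a 2 = 12 * a ^ 2" "eis_a 3 = 8 * a ^ 3"
    by (simp_all add: eis_a_def a_def)
  have st: "(s \<longlongrightarrow> 1) at_cusp" "(t \<longlongrightarrow> 1) at_cusp"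
    unfolding s_def t_def by (rule sigma_series_at_cusp)+
  have alg: "(b * (1 + 240 * (q * u))) ^ 3 - 27 * (c * (1 - 504 * (q * v))) ^ 2 =
      (b ^ 3 - 27 * c ^ 2) + q * (b ^ 3 * (720 * u + 172800 * (q * u ^ 2) + 13824000 * (q ^ 2 * u ^ 3)) +
        27 * c ^ 2 * (1008 * v - 254016 * (q * v ^ 2)))" for b c q u v :: complex
    by (simp add: algebra_simps power3_eq_cube power2_eq_square)
  define X where "X = (\<lambda>z. 1728 * a ^ 6 * (720 * s z + 172800 * (qexp z * s z ^ 2) +
      13824000 * (qexp z ^ 2 * s z ^ 3) + (1008 * t z - 254016 * (qexp z * t z ^ 2))))"
  have eq: "app_hol discriminant z = qexp z * X z" if z: "z \<in> upper_half_plane" for z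
  proof -
    have "app_hol discriminant z = (eis_a 2 * (1 + 240 * (qexp z * s z))) ^ 3 -
        27 * (eis_a 3 * (1 - 504 * (qexp z * t z))) ^ 2"
      using z by (simp add: discriminant_def eisenstein_eq eis_B_def s_def t_def)
    also have "\<dots> = qexp z * X z"
      unfolding alg e X_def by (simp add: power_mult_distrib algebra_simps flip: power_mult)
    finally show ?thesis .
  qed
  have "(X \<longlongrightarrow> 1728 * a ^ 6 * (720 * 1 + 172800 * (0 * 1 ^ 2) + 13824000 * (0 ^ 2 * 1 ^ 3) +
      (1008 * 1 - 254016 * (0 * 1 ^ 2)))) at_cusp"
    unfolding X_def by (intro tendsto_intros st qexp_tendsto_0_at_cusp)
  then show "((\<lambda>z. app_hol discriminant z / qexp z) \<longlongrightarrow> 1728 * a ^ 6 * (720 * 1 + 172800 * (0 * 1 ^ 2) + 13824000 * (0 ^ 2 * 1 ^ 3) +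
      (1008 * 1 - 254016 * (0 * 1 ^ 2)))) at_cusp"
    by (rule tendsto_cong_at_cusp) (simp add: eq)
  show "1728 * a ^ 6 * (720 * 1 + 172800 * (0 * 1 ^ 2) + 13824000 * (0 ^ 2 * 1 ^ 3) +
      (1008 * 1 - 254016 * (0 * 1 ^ 2))) \<noteq> 0"
    by (simp add: a_def)
qed

lemma discriminant_nonzero_at_cusp: "eventually (\<lambda>z. app_hol discriminant z \<noteq> 0) at_cusp"
proof -
  obtain l where "((\<lambda>z. app_hol discriminant z / qexp z) \<longlongrightarrow> l) at_cusp" "l \<noteq> 0"
    by (rule discriminant_at_cusp)
  then have "eventually (\<lambda>z. app_hol discriminant z / qexp z \<noteq> 0) at_cusp"
    by (rule tendsto_imp_eventually_ne)
  then show ?thesis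
    by (rule eventually_mono) auto
qed

lemma discriminant_tendsto_0: "(app_hol discriminant \<longlongrightarrow> 0) at_cusp"
proof -
  obtain l where "((\<lambda>z. app_hol discriminant z / qexp z) \<longlongrightarrow> l) at_cusp" "l \<noteq> 0"
    by (rule discriminant_at_cusp)
  then have "((\<lambda>z. app_hol discriminant z / qexp z * qexp z) \<longlongrightarrow> l * 0) at_cusp"
    by (intro tendsto_mult qexp_tendsto_0_at_cusp)
  then show ?thesis
    by simp
qed

lemma discriminant_nonzero: "discriminant \<noteq> 0"
proof
  assume "discriminant = 0"
  then have "eventually (\<lambda>z. False) at_cusp"
    using discriminant_nonzero_at_cusp by simp
  then show False
    using at_cusp_neq_bot by simp
qed

section \<open>The structure of classical modular forms\<close>

definition eis_monomials :: "int \<Rightarrow> hol_fun set" where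
  "eis_monomials k = {eisenstein 2 ^ b * eisenstein 3 ^ c |b c. 4 * int b + 6 * int c = k}"

lemma eis_monomials_mult:
  assumes "x \<in> eis_monomials j" "y \<in> eis_monomials k"
  shows "x * y \<in> eis_monomials (j + k)"
proof -
  obtain b c b' c' where "x = eisenstein 2 ^ b * eisenstein 3 ^ c" "4 * int b + 6 * int c = j"
    "y = eisenstein 2 ^ b' * eisenstein 3 ^ c'" "4 * int b' + 6 * int c' = k"
    using assms by (auto simp: eis_monomials_def)
  then show ?thesis
    unfolding eis_monomials_def
    by (intro CollectI exI[of _ "b + b'"] exI[of _ "c + c'"]) (auto simp: power_add algebra_simps)
qed

text \<open>For a zero-free cusp form \<open>d\<close> of weight \<open>12\<close>, the product \<open>f ^ 12 * d ^ (- k)\<close> has weight \<open>0\<close> and vanishes at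
  the cusp.\<close>

lemma modular_form_negative_weight:
  assumes f: "modular_form k f" and k: "k < 0"
  shows "f = 0"
proof -
  obtain d l where d: "modular_form 12 d" "\<forall>z\<in>upper_half_plane. app_hol d z \<noteq> 0"
    "((\<lambda>z. app_hol d z / qexp z) \<longlongrightarrow> l) at_cusp" "l \<noteq> 0"
    by (rule exists_nonvanishing_cusp_form)
  have "((\<lambda>z. app_hol d z / qexp z * qexp z) \<longlongrightarrow> l * 0) at_cusp"
    using d(3) by (intro tendsto_mult qexp_tendsto_0_at_cusp)
  then have "(app_hol d \<longlongrightarrow> 0) at_cusp"
    by simp
  then have "(app_hol (d ^ nat (- k)) \<longlongrightarrow> 0 ^ nat (- k)) at_cusp"
    by (rule tendsto_app_hol_power)
  then have dlim: "(app_hol (d ^ nat (- k)) \<longlongrightarrow> 0) at_cusp"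
    using k by (simp add: power_0_left)
  obtain m where "(app_hol f \<longlongrightarrow> m) at_cusp"
    using f by (rule modular_form_at_cusp)
  then have "(app_hol (f ^ 12) \<longlongrightarrow> m ^ 12) at_cusp"
    by (rule tendsto_app_hol_power)
  from tendsto_app_hol_mult[OF this dlim] have "(app_hol (f ^ 12 * d ^ nat (- k)) \<longlongrightarrow> 0) at_cusp"
    by (simp only: mult_zero_right)
  moreover have "modular_form (int 12 * k + int (nat (- k)) * 12) (f ^ 12 * d ^ nat (- k))"
    by (intro modular_form_mult modular_form_power f d(1))
  then have "modular_form 0 (f ^ 12 * d ^ nat (- k))"
    using k by simp
  ultimately have "f ^ 12 * d ^ nat (- k) = 0"
    by (intro modular_form_weight_0_cusp)
  then have *: "app_hol (f ^ 12 * d ^ nat (- k)) z = 0" for z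
    by simp
  show ?thesis
  proof (rule hol_fun_eqI)
    fix z assume "z \<in> upper_half_plane"
    then show "app_hol f z = app_hol 0 z"
      using *[of z] d(2) by simp
  qed
qed

text \<open>Applying the inversion twice gives \<open>f = - f\<close>.\<close>

lemma modular_form_odd_weight:
  assumes f: "modular_form k f" and k: "odd k"
  shows "f = 0"
proof (rule hol_fun_eqI)
  fix z assume z: "z \<in> upper_half_plane"
  then have z': "- (1 / z) \<in> upper_half_plane"
    by (rule minus_inverse_in_upper_half_plane)
  have z0: "z \<noteq> 0"
    using z by (rule upper_half_plane_nonzero)
  have "app_hol f z = app_hol f (- (1 / (- (1 / z))))"
    by simp
  also have "\<dots> = (- (1 / z)) powi k * (z powi k * app_hol f z)"
    unfolding modular_form_inversion[OF f z'] modular_form_inversion[OF f z] ..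
  also have "\<dots> = ((- (1 / z)) * z) powi k * app_hol f z"
    by (simp only: power_int_mult_distrib mult.assoc)
  also have "(- (1 / z)) * z = - 1"
    using z0 by simp
  also have "(- 1) powi k = (- 1 :: complex)"
    using k by (simp add: power_int_minus_left)
  finally show "app_hol f z = app_hol 0 z"
    by (simp add: eq_neg_iff_add_eq_0 flip: mult_2)
qed

text \<open>Both \<open>f / qexp\<close> and \<open>d / qexp\<close> have limits at the cusp, the second one not \<open>0\<close>, so the quotient of \<open>f\<close> and \<open>d\<close>
  is again regular there.\<close>

lemma cusp_form_divisible_by_nonvanishing:
  assumes f: "modular_form k f" and lim: "(app_hol f \<longlongrightarrow> 0) at_cusp"
    and d: "modular_form 12 d" "\<forall>z\<in>upper_half_plane. app_hol d z \<noteq> 0"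
      "((\<lambda>z. app_hol d z / qexp z) \<longlongrightarrow> l) at_cusp" "l \<noteq> 0"
  obtains h where "modular_form (k - 12) h" "f = h * d"
proof -
  have "(\<lambda>z. app_hol f z / app_hol d z) holomorphic_on upper_half_plane"
    using d(2) by (intro holomorphic_on_divide holomorphic_on_app_hol) auto
  then obtain h where h: "\<And>z. z \<in> upper_half_plane \<Longrightarrow> app_hol h z = app_hol f z / app_hol d z"
    using obtain_hol_fun by blast
  obtain m where m: "((\<lambda>z. app_hol f z / qexp z) \<longlongrightarrow> m) at_cusp"
    using holomorphic_on_app_hol modular_form_translate[OF f] lim by (rule periodic_vanishing_at_cusp)
  have "((\<lambda>z. (app_hol f z / qexp z) / (app_hol d z / qexp z)) \<longlongrightarrow> m / l) at_cusp"
    using m d(3,4) by (rule tendsto_divide)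
  then have "(app_hol h \<longlongrightarrow> m / l) at_cusp"
    by (rule tendsto_cong_at_cusp) (simp add: h)
  moreover have "app_hol h (z + 1) = app_hol h z" if z: "z \<in> upper_half_plane" for z
    using add_of_int_in_upper_half_plane[of z 1] z modular_form_translate[OF f z] modular_form_translate[OF d(1) z]
    by (simp add: h)
  moreover have "app_hol h (- (1 / z)) = z powi (k - 12) * app_hol h z" if z: "z \<in> upper_half_plane" for z
    using minus_inverse_in_upper_half_plane[OF z] z modular_form_inversion[OF f z] modular_form_inversion[OF d(1) z]
      upper_half_plane_nonzero[OF z]
    by (simp add: h power_int_diff)
  ultimately have "modular_form (k - 12) h"
    by (auto simp: modular_form_def)
  moreover have "f = h * d"
    by (rule hol_fun_eqI) (simp add: h d(2))
  ultimately show ?thesis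
    by (rule that)
qed

text \<open>The discriminant is itself divisible by the zero-free form, with a quotient of weight \<open>0\<close>, so the two are
  proportional.\<close>

lemma cusp_form_divisible_by_discriminant:
  assumes "modular_form k f" "(app_hol f \<longlongrightarrow> 0) at_cusp"
  obtains h where "modular_form (k - 12) h" "f = h * discriminant"
proof -
  obtain d l where d: "modular_form 12 d" "\<forall>z\<in>upper_half_plane. app_hol d z \<noteq> 0"
    "((\<lambda>z. app_hol d z / qexp z) \<longlongrightarrow> l) at_cusp" "l \<noteq> 0"
    by (rule exists_nonvanishing_cusp_form)
  obtain h where h: "modular_form (k - 12) h" "f = h * d"
    by (rule cusp_form_divisible_by_nonvanishing[OF assms d])
  obtain e where e: "modular_form (12 - 12) e" "discriminant = e * d"
    by (rule cusp_form_divisible_by_nonvanishing[OF modular_form_discriminant discriminant_tendsto_0 d])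
  then obtain c where c: "e = scale_hol c 1"
    using modular_form_weight_0[of e] by auto
  have "c \<noteq> 0"
    using e(2) discriminant_nonzero unfolding c by (auto simp: hol.scale_zero_left)
  then have "f = scale_hol (1 / c) h * discriminant"
    unfolding h(2) e(2) c by (intro hol_fun_eqI) simp
  with modular_form_scale[OF h(1)] show ?thesis
    by (rule that)
qed

lemma eis_monomials_modular_form: "modular_form (4 * int b + 6 * int c) (eisenstein 2 ^ b * eisenstein 3 ^ c)"
  using modular_form_mult[OF modular_form_power[OF modular_form_eisenstein(1), of b] modular_form_power[OF modular_form_eisenstein(2), of c]]
  by (simp add: mult.commute)

lemma discriminant_in_span: "discriminant \<in> hol.span (eis_monomials 12)"
  unfolding discriminant_def
proof (intro hol.span_diff hol.span_scale hol.span_base)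
  show "eisenstein 2 ^ 3 \<in> eis_monomials 12"
    unfolding eis_monomials_def by (intro CollectI exI[of _ 3] exI[of _ 0]) simp
  show "eisenstein 3 ^ 2 \<in> eis_monomials 12"
    unfolding eis_monomials_def by (intro CollectI exI[of _ 0] exI[of _ 2]) simp
qed

text \<open>A multiple of the monomial removes the value at the cusp, and the remaining cusp form is a multiple of the
  discriminant.\<close>

lemma modular_form_in_span_step:
  assumes f: "modular_form (4 * int b + 6 * int c) f"
    and IH: "\<And>h. modular_form (4 * int b + 6 * int c - 12) h \<Longrightarrow> h \<in> hol.span (eis_monomials (4 * int b + 6 * int c - 12))"
  obtains a h where "f = scale_hol a (eisenstein 2 ^ b * eisenstein 3 ^ c) + h * discriminant"
    "modular_form (4 * int b + 6 * int c - 12) h" "f \<in> hol.span (eis_monomials (4 * int b + 6 * int c))"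
proof -
  define k where "k = 4 * int b + 6 * int c"
  define M where "M = eisenstein 2 ^ b * eisenstein 3 ^ c"
  have M: "modular_form k M"
    unfolding k_def M_def by (rule eis_monomials_modular_form)
  define m where "m = eis_a 2 ^ b * eis_a 3 ^ c"
  have m0: "m \<noteq> 0"
    by (simp add: m_def eis_a_nonzero)
  have Mm: "(app_hol M \<longlongrightarrow> m) at_cusp"
    unfolding M_def m_def
    by (intro tendsto_app_hol_mult tendsto_app_hol_power eisenstein_at_cusp)
  obtain l where l: "(app_hol f \<longlongrightarrow> l) at_cusp"
    using f by (rule modular_form_at_cusp)
  have "((\<lambda>z. app_hol f z - l / m * app_hol M z) \<longlongrightarrow> l - l / m * m) at_cusp"
    by (intro tendsto_intros l Mm)
  then have lim: "(app_hol (f - scale_hol (l / m) M) \<longlongrightarrow> 0) at_cusp"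
    using m0 by simp
  have mf: "modular_form k (f - scale_hol (l / m) M)"
    using f M unfolding k_def by (intro modular_form_diff modular_form_scale)
  obtain h where h: "modular_form (k - 12) h" "f - scale_hol (l / m) M = h * discriminant"
    by (rule cusp_form_divisible_by_discriminant[OF mf lim])
  then have eq: "f = scale_hol (l / m) M + h * discriminant"
    by (simp add: algebra_simps)
  have "h * discriminant \<in> hol.span (eis_monomials k)"
  proof (rule span_mult)
    show "h \<in> hol.span (eis_monomials (k - 12))"
      using h(1) IH unfolding k_def by blast
    show "x * y \<in> eis_monomials k" if "x \<in> eis_monomials (k - 12)" "y \<in> eis_monomials 12" for x y
      using eis_monomials_mult[OF that] by simp
  qed (rule discriminant_in_span)
  moreover have "M \<in> eis_monomials k"
    by (auto simp: eis_monomials_def M_def k_def)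
  ultimately have "f \<in> hol.span (eis_monomials k)"
    unfolding eq by (auto intro: hol.span_add hol.span_scale hol.span_base)
  with eq h(1) show ?thesis
    unfolding k_def M_def by (rule that)
qed

text \<open>The square and the cube of \<open>f\<close> have weights \<open>4\<close> and \<open>6\<close>, so \<open>f\<^sup>2 = a g\<^sub>2\<close> and \<open>f\<^sup>3 = b g\<^sub>3\<close>. If \<open>a \<noteq> 0\<close>, then
  \<open>g\<^sub>2\<^sup>3\<close> is a constant multiple of \<open>g\<^sub>3\<^sup>2\<close>; comparison at the cusp shows that the factor is \<open>27\<close>, and the discriminant
  would vanish.\<close>

lemma modular_form_weight_2:
  assumes f: "modular_form 2 f"
  shows "f = 0"
proof -
  have neg: "h = 0" if "modular_form k h" "k < 0" for k h
    using that by (rule modular_form_negative_weight)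
  have f2: "modular_form (4 * int 1 + 6 * int 0) (f ^ 2)"
    using modular_form_power[OF f, of 2] by simp
  obtain a h where a: "f ^ 2 = scale_hol a (eisenstein 2 ^ 1 * eisenstein 3 ^ 0) + h * discriminant"
    "modular_form (4 * int 1 + 6 * int 0 - 12) h"
    by (rule modular_form_in_span_step[OF f2]) (auto dest!: neg intro: hol.span_zero)
  from a(2) have h: "h = 0"
    by (rule neg) simp
  have f3: "modular_form (4 * int 0 + 6 * int 1) (f ^ 3)"
    using modular_form_power[OF f, of 3] by simp
  obtain b h' where b: "f ^ 3 = scale_hol b (eisenstein 2 ^ 0 * eisenstein 3 ^ 1) + h' * discriminant"
    "modular_form (4 * int 0 + 6 * int 1 - 12) h'"
    by (rule modular_form_in_span_step[OF f3]) (auto dest!: neg intro: hol.span_zero)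
  from b(2) have h': "h' = 0"
    by (rule neg) simp
  have A: "app_hol f z ^ 2 = a * app_hol (eisenstein 2) z"
    and B: "app_hol f z ^ 3 = b * app_hol (eisenstein 3) z" if "z \<in> upper_half_plane" for z
    using arg_cong[OF a(1), of "\<lambda>f. app_hol f z"] arg_cong[OF b(1), of "\<lambda>f. app_hol f z"] that
    by (simp_all add: h h')
  have AB: "a ^ 3 * app_hol (eisenstein 2) z ^ 3 = b ^ 2 * app_hol (eisenstein 3) z ^ 2"
    if "z \<in> upper_half_plane" for z
  proof -
    have "(app_hol f z ^ 2) ^ 3 = (app_hol f z ^ 3) ^ 2"
      by (simp flip: power_mult)
    then show ?thesis
      unfolding A[OF that] B[OF that] by (simp add: power_mult_distrib)
  qed
  have "((\<lambda>z. a ^ 3 * app_hol (eisenstein 2) z ^ 3) \<longlongrightarrow> a ^ 3 * eis_a 2 ^ 3) at_cusp"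
    by (intro tendsto_intros eisenstein_at_cusp)
  moreover have "((\<lambda>z. a ^ 3 * app_hol (eisenstein 2) z ^ 3) \<longlongrightarrow> b ^ 2 * eis_a 3 ^ 2) at_cusp"
    by (rule tendsto_cong_at_cusp[of "\<lambda>z. b ^ 2 * app_hol (eisenstein 3) z ^ 2"])
      (auto simp: AB intro!: tendsto_intros eisenstein_at_cusp)
  ultimately have "a ^ 3 * eis_a 2 ^ 3 = b ^ 2 * eis_a 3 ^ 2"
    by (rule tendsto_unique[OF at_cusp_neq_bot])
  moreover have "eis_a 2 ^ 3 = 27 * eis_a 3 ^ 2"
    by (simp add: eis_a_def eval_nat_numeral)
  ultimately have b2: "b ^ 2 = 27 * a ^ 3"
    using eis_a_nonzero[of 3] by (simp add: algebra_simps)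
  have "a = 0"
  proof (rule ccontr)
    assume a0: "a \<noteq> 0"
    have "discriminant = 0"
    proof (rule hol_fun_eqI)
      fix z assume z: "z \<in> upper_half_plane"
      show "app_hol discriminant z = app_hol 0 z"
        using AB[OF z] a0 z unfolding b2 by (simp add: discriminant_def)
    qed
    with discriminant_nonzero show False ..
  qed
  show ?thesis
    by (rule hol_fun_eqI) (use A \<open>a = 0\<close> in simp)
qed

text \<open>Induction on the weight. Every even weight \<open>k \<ge> 4\<close> is of the form \<open>4 b + 6 c\<close>, and weight \<open>2\<close>, which is
  not, carries no forms.\<close>

theorem modular_form_in_span:
  assumes "modular_form k f"
  shows "f \<in> hol.span (eis_monomials k)"
proof -
  have "\<forall>f. modular_form (int n) f \<longrightarrow> f \<in> hol.span (eis_monomials (int n))" for n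
  proof (induction n rule: less_induct)
    case (less n)
    show ?case
    proof (intro allI impI)
      fix f assume f: "modular_form (int n) f"
      consider "odd n" | "n = 0" | "n = 2" | m where "n = 2 * m" "m \<ge> 2"
        by (cases "n = 0"; cases "n = 2"; cases "odd n") (auto elim!: evenE)
      then show "f \<in> hol.span (eis_monomials (int n))"
      proof cases
        case 1
        then have "f = 0"
          using modular_form_odd_weight[OF f] by simp
        then show ?thesis
          by (simp add: hol.span_zero)
      next
        case 2
        obtain c where "f = scale_hol c 1"
          using modular_form_weight_0[of f] f 2 by auto
        moreover have "1 \<in> eis_monomials (int n)"
          using 2 unfolding eis_monomials_def by (intro CollectI exI[of _ 0]) simp
        ultimately show ?thesis
          by (simp add: hol.span_scale hol.span_base)
      next
        case 3
        then have "f = 0"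
          using modular_form_weight_2[of f] f by simp
        then show ?thesis
          by (simp add: hol.span_zero)
      next
        case 4
        obtain b c where bc: "m = 2 * b + 3 * c"
        proof (cases "even m")
          case True
          then show ?thesis
            using that[of "m div 2" 0] by auto
        next
          case False
          then show ?thesis
            using 4(2) that[of "(m - 3) div 2" 1] by (auto elim!: oddE)
        qed
        have n: "int n = 4 * int b + 6 * int c"
          by (simp add: 4 bc)
        show ?thesis
        proof (rule modular_form_in_span_step[of b c f])
          show "modular_form (4 * int b + 6 * int c) f"
            using f n by simp
        next
          fix h assume h: "modular_form (4 * int b + 6 * int c - 12) h"
          show "h \<in> hol.span (eis_monomials (4 * int b + 6 * int c - 12))"
          proof (cases "n < 12")
            case True
            then have "h = 0"
              using modular_form_negative_weight[OF h] n by simp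
            then show ?thesis
              by (simp add: hol.span_zero)
          next
            case False
            then have "4 * int b + 6 * int c - 12 = int (n - 12)"
              using n by simp
            then show ?thesis
              using less[of "n - 12"] False h by simp
          qed
        qed (simp add: n)
      qed
    qed
  qed
  note nonneg = this
  show ?thesis
  proof (cases "k < 0")
    case True
    then have "f = 0"
      using assms by (intro modular_form_negative_weight)
    then show ?thesis
      by (simp add: hol.span_zero)
  next
    case False
    then obtain n where "k = int n"
      using nonneg_int_cases[of k] by auto
    then show ?thesis
      using nonneg[of n] assms by simp
  qed
qed

section \<open>Families of associated functions\<close>

lemma SL2Z_iff: "A \<in> SL2Z \<longleftrightarrow> A$1$1 * A$2$2 - A$1$2 * A$2$1 = 1"
  by (simp add: SL2Z_def det_2)

lemma linear_form_nonzero: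
  assumes "z \<in> upper_half_plane" "a * d - b * c = (1 :: int)"
  shows "of_int c * z + of_int d \<noteq> 0"
proof
  assume eq: "of_int c * z + of_int d = 0"
  from arg_cong[OF eq, of Im] have "c = 0"
    using assms(1) by (simp add: upper_half_plane_def)
  with eq assms(2) show False
    by simp
qed

lemma autj_nonzero: "A \<in> SL2Z \<Longrightarrow> z \<in> upper_half_plane \<Longrightarrow> autj A z \<noteq> 0"
  unfolding autj_def SL2Z_iff by (rule linear_form_nonzero)

lemma fractional_linear_in_upper_half_plane:
  assumes "z \<in> upper_half_plane" "a * d - b * c = (1 :: int)"
  shows "(of_int a * z + of_int b) / (of_int c * z + of_int d) \<in> upper_half_plane"
proof -
  have "(of_int a * Im z) * (of_int c * Re z + of_int d) - (of_int a * Re z + of_int b) * (of_int c * Im z) =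
      of_int (a * d - b * c) * Im z"
    by (simp add: algebra_simps)
  then have "(of_int a * Im z) * (of_int c * Re z + of_int d) - (of_int a * Re z + of_int b) * (of_int c * Im z) > 0"
    using assms by (simp add: upper_half_plane_def)
  moreover have "(of_int c * Re z + of_int d)\<^sup>2 + (of_int c * Im z)\<^sup>2 > 0"
    using linear_form_nonzero[OF assms] by (auto simp: complex_eq_iff sum_power2_gt_zero_iff)
  ultimately show ?thesis
    unfolding upper_half_plane_def mem_Collect_eq Im_divide by simp
qed

lemma moebius_act_in_upper_half_plane:
  "A \<in> SL2Z \<Longrightarrow> z \<in> upper_half_plane \<Longrightarrow> moebius_act A z \<in> upper_half_plane"
  unfolding moebius_act_def SL2Z_iff by (rule fractional_linear_in_upper_half_plane)

lemma eisenstein_translate: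
  "z \<in> upper_half_plane \<Longrightarrow> app_hol (eisenstein k) (z + of_int n) = app_hol (eisenstein k) z"
  by (rule periodic_of_int) (rule eisenstein_plus_1)

text \<open>Euclid's algorithm on the first column. With \<open>n = a div c\<close> the point \<open>w - n\<close> is \<open>- 1 / w'\<close>, where the
  matrix of \<open>w'\<close> has the lower left entry \<open>a mod c\<close>. So the laws for translation and inversion carry the
  formulas over from \<open>w'\<close> to \<open>w\<close>.\<close>

lemma eisenstein_fractional_linear:
  fixes a b c d :: int
  assumes "z \<in> upper_half_plane" "a * d - b * c = 1"
  defines "j \<equiv> of_int c * z + of_int d"
  defines "w \<equiv> (of_int a * z + of_int b) / j"
  shows "app_hol (eisenstein 1) w = j ^ 2 * app_hol (eisenstein 1) z + of_int c * j \<and>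
    app_hol (eisenstein 2) w = j ^ 4 * app_hol (eisenstein 2) z \<and>
    app_hol (eisenstein 3) w = j ^ 6 * app_hol (eisenstein 3) z"
  using assms(2) unfolding j_def w_def
proof (induction "nat \<bar>c\<bar>" arbitrary: a b c d rule: less_induct)
  case less
  show ?case
  proof (cases "c = 0")
    case True
    with less.prems have "a = 1 \<and> d = 1 \<or> a = - 1 \<and> d = - 1"
      by (simp add: zmult_eq_1_iff)
    then show ?thesis
      using eisenstein_translate[OF assms(1), of _ b] eisenstein_translate[OF assms(1), of _ "- b"] True by auto
  next
    case False
    define n where "n = a div c"
    define c' d' where "c' = a - n * c" and "d' = b - n * d"
    define j j' where "j = of_int c * z + of_int d" and "j' = of_int c' * z + of_int d'"
    define w w' where "w = (of_int a * z + of_int b) / j" and "w' = - (j / j')"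
    have "c' = a mod c"
      by (simp add: c'_def n_def minus_div_mult_eq_mod)
    then have lt: "nat \<bar>c'\<bar> < nat \<bar>c\<bar>"
      using abs_mod_less[OF False, of a] by simp
    have det: "(- c) * d' - (- d) * c' = 1"
      using less.prems by (simp add: c'_def d'_def algebra_simps)
    have j0: "j \<noteq> 0" "j' \<noteq> 0"
      unfolding j_def j'_def
      using linear_form_nonzero[OF assms(1) less.prems] linear_form_nonzero[OF assms(1) det] by auto
    have w'_eq: "(of_int (- c) * z + of_int (- d)) / j' = w'"
      by (simp add: w'_def j_def divide_simps)
    have w': "w' \<in> upper_half_plane"
      using fractional_linear_in_upper_half_plane[OF assms(1) det] unfolding j'_def[symmetric] w'_eq .
    note IH = less.hyps[OF lt det, folded j'_def, unfolded w'_eq]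
    have "w = - (1 / w') + of_int n"
      using j0 by (simp add: w_def w'_def field_simps) (simp add: j_def j'_def c'_def d'_def algebra_simps)
    then have E: "app_hol (eisenstein k) w = app_hol (eisenstein k) (- (1 / w'))" for k
      using eisenstein_translate[OF minus_inverse_in_upper_half_plane[OF w']] by simp
    have wj: "w' ^ k * (j' ^ k * x) = (- j) ^ k * x" for k x
      using j0 by (simp add: w'_def flip: mult.assoc power_mult_distrib)
    \<comment> \<open>The determinant of the new matrix, which turns the inhomogeneous term at \<open>w'\<close> into the one at \<open>w\<close>.\<close>
    have cj: "of_int c' * j = 1 + of_int c * j'"
    proof -
      have "of_int c' * j - of_int c * j' = of_int ((- c) * d' - (- d) * c')"
        by (simp add: j_def j'_def algebra_simps)
      then show ?thesis
        unfolding det by (simp add: algebra_simps)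
    qed
    have "w' ^ 2 * (of_int c' * j') + w' = of_int c * j"
    proof -
      have "w' ^ 2 * (of_int c' * j') + w' = (of_int c' * j - 1) * (j / j')"
        using j0 by (simp add: w'_def field_simps power2_eq_square)
      then show ?thesis
        unfolding cj using j0 by simp
    qed
    then have "app_hol (eisenstein 1) w = j ^ 2 * app_hol (eisenstein 1) z + of_int c * j"
      unfolding E eisenstein_inversion[OF w'] IH[THEN conjunct1] using wj[of 2]
      by (simp add: ring_distribs add.assoc)
    moreover have "app_hol (eisenstein 2) w = j ^ 4 * app_hol (eisenstein 2) z"
      unfolding E eisenstein_inversion[OF w'] IH[THEN conjunct2, THEN conjunct1] wj by simp
    moreover have "app_hol (eisenstein 3) w = j ^ 6 * app_hol (eisenstein 3) z"
      unfolding E eisenstein_inversion[OF w'] IH[THEN conjunct2, THEN conjunct2] wj by simp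
    ultimately show ?thesis
      unfolding j_def w_def by blast
  qed
qed

lemma eisenstein_moebius:
  assumes "A \<in> SL2Z" "z \<in> upper_half_plane"
  shows "app_hol (eisenstein 1) (moebius_act A z) =
      autj A z ^ 2 * app_hol (eisenstein 1) z + of_int (A$2$1) * autj A z"
    and "app_hol (eisenstein 2) (moebius_act A z) = autj A z ^ 4 * app_hol (eisenstein 2) z"
    and "app_hol (eisenstein 3) (moebius_act A z) = autj A z ^ 6 * app_hol (eisenstein 3) z"
  using eisenstein_fractional_linear[of z "A$1$1" "A$2$2" "A$1$2" "A$2$1"] assms
  by (simp_all add: SL2Z_iff autj_def moebius_act_def)

text \<open>A form \<open>F 0\<close> with its associated functions \<open>F 1, \<dots>, F n\<close>, all equations being on the same footing: the
  associated functions of \<open>F i\<close> are \<open>F (i + 1), \<dots>, F n\<close>. Membership in \<open>diff_mod_forms n m\<close> amounts to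
  being the first member of such a family, which removes the recursion.\<close>

definition quasi_family :: "nat \<Rightarrow> int \<Rightarrow> (nat \<Rightarrow> hol_fun) \<Rightarrow> bool" where
  "quasi_family n m F \<longleftrightarrow> (\<forall>i\<le>n. regular_at_infinity (F i) \<and>
     (\<forall>A\<in>SL2Z. \<forall>z\<in>upper_half_plane. app_hol (F i) (moebius_act A z) =
        autj A z powi (m - 2 * int i) * (\<Sum>l\<le>n - i. of_nat ((n - i) choose l) *
          (of_int (A$2$1) / autj A z) ^ l * app_hol (F (i + l)) z)))"

text \<open>The function \<open>f\<close> that is subtracted in the definition is the missing term for \<open>l = 0\<close> of the sum.\<close>

lemma transforms_with_iff:
  assumes "F 0 = f"
  shows "transforms_with n m f F \<longleftrightarrow>
    (\<forall>A\<in>SL2Z. \<forall>z\<in>upper_half_plane. app_hol f (moebius_act A z) =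
       autj A z powi m * (\<Sum>l\<le>n. of_nat (n choose l) * (of_int (A$2$1) / autj A z) ^ l * app_hol (F l) z))"
  unfolding transforms_with_def slash_def
proof (intro ball_cong refl)
  fix A z assume A: "A \<in> SL2Z" and z: "z \<in> upper_half_plane"
  define j where "j = autj A z"
  define c where "c = (of_int (A$2$1) :: complex)"
  have j: "j \<noteq> 0"
    unfolding j_def using A z by (rule autj_nonzero)
  define S where "S = (\<Sum>i=1..n. of_nat (n choose i) * (c / j) ^ i * app_hol (F i) z)"
  have S: "(\<Sum>i=1..n. of_nat (n choose i) * c ^ i * j powi (- int i) * app_hol (F i) z) = S"
    unfolding S_def by (intro sum.cong refl) (simp add: power_int_minus power_divide field_simps)
  have S0: "(\<Sum>l\<le>n. of_nat (n choose l) * (c / j) ^ l * app_hol (F l) z) = app_hol f z + S"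
    unfolding atMost_atLeast0 by (subst sum.atLeast_Suc_atMost) (simp_all add: S_def assms)
  show "(autj A z powi - m * app_hol f (moebius_act A z) - app_hol f z =
      (\<Sum>i=1..n. of_nat (n choose i) * of_int (A$2$1) ^ i * autj A z powi - int i * app_hol (F i) z)) \<longleftrightarrow>
    (app_hol f (moebius_act A z) = autj A z powi m *
      (\<Sum>l\<le>n. of_nat (n choose l) * (of_int (A$2$1) / autj A z) ^ l * app_hol (F l) z))"
    unfolding j_def[symmetric] c_def[symmetric] S S0 using j
    by (auto simp: power_int_minus field_simps)
qed

lemma regular_diff_mod_forms: "f \<in> diff_mod_forms n m \<Longrightarrow> regular_at_infinity f"
  by (cases n) auto

lemma diff_mod_forms_imp_quasi_family:
  assumes "f \<in> diff_mod_forms n m"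
  obtains F where "F 0 = f" "quasi_family n m F"
proof (cases n)
  case 0
  have "quasi_family n m (\<lambda>_. f)"
    using assms autj_nonzero
    by (auto simp: 0 quasi_family_def slash_def power_int_minus field_simps)
  then show ?thesis
    using that[of "\<lambda>_. f"] by simp
next
  case (Suc n')
  obtain F G where F: "\<forall>i\<in>{1..n}. F i \<in> diff_mod_forms (n - i) (m - 2 * int i)"
    "transforms_with n m f F"
    "\<forall>i\<in>{1..n}. transforms_with (n - i) (m - 2 * int i) (F i) (G i) \<and> (\<forall>j\<in>{1..n - i}. G i j = F (i + j))"
    using assms unfolding Suc diff_mod_forms.simps mem_Collect_eq by blast
  define H where "H = F(0 := f)"
  have cong: "transforms_with k l g P \<longleftrightarrow> transforms_with k l g Q" if "\<And>i. i \<in> {1..k} \<Longrightarrow> P i = Q i" for k l g P Q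
    unfolding transforms_with_def using that by (intro ball_cong refl arg_cong2[of _ _ _ _ "(=)"] sum.cong) auto
  have trans: "transforms_with (n - i) (m - 2 * int i) (H i) (\<lambda>l. H (i + l))" if "i \<le> n" for i
  proof (cases "i = 0")
    case True
    have "transforms_with n m f H"
      using F(2) by (subst cong[of _ H F]) (auto simp: H_def)
    moreover have "H 0 = f"
      by (simp add: H_def)
    ultimately show ?thesis
      by (simp add: True)
  next
    case False
    then have "transforms_with (n - i) (m - 2 * int i) (F i) (G i)" "\<forall>j\<in>{1..n - i}. G i j = F (i + j)"
      using F(3) that by auto
    then have "transforms_with (n - i) (m - 2 * int i) (F i) (\<lambda>l. H (i + l))"
      by (subst cong[of _ _ "G i"]) (auto simp: H_def)
    then show ?thesis
      using False by (simp add: H_def)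
  qed
  have "regular_at_infinity (H i)" if "i \<le> n" for i
    using that F(1) regular_diff_mod_forms[OF assms] regular_diff_mod_forms[of "F i" "n - i" "m - 2 * int i"]
    by (cases "i = 0") (auto simp: H_def)
  then have "quasi_family n m H"
    unfolding quasi_family_def
    using trans by (subst (asm) transforms_with_iff) auto
  then show ?thesis
    using that[of H] by (simp add: H_def)
qed

lemma quasi_family_shift:
  assumes "quasi_family n m F" "k \<le> n"
  shows "quasi_family (n - k) (m - 2 * int k) (\<lambda>l. F (k + l))"
  unfolding quasi_family_def
proof (intro allI impI conjI ballI)
  fix i assume "i \<le> n - k"
  then have i: "k + i \<le> n"
    using assms(2) by simp
  show "regular_at_infinity (F (k + i))"
    using assms(1) i by (simp add: quasi_family_def)
  fix A z assume Az: "A \<in> SL2Z" "z \<in> upper_half_plane"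
  have e: "m - 2 * int k - 2 * int i = m - 2 * int (k + i)"
    by simp
  show "app_hol (F (k + i)) (moebius_act A z) = autj A z powi (m - 2 * int k - 2 * int i) *
      (\<Sum>l\<le>n - k - i. of_nat ((n - k - i) choose l) * (of_int (A$2$1) / autj A z) ^ l * app_hol (F (k + (i + l))) z)"
    using assms(1) i Az unfolding e quasi_family_def by (simp add: add.assoc)
qed

lemma quasi_family_transforms_with:
  assumes "quasi_family n m F" "i \<le> n"
  shows "transforms_with (n - i) (m - 2 * int i) (F i) (\<lambda>l. F (i + l))"
  using assms by (subst transforms_with_iff) (auto simp: quasi_family_def)

lemma quasi_family_imp_diff_mod_forms:
  assumes "quasi_family n m F"
  shows "F 0 \<in> diff_mod_forms n m"
  using assms
proof (induction n arbitrary: m F rule: less_induct)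
  case (less n)
  have reg: "regular_at_infinity (F 0)"
    using less.prems by (auto simp: quasi_family_def)
  have IH: "F k \<in> diff_mod_forms (n - k) (m - 2 * int k)" if "1 \<le> k" "k \<le> n" for k
    using less.IH[OF _ quasi_family_shift[OF less.prems that(2)]] that by simp
  show ?case
  proof (cases n)
    case 0
    then show ?thesis
      using less.prems autj_nonzero reg
      by (auto simp: quasi_family_def slash_def power_int_minus field_simps)
  next
    case (Suc n')
    have "F 0 \<in> diff_mod_forms (Suc n') m"
      unfolding diff_mod_forms.simps mem_Collect_eq unfolding Suc[symmetric]
    proof (intro exI[of _ F] exI[of _ "\<lambda>i j. F (i + j)"] conjI ballI reg)
      show "transforms_with n m (F 0) F"
        using quasi_family_transforms_with[OF less.prems, of 0] by simp
      fix i assume i: "i \<in> {1..n}"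
      show "F i \<in> diff_mod_forms (n - i) (m - 2 * int i)"
        using IH i by simp
      show "transforms_with (n - i) (m - 2 * int i) (F i) (\<lambda>j. F (i + j))"
        using i by (intro quasi_family_transforms_with less.prems) simp
      fix j assume j: "j \<in> {1..n - i}"
      have e: "n - i - j = n - (i + j)" "m - 2 * int i - 2 * int j = m - 2 * int (i + j)"
        by simp_all
      show "F (i + j) \<in> diff_mod_forms (n - i - j) (m - 2 * int i - 2 * int j)"
        unfolding e using i j by (intro IH) auto
    qed auto
    then show ?thesis
      by (simp only: Suc)
  qed
qed

text \<open>This is the substitution of \<open>a + b\<close> for the variable in \<open>\<Sum>t. (N choose t) F t X ^ t\<close>, carried out in two steps.\<close>

lemma binomial_resummation:
  fixes a b :: "'a :: comm_ring_1"
  shows "(\<Sum>k\<le>N. of_nat (N choose k) * a ^ k * (\<Sum>l\<le>N - k. of_nat ((N - k) choose l) * b ^ l * F (k + l))) =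
    (\<Sum>t\<le>N. of_nat (N choose t) * (a + b) ^ t * F t)"
proof -
  have "(\<Sum>k\<le>N. of_nat (N choose k) * a ^ k * (\<Sum>l\<le>N - k. of_nat ((N - k) choose l) * b ^ l * F (k + l))) =
      (\<Sum>(k, l)\<in>Sigma {..N} (\<lambda>k. {..N - k}). of_nat (N choose k) * a ^ k * (of_nat ((N - k) choose l) * b ^ l * F (k + l)))"
    by (simp add: sum_distrib_left sum.Sigma)
  also have "\<dots> = (\<Sum>(t, k)\<in>Sigma {..N} (\<lambda>t. {..t}). of_nat (N choose t) * (of_nat (t choose k) * a ^ k * b ^ (t - k)) * F t)"
  proof (rule sum.reindex_bij_witness[of _ "\<lambda>(t, k). (k, t - k)" "\<lambda>(k, l). (k + l, k)"])
    fix x assume "x \<in> Sigma {..N} (\<lambda>k. {..N - k})"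
    then obtain k l where x: "x = (k, l)" "k + l \<le> N"
      by (auto simp: le_diff_conv2 add.commute)
    have "(N choose (k + l)) * ((k + l) choose k) = (N choose k) * ((N - k) choose l)"
      using choose_mult[of k "k + l" N] x(2) by simp
    then have "(of_nat (N choose (k + l)) * of_nat ((k + l) choose k) :: 'a) = of_nat (N choose k) * of_nat ((N - k) choose l)"
      by (simp flip: of_nat_mult)
    then show "(case case x of (k, l) \<Rightarrow> (k + l, k) of (t, k) \<Rightarrow> of_nat (N choose t) * (of_nat (t choose k) * a ^ k * b ^ (t - k)) * F t) =
        (case x of (k, l) \<Rightarrow> of_nat (N choose k) * a ^ k * (of_nat ((N - k) choose l) * b ^ l * F (k + l)))"
      by (simp add: x(1) mult_ac)
  qed auto
  also have "\<dots> = (\<Sum>t\<le>N. of_nat (N choose t) * (a + b) ^ t * F t)"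
    by (simp add: sum.Sigma[symmetric] binomial_ring sum_distrib_left sum_distrib_right)
  finally show ?thesis .
qed

section \<open>Decomposition of differential modular forms\<close>

definition translation_matrix :: "int^2^2" where
  "translation_matrix = vector [vector [1, 1], vector [0, 1]]"

definition inversion_matrix :: "int^2^2" where
  "inversion_matrix = vector [vector [0, - 1], vector [1, 0]]"

lemma translation_matrix:
  "translation_matrix \<in> SL2Z" "autj translation_matrix z = 1"
  "moebius_act translation_matrix z = z + 1" "translation_matrix$2$1 = 0"
  by (simp_all add: translation_matrix_def SL2Z_iff autj_def moebius_act_def)

lemma inversion_matrix:
  "inversion_matrix \<in> SL2Z" "autj inversion_matrix z = z"
  "moebius_act inversion_matrix z = - (1 / z)" "inversion_matrix$2$1 = 1"
  by (simp_all add: inversion_matrix_def SL2Z_iff autj_def moebius_act_def)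

lemma quasi_family_app:
  assumes "quasi_family n m F" "i \<le> n" "A \<in> SL2Z" "z \<in> upper_half_plane"
  shows "app_hol (F i) (moebius_act A z) =
    autj A z powi (m - 2 * int i) * (\<Sum>l\<le>n - i. of_nat ((n - i) choose l) *
      (of_int (A$2$1) / autj A z) ^ l * app_hol (F (i + l)) z)"
  using assms unfolding quasi_family_def by blast

text \<open>Up to the factor \<open>n choose k\<close>, this is the coefficient of \<open>Y ^ k\<close> in the polynomial of the family after the
  substitution \<open>X = Y - g\<^sub>1\<close>.\<close>

definition modular_part :: "nat \<Rightarrow> (nat \<Rightarrow> hol_fun) \<Rightarrow> nat \<Rightarrow> hol_fun" where
  "modular_part n F k = (\<Sum>l\<le>n - k. scale_hol (of_nat ((n - k) choose l)) ((- eisenstein 1) ^ l * F (k + l)))"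

lemma app_modular_part:
  "z \<in> upper_half_plane \<Longrightarrow> app_hol (modular_part n F k) z =
    (\<Sum>l\<le>n - k. of_nat ((n - k) choose l) * (- app_hol (eisenstein 1) z) ^ l * app_hol (F (k + l)) z)"
  by (simp add: modular_part_def mult.assoc)

lemma regular_at_infinity_iff: "regular_at_infinity f \<longleftrightarrow> (\<exists>l. (app_hol f \<longlongrightarrow> l) at_cusp)"
  by (simp add: regular_at_infinity_def)

lemma quasi_family_at_cusp:
  assumes "quasi_family n m F" "i \<le> n"
  obtains l where "(app_hol (F i) \<longlongrightarrow> l) at_cusp"
  using assms unfolding quasi_family_def regular_at_infinity_iff by blast

text \<open>Under \<open>A\<close> the series \<open>- g\<^sub>1\<close> becomes \<open>j\<^sup>2 (- (g\<^sub>1 + s))\<close>, while the action on the family substitutes a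
  variable shifted by \<open>s\<close>. By \<open>binomial_resummation\<close> the two shifts cancel and leave \<open>- (g\<^sub>1 + s) + s = - g\<^sub>1\<close>.\<close>

lemma modular_form_modular_part:
  assumes F: "quasi_family n m F" and k: "k \<le> n"
  shows "modular_form (m - 2 * int k) (modular_part n F k)"
proof -
  have act: "app_hol (modular_part n F k) (moebius_act A z) =
      autj A z powi (m - 2 * int k) * app_hol (modular_part n F k) z"
    if A: "A \<in> SL2Z" and z: "z \<in> upper_half_plane" for A z
  proof -
    define j where "j = autj A z"
    define s where "s = of_int (A$2$1) / j"
    define g where "g = app_hol (eisenstein 1) z"
    have j: "j \<noteq> 0"
      unfolding j_def using A z by (rule autj_nonzero)
    have g: "app_hol (eisenstein 1) (moebius_act A z) = j ^ 2 * (g + s)"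
      using eisenstein_moebius(1)[OF A z] j by (simp add: g_def s_def j_def field_simps power2_eq_square)
    have "app_hol (modular_part n F k) (moebius_act A z) =
        (\<Sum>l\<le>n - k. of_nat ((n - k) choose l) * (- (j ^ 2 * (g + s))) ^ l * app_hol (F (k + l)) (moebius_act A z))"
      using app_modular_part[OF moebius_act_in_upper_half_plane[OF A z], of n F k] by (simp only: g)
    also have "\<dots> = (\<Sum>l\<le>n - k. j powi (m - 2 * int k) * (of_nat ((n - k) choose l) * (- (g + s)) ^ l *
        (\<Sum>r\<le>n - k - l. of_nat ((n - k - l) choose r) * s ^ r * app_hol (F (k + (l + r))) z)))"
    proof (intro sum.cong refl)
      fix l assume l: "l \<in> {..n - k}"
      define X where "X = (\<Sum>r\<le>n - k - l. of_nat ((n - k - l) choose r) * s ^ r * app_hol (F (k + (l + r))) z)"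
      have e1: "app_hol (F (k + l)) (moebius_act A z) = j powi (m - 2 * int (k + l)) * X"
        using quasi_family_app[OF F _ A z, of "k + l"] l k by (simp add: X_def j_def s_def add.assoc)
      have e2: "(- (j ^ 2 * (g + s))) ^ l = j powi (2 * int l) * (- (g + s)) ^ l"
      proof -
        have "(- (j ^ 2 * (g + s))) ^ l = (j ^ 2 * (- (g + s))) ^ l"
          by (simp only: mult_minus_right)
        also have "\<dots> = j ^ (2 * l) * (- (g + s)) ^ l"
          by (simp only: power_mult_distrib power_mult)
        also have "j ^ (2 * l) = j powi (2 * int l)"
          by (simp flip: power_int_of_nat)
        finally show ?thesis .
      qed
      have e3: "j powi (2 * int l) * j powi (m - 2 * int (k + l)) = j powi (m - 2 * int k)"
        using j by (simp flip: power_int_add)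
      show "of_nat ((n - k) choose l) * (- (j ^ 2 * (g + s))) ^ l * app_hol (F (k + l)) (moebius_act A z) =
          j powi (m - 2 * int k) * (of_nat ((n - k) choose l) * (- (g + s)) ^ l * X)"
        unfolding e1 e2 e3[symmetric] by (simp only: mult_ac)
    qed
    also have "\<dots> = j powi (m - 2 * int k) * (\<Sum>t\<le>n - k. of_nat ((n - k) choose t) * (- (g + s) + s) ^ t * app_hol (F (k + t)) z)"
      unfolding sum_distrib_left[symmetric]
      using binomial_resummation[of "n - k" "- (g + s)" s "\<lambda>t. app_hol (F (k + t)) z"] by simp
    also have "\<dots> = j powi (m - 2 * int k) * app_hol (modular_part n F k) z"
      using app_modular_part[OF z, of n F k] by (simp add: g_def)
    finally show ?thesis
      by (simp add: j_def)
  qed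
  have "\<exists>l. (app_hol (F i) \<longlongrightarrow> l) at_cusp" if "i \<le> n" for i
    using quasi_family_at_cusp[OF F that] by blast
  then obtain L where L: "\<And>i. i \<le> n \<Longrightarrow> (app_hol (F i) \<longlongrightarrow> L i) at_cusp"
    by metis
  have "((\<lambda>z. \<Sum>l\<le>n - k. of_nat ((n - k) choose l) * (- app_hol (eisenstein 1) z) ^ l * app_hol (F (k + l)) z) \<longlongrightarrow>
      (\<Sum>l\<le>n - k. of_nat ((n - k) choose l) * (- eis_a 1) ^ l * L (k + l))) at_cusp"
    using k by (intro tendsto_intros eisenstein_at_cusp L) auto
  then have "(app_hol (modular_part n F k) \<longlongrightarrow> (\<Sum>l\<le>n - k. of_nat ((n - k) choose l) * (- eis_a 1) ^ l * L (k + l))) at_cusp"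
    by (rule tendsto_cong_at_cusp) (rule app_modular_part[symmetric])
  then show ?thesis
    unfolding modular_form_def
    using act[OF translation_matrix(1)] act[OF inversion_matrix(1)] by (auto simp: translation_matrix inversion_matrix)
qed

text \<open>The shifts by \<open>g\<^sub>1\<close> and by \<open>- g\<^sub>1\<close> cancel.\<close>

lemma quasi_family_decomposition:
  "F 0 = (\<Sum>k\<le>n. scale_hol (of_nat (n choose k)) (eisenstein 1 ^ k * modular_part n F k))"
proof (rule hol_fun_eqI)
  fix z assume z: "z \<in> upper_half_plane"
  define g where "g = app_hol (eisenstein 1) z"
  have "app_hol (\<Sum>k\<le>n. scale_hol (of_nat (n choose k)) (eisenstein 1 ^ k * modular_part n F k)) z =
      (\<Sum>k\<le>n. of_nat (n choose k) * g ^ k * (\<Sum>l\<le>n - k. of_nat ((n - k) choose l) * (- g) ^ l * app_hol (F (k + l)) z))"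
    by (simp add: z app_modular_part g_def mult.assoc)
  also have "\<dots> = (\<Sum>t\<le>n. of_nat (n choose t) * (g + - g) ^ t * app_hol (F t) z)"
    by (rule binomial_resummation)
  also have "\<dots> = (\<Sum>t\<in>{0}. of_nat (n choose t) * (g + - g) ^ t * app_hol (F t) z)"
    by (rule sum.mono_neutral_right) auto
  finally show "app_hol (F 0) z = app_hol (\<Sum>k\<le>n. scale_hol (of_nat (n choose k)) (eisenstein 1 ^ k * modular_part n F k)) z"
    by simp
qed

definition quasi_monomials :: "nat \<Rightarrow> int \<Rightarrow> hol_fun set" where
  "quasi_monomials n m = {eisenstein 1 ^ a * eisenstein 2 ^ b * eisenstein 3 ^ c |a b c.
     a \<le> n \<and> 2 * int a + 4 * int b + 6 * int c = m}"

lemma diff_mod_forms_in_span: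
  assumes "f \<in> diff_mod_forms n m"
  shows "f \<in> hol.span (quasi_monomials n m)"
proof -
  obtain F where F: "F 0 = f" "quasi_family n m F"
    using assms by (rule diff_mod_forms_imp_quasi_family)
  have "eisenstein 1 ^ k * modular_part n F k \<in> hol.span (quasi_monomials n m)" if k: "k \<le> n" for k
  proof (rule span_mult)
    show "eisenstein 1 ^ k \<in> hol.span {eisenstein 1 ^ k}"
      by (simp add: hol.span_base)
    show "modular_part n F k \<in> hol.span (eis_monomials (m - 2 * int k))"
      using modular_form_modular_part[OF F(2) k] by (rule modular_form_in_span)
    fix x y assume "x \<in> {eisenstein 1 ^ k}" "y \<in> eis_monomials (m - 2 * int k)"
    then obtain b c where "x = eisenstein 1 ^ k" "y = eisenstein 2 ^ b * eisenstein 3 ^ c" "4 * int b + 6 * int c = m - 2 * int k"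
      by (auto simp: eis_monomials_def)
    then show "x * y \<in> quasi_monomials n m"
      using k unfolding quasi_monomials_def
      by (intro CollectI exI[of _ k] exI[of _ b] exI[of _ c]) (auto simp: mult.assoc)
  qed
  then show ?thesis
    using F(1) quasi_family_decomposition[of F n] by (auto intro!: hol.span_sum hol.span_scale)
qed

lemma subspace_diff_mod_forms: "hol.subspace (diff_mod_forms n m)"
proof (rule hol.subspaceI)
  have "quasi_family n m (\<lambda>_. 0)"
    by (auto simp: quasi_family_def regular_at_infinity_iff)
  then show "0 \<in> diff_mod_forms n m"
    using quasi_family_imp_diff_mod_forms by blast
next
  fix f g assume "f \<in> diff_mod_forms n m" "g \<in> diff_mod_forms n m"
  then obtain F G where F: "F 0 = f" "quasi_family n m F" and G: "G 0 = g" "quasi_family n m G"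
    using diff_mod_forms_imp_quasi_family by metis
  have "quasi_family n m (\<lambda>i. F i + G i)"
    unfolding quasi_family_def
  proof (intro allI impI conjI ballI)
    fix i assume i: "i \<le> n"
    obtain a where "(app_hol (F i) \<longlongrightarrow> a) at_cusp"
      using F(2) i by (rule quasi_family_at_cusp)
    moreover obtain b where "(app_hol (G i) \<longlongrightarrow> b) at_cusp"
      using G(2) i by (rule quasi_family_at_cusp)
    ultimately have "(app_hol (F i + G i) \<longlongrightarrow> a + b) at_cusp"
      by (auto intro: tendsto_add)
    then show "regular_at_infinity (F i + G i)"
      by (auto simp: regular_at_infinity_iff)
    fix A z assume Az: "A \<in> SL2Z" "z \<in> upper_half_plane"
    show "app_hol (F i + G i) (moebius_act A z) = autj A z powi (m - 2 * int i) *
        (\<Sum>l\<le>n - i. of_nat ((n - i) choose l) * (of_int (A$2$1) / autj A z) ^ l * app_hol (F (i + l) + G (i + l)) z)"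
      using quasi_family_app[OF F(2) i Az] quasi_family_app[OF G(2) i Az]
      by (simp add: ring_distribs sum.distrib)
  qed
  then show "f + g \<in> diff_mod_forms n m"
    using quasi_family_imp_diff_mod_forms[of n m "\<lambda>i. F i + G i"] F(1) G(1) by simp
next
  fix c f assume "f \<in> diff_mod_forms n m"
  then obtain F where F: "F 0 = f" "quasi_family n m F"
    by (rule diff_mod_forms_imp_quasi_family)
  have "quasi_family n m (\<lambda>i. scale_hol c (F i))"
    unfolding quasi_family_def
  proof (intro allI impI conjI ballI)
    fix i assume i: "i \<le> n"
    obtain a where "(app_hol (F i) \<longlongrightarrow> a) at_cusp"
      using F(2) i by (rule quasi_family_at_cusp)
    then have "(app_hol (scale_hol c (F i)) \<longlongrightarrow> c * a) at_cusp"
      by (auto intro: tendsto_mult_left)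
    then show "regular_at_infinity (scale_hol c (F i))"
      by (auto simp: regular_at_infinity_iff)
    fix A z assume Az: "A \<in> SL2Z" "z \<in> upper_half_plane"
    show "app_hol (scale_hol c (F i)) (moebius_act A z) = autj A z powi (m - 2 * int i) *
        (\<Sum>l\<le>n - i. of_nat ((n - i) choose l) * (of_int (A$2$1) / autj A z) ^ l * app_hol (scale_hol c (F (i + l))) z)"
      using quasi_family_app[OF F(2) i Az] by (simp add: sum_distrib_left mult_ac)
  qed
  then show "scale_hol c f \<in> diff_mod_forms n m"
    using quasi_family_imp_diff_mod_forms[of n m "\<lambda>i. scale_hol c (F i)"] F(1) by simp
qed

text \<open>Put \<open>t = i + l\<close>. The identity \<open>(n choose t) (t choose i) = (n choose i) ((n - i) choose l)\<close> and the same
  identity for \<open>a\<close> in place of \<open>n\<close> share the factor \<open>t choose i\<close>, which cancels.\<close>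

lemma binomial_ratio:
  assumes "i \<le> a" "a \<le> n" "l \<le> n - i"
  shows "(of_nat ((n - i) choose l) :: complex) * (of_nat (a choose (i + l)) / of_nat (n choose (i + l))) =
    of_nat (a choose i) / of_nat (n choose i) * of_nat ((a - i) choose l)"
proof (cases "i + l \<le> a")
  case True
  have "(n choose (i + l)) * ((i + l) choose i) = (n choose i) * ((n - i) choose l)"
    using choose_mult[of i "i + l" n] assms True by simp
  then have 1: "(of_nat (n choose (i + l)) * of_nat ((i + l) choose i) :: complex) = of_nat (n choose i) * of_nat ((n - i) choose l)"
    by (simp flip: of_nat_mult)
  have "(a choose (i + l)) * ((i + l) choose i) = (a choose i) * ((a - i) choose l)"
    using choose_mult[of i "i + l" a] True by simp
  then have 2: "(of_nat (a choose (i + l)) * of_nat ((i + l) choose i) :: complex) = of_nat (a choose i) * of_nat ((a - i) choose l)"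
    by (simp flip: of_nat_mult)
  define p q r s t u v :: complex where "p = of_nat (n choose (i + l))" and "q = of_nat ((i + l) choose i)"
    and "r = of_nat (n choose i)" and "s = of_nat ((n - i) choose l)" and "t = of_nat (a choose (i + l))"
    and "u = of_nat (a choose i)" and "v = of_nat ((a - i) choose l)"
  have "p \<noteq> 0" "r \<noteq> 0" "p * q = r * s" "t * q = u * v"
    using assms True 1 2 by (simp_all add: p_def q_def r_def s_def t_def u_def v_def)
  then have "r * s * t = p * (u * v)"
    by (metis mult.assoc mult.commute)
  with \<open>p \<noteq> 0\<close> \<open>r \<noteq> 0\<close> have "s * (t / p) = u / r * v"
    by (simp add: field_simps)
  then show ?thesis
    by (simp only: p_def r_def s_def t_def u_def v_def)
next
  case False
  then show ?thesis
    using assms by (simp add: binomial_eq_0)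
qed

text \<open>The polynomial of the monomial \<open>g\<^sub>1^a M\<close>, with \<open>M\<close> modular, is \<open>(g\<^sub>1 + X)^a M\<close>. Its coefficients, divided by
  \<open>n choose i\<close>, form the family \<open>F\<close>.\<close>

lemma quasi_monomials_subset: "quasi_monomials n m \<subseteq> diff_mod_forms n m"
proof
  fix x assume "x \<in> quasi_monomials n m"
  then obtain a b c where x: "x = eisenstein 1 ^ a * eisenstein 2 ^ b * eisenstein 3 ^ c"
    and a: "a \<le> n" and m: "2 * int a + 4 * int b + 6 * int c = m"
    by (auto simp: quasi_monomials_def)
  define M where "M = eisenstein 2 ^ b * eisenstein 3 ^ c"
  define F where "F = (\<lambda>i. scale_hol (of_nat (a choose i) / of_nat (n choose i)) (eisenstein 1 ^ (a - i) * M))"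
  have "quasi_family n m F"
    unfolding quasi_family_def
  proof (intro allI impI conjI ballI)
    fix i assume i: "i \<le> n"
    define r :: complex where "r = of_nat (a choose i) / of_nat (n choose i)"
    have "(app_hol (eisenstein 1 ^ (a - i) * M) \<longlongrightarrow> eis_a 1 ^ (a - i) * (eis_a 2 ^ b * eis_a 3 ^ c)) at_cusp"
      unfolding M_def by (intro tendsto_app_hol_mult tendsto_app_hol_power eisenstein_at_cusp)
    then have "(app_hol (F i) \<longlongrightarrow> r * (eis_a 1 ^ (a - i) * (eis_a 2 ^ b * eis_a 3 ^ c))) at_cusp"
      unfolding F_def r_def scale_hol.rep_eq by (rule tendsto_mult_left)
    then show "regular_at_infinity (F i)"
      by (auto simp: regular_at_infinity_iff)
    fix A z assume A: "A \<in> SL2Z" and z: "z \<in> upper_half_plane"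
    define j where "j = autj A z"
    define s where "s = of_int (A$2$1) / j"
    define g where "g = app_hol (eisenstein 1) z"
    define h where "h = app_hol M z"
    have Az: "moebius_act A z \<in> upper_half_plane"
      using A z by (rule moebius_act_in_upper_half_plane)
    have j: "j \<noteq> 0"
      unfolding j_def using A z by (rule autj_nonzero)
    have g: "app_hol (eisenstein 1) (moebius_act A z) = j ^ 2 * (g + s)"
      using eisenstein_moebius(1)[OF A z] j by (simp add: g_def s_def j_def field_simps power2_eq_square)
    have h: "app_hol M (moebius_act A z) = j ^ (4 * b + 6 * c) * h"
      using eisenstein_moebius[OF A z] Az z
      by (simp add: M_def h_def j_def power_mult_distrib power_add mult_ac flip: power_mult)
    show "app_hol (F i) (moebius_act A z) = autj A z powi (m - 2 * int i) *
        (\<Sum>l\<le>n - i. of_nat ((n - i) choose l) * (of_int (A$2$1) / autj A z) ^ l * app_hol (F (i + l)) z)"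
      unfolding j_def[symmetric] s_def[symmetric]
    proof (cases "i \<le> a")
      case False
      then show "app_hol (F i) (moebius_act A z) = j powi (m - 2 * int i) *
        (\<Sum>l\<le>n - i. of_nat ((n - i) choose l) * s ^ l * app_hol (F (i + l)) z)"
        by (simp add: F_def binomial_eq_0)
    next
      case True
      have "(\<Sum>l\<le>n - i. of_nat ((n - i) choose l) * s ^ l * app_hol (F (i + l)) z) =
          (\<Sum>l\<le>n - i. r * (of_nat ((a - i) choose l) * s ^ l * g ^ (a - i - l)) * h)"
      proof (intro sum.cong refl)
        fix l assume "l \<in> {..n - i}"
        then have l: "l \<le> n - i"
          by simp
        have "of_nat ((n - i) choose l) * s ^ l * app_hol (F (i + l)) z =
            (of_nat ((n - i) choose l) * (of_nat (a choose (i + l)) / of_nat (n choose (i + l)))) * (s ^ l * g ^ (a - i - l) * h)"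
          using z by (simp add: F_def g_def h_def mult_ac)
        also have "\<dots> = r * (of_nat ((a - i) choose l) * s ^ l * g ^ (a - i - l)) * h"
          unfolding binomial_ratio[OF True a l] r_def by (simp add: mult_ac)
        finally show "of_nat ((n - i) choose l) * s ^ l * app_hol (F (i + l)) z =
            r * (of_nat ((a - i) choose l) * s ^ l * g ^ (a - i - l)) * h" .
      qed
      also have "\<dots> = r * (\<Sum>l\<le>n - i. of_nat ((a - i) choose l) * s ^ l * g ^ (a - i - l)) * h"
        by (simp add: sum_distrib_left sum_distrib_right)
      also have "(\<Sum>l\<le>n - i. of_nat ((a - i) choose l) * s ^ l * g ^ (a - i - l)) =
          (\<Sum>l\<le>a - i. of_nat ((a - i) choose l) * s ^ l * g ^ (a - i - l))"
        using a by (intro sum.mono_neutral_right) auto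
      also have "\<dots> = (g + s) ^ (a - i)"
        by (simp only: binomial_ring[of s g] add.commute[of g s])
      finally have rhs: "(\<Sum>l\<le>n - i. of_nat ((n - i) choose l) * s ^ l * app_hol (F (i + l)) z) = r * (g + s) ^ (a - i) * h" .
      have "m - 2 * int i = int (2 * (a - i) + (4 * b + 6 * c))"
        using m True by (simp add: of_nat_diff)
      then have jm: "j powi (m - 2 * int i) = (j ^ 2) ^ (a - i) * j ^ (4 * b + 6 * c)"
        by (simp only: power_int_of_nat power_add power_mult)
      show "app_hol (F i) (moebius_act A z) = j powi (m - 2 * int i) *
        (\<Sum>l\<le>n - i. of_nat ((n - i) choose l) * s ^ l * app_hol (F (i + l)) z)"
      proof -
        have "app_hol (F i) (moebius_act A z) =
            r * (app_hol (eisenstein 1) (moebius_act A z) ^ (a - i) * app_hol M (moebius_act A z))"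
          using Az by (simp add: F_def r_def)
        then show ?thesis
          unfolding rhs jm g h by (simp only: power_mult_distrib mult_ac)
      qed
    qed
  qed
  then have "F 0 \<in> diff_mod_forms n m"
    by (rule quasi_family_imp_diff_mod_forms)
  moreover have "F 0 = x"
    by (rule hol_fun_eqI) (simp add: F_def x M_def mult.assoc)
  ultimately show "x \<in> diff_mod_forms n m"
    by simp
qed

lemma diff_mod_forms_eq_span: "diff_mod_forms n m = hol.span (quasi_monomials n m)"
proof (rule equalityI)
  show "diff_mod_forms n m \<subseteq> hol.span (quasi_monomials n m)"
    using diff_mod_forms_in_span by (rule subsetI)
  show "hol.span (quasi_monomials n m) \<subseteq> diff_mod_forms n m"
    using quasi_monomials_subset subspace_diff_mod_forms by (rule hol.span_minimal)
qed

lemma finite_quasi_monomials: "finite (quasi_monomials n m)"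
proof (rule finite_subset)
  show "quasi_monomials n m \<subseteq> (\<lambda>(a, b, c). eisenstein 1 ^ a * eisenstein 2 ^ b * eisenstein 3 ^ c) `
      ({..n} \<times> {..nat m} \<times> {..nat m})"
  proof
    fix x assume "x \<in> quasi_monomials n m"
    then obtain a b c where x: "x = eisenstein 1 ^ a * eisenstein 2 ^ b * eisenstein 3 ^ c"
      and abc: "a \<le> n" "2 * int a + 4 * int b + 6 * int c = m"
      unfolding quasi_monomials_def by blast
    from abc(2) have "b \<le> nat m" "c \<le> nat m"
      by linarith+
    with abc(1) show "x \<in> (\<lambda>(a, b, c). eisenstein 1 ^ a * eisenstein 2 ^ b * eisenstein 3 ^ c) `
        ({..n} \<times> {..nat m} \<times> {..nat m})"
      by (intro image_eqI[of _ _ "(a, b, c)"]) (simp_all add: x)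
  qed
qed auto

lemma finite_dim_diff_mod_forms: "finite_dim_subspace (diff_mod_forms n m)"
  unfolding finite_dim_subspace_def
  by (intro conjI subspace_diff_mod_forms exI[of _ "quasi_monomials n m"] finite_quasi_monomials
      diff_mod_forms_eq_span)

definition eis_monomial :: "nat \<Rightarrow> nat \<Rightarrow> nat \<Rightarrow> hol_fun" where
  "eis_monomial a b c = eisenstein 1 ^ a * eisenstein 2 ^ b * eisenstein 3 ^ c"

lemma diff_mod_form_algebra_eq_span:
  "diff_mod_form_algebra = hol.span {eis_monomial a b c |a b c. True}"
proof -
  have "diff_mod_form_algebra \<subseteq> hol.span {eis_monomial a b c |a b c. True}"
    unfolding diff_mod_form_algebra_def
  proof (rule hol.span_minimal)
    have "quasi_monomials n m \<subseteq> {eis_monomial a b c |a b c. True}" for n m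
      by (auto simp: quasi_monomials_def eis_monomial_def)
    then show "(\<Union>n. \<Union>m. diff_mod_forms n m) \<subseteq> hol.span {eis_monomial a b c |a b c. True}"
      unfolding diff_mod_forms_eq_span by (intro UN_least hol.span_mono)
  qed (rule hol.subspace_span)
  moreover have "eis_monomial a b c \<in> diff_mod_forms a (2 * int a + 4 * int b + 6 * int c)" for a b c
  proof -
    have "eis_monomial a b c \<in> quasi_monomials a (2 * int a + 4 * int b + 6 * int c)"
      unfolding quasi_monomials_def eis_monomial_def by blast
    then show ?thesis
      using quasi_monomials_subset by blast
  qed
  then have "{eis_monomial a b c |a b c. True} \<subseteq> (\<Union>n. \<Union>m. diff_mod_forms n m)"
    by blast
  then have "hol.span {eis_monomial a b c |a b c. True} \<subseteq> diff_mod_form_algebra"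
    unfolding diff_mod_form_algebra_def by (rule hol.span_mono)
  ultimately show ?thesis
    by blast
qed

lemma subalgebra_diff_mod_form_algebra: "subalgebra diff_mod_form_algebra"
proof -
  have "1 = eis_monomial 0 0 0"
    by (simp add: eis_monomial_def)
  then have "1 \<in> {eis_monomial a b c |a b c. True}"
    by blast
  then have one: "1 \<in> hol.span {eis_monomial a b c |a b c. True}"
    by (rule hol.span_base)
  have eq: "eis_monomial a b c * eis_monomial a' b' c' = eis_monomial (a + a') (b + b') (c + c')" for a b c a' b' c'
    by (simp add: eis_monomial_def power_add mult_ac)
  have mult: "x * y \<in> {eis_monomial a b c |a b c. True}"
    if xy: "x \<in> {eis_monomial a b c |a b c. True}" "y \<in> {eis_monomial a b c |a b c. True}" for x y
  proof -
    obtain a b c where "x = eis_monomial a b c"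
      using xy(1) by blast
    moreover obtain a' b' c' where "y = eis_monomial a' b' c'"
      using xy(2) by blast
    ultimately show ?thesis
      using eq by blast
  qed
  have closed: "f * g \<in> hol.span {eis_monomial a b c |a b c. True}"
    if "f \<in> hol.span {eis_monomial a b c |a b c. True}" "g \<in> hol.span {eis_monomial a b c |a b c. True}" for f g
    using mult that by (rule span_mult)
  show ?thesis
    unfolding subalgebra_def diff_mod_form_algebra_eq_span
    using one closed hol.subspace_span by blast
qed

section \<open>Algebraic independence\<close>

lemma poly_eq_0_if_infinite_roots:
  fixes p :: "complex poly"
  assumes "infinite X" "\<And>x. x \<in> X \<Longrightarrow> poly p x = 0"
  shows "p = 0"
proof (rule ccontr)
  assume "p \<noteq> 0"
  then have "finite {x. poly p x = 0}"
    by (rule poly_roots_finite)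
  then show False
    using assms by (meson finite_subset mem_Collect_eq subsetI)
qed

lemma power_sum_vanishes_imp:
  fixes f :: "'s \<Rightarrow> complex"
  assumes S: "finite S" and X: "infinite X" "\<And>x. x \<in> X \<Longrightarrow> (\<Sum>s\<in>S. f s * x ^ k s) = 0"
  shows "(\<Sum>s\<in>{s \<in> S. k s = n}. f s) = 0"
proof -
  define p where "p = (\<Sum>s\<in>S. monom (f s) (k s))"
  have "p = 0"
    using X(1) by (rule poly_eq_0_if_infinite_roots) (use X(2) in \<open>simp add: p_def poly_sum poly_monom\<close>)
  then have "coeff p n = 0"
    by simp
  then show ?thesis
    using S by (simp add: p_def coeff_sum sum.inter_filter)
qed

text \<open>At the image \<open>w\<close> of \<open>z\<close> under the matrix with rows \<open>(1, n)\<close> and \<open>(k, 1 + k n)\<close> the relation is a polynomial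
  equation in \<open>j = k z + 1 + k n\<close>. Infinitely many \<open>n\<close> make it an identity in \<open>j\<close>, and then infinitely many \<open>k\<close>
  an identity in \<open>k\<close>. Now \<open>g\<^sub>1(w) = j\<^sup>2 g\<^sub>1(z) + k j\<close> can be given any value \<open>Y\<close> while \<open>J = j\<close> is kept fixed.\<close>

lemma eis_relation_weighted:
  assumes S: "finite S"
    and rel: "(\<Sum>(a, b, c)\<in>S. scale_hol (f (a, b, c)) (eis_monomial a b c)) = 0"
    and z: "z \<in> upper_half_plane" and J: "J \<noteq> 0"
  shows "(\<Sum>(a, b, c)\<in>S. f (a, b, c) * Y ^ a * (J ^ 4 * app_hol (eisenstein 2) z) ^ b *
    (J ^ 6 * app_hol (eisenstein 3) z) ^ c) = 0"
proof -
  define g1 g2 g3 where "g1 = app_hol (eisenstein 1) z" and "g2 = app_hol (eisenstein 2) z"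
    and "g3 = app_hol (eisenstein 3) z"
  have rel': "(\<Sum>(a, b, c)\<in>S. f (a, b, c) * app_hol (eisenstein 1) w ^ a * app_hol (eisenstein 2) w ^ b * app_hol (eisenstein 3) w ^ c) = 0"
    if "w \<in> upper_half_plane" for w
    using arg_cong[OF rel, of "\<lambda>f. app_hol f w"] that
    by (simp add: case_prod_unfold eis_monomial_def mult.assoc)
  have 1: "(\<Sum>(a, b, c)\<in>S. f (a, b, c) * (J ^ 2 * g1 + of_int k * J) ^ a * (J ^ 4 * g2) ^ b * (J ^ 6 * g3) ^ c) = 0"
    if k: "k > 0" for k :: int and J
  proof -
    define p where "p = (\<Sum>(a, b, c)\<in>S. [:f (a, b, c):] * [:0, of_int k, g1:] ^ a * (monom g2 4) ^ b * (monom g3 6) ^ c)"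
    have p: "poly p J = (\<Sum>(a, b, c)\<in>S. f (a, b, c) * (J ^ 2 * g1 + of_int k * J) ^ a * (J ^ 4 * g2) ^ b * (J ^ 6 * g3) ^ c)" for J
    proof -
      have "poly [:0, of_int k, g1:] J = J ^ 2 * g1 + of_int k * J" "poly (monom g2 4) J = J ^ 4 * g2"
        "poly (monom g3 6) J = J ^ 6 * g3" "poly [:C:] J = C" for C
        by (simp_all add: algebra_simps power2_eq_square poly_monom)
      then show ?thesis
        by (simp only: p_def poly_sum case_prod_unfold poly_mult poly_power)
    qed
    have "p = 0"
    proof (rule poly_eq_0_if_infinite_roots)
      have "inj (\<lambda>n. of_int k * z + of_int (1 + k * int n))"
        using k by (auto intro!: injI)
      then show "infinite (range (\<lambda>n. of_int k * z + of_int (1 + k * int n)))"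
        by (rule range_inj_infinite)
    next
      fix J assume "J \<in> range (\<lambda>n. of_int k * z + of_int (1 + k * int n))"
      then obtain n' where "J = of_int k * z + of_int (1 + k * int n')"
        by blast
      then obtain n :: int where n: "J = of_int k * z + of_int (1 + k * n)"
        by blast
      have det: "1 * (1 + k * n) - n * k = 1"
        by simp
      note E = eisenstein_fractional_linear[OF z det, folded n g1_def g2_def g3_def]
      note w = fractional_linear_in_upper_half_plane[OF z det, folded n]
      show "poly p J = 0"
        unfolding p using rel'[OF w] E by simp
    qed
    then show ?thesis
      using p[of J] by simp
  qed
  define q where "q = (\<Sum>(a, b, c)\<in>S. [:f (a, b, c) * (J ^ 4 * g2) ^ b * (J ^ 6 * g3) ^ c:] * [:J ^ 2 * g1, J:] ^ a)"
  have q: "poly q C = (\<Sum>(a, b, c)\<in>S. f (a, b, c) * (J ^ 2 * g1 + C * J) ^ a * (J ^ 4 * g2) ^ b * (J ^ 6 * g3) ^ c)" for C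
  proof -
    have "poly [:J ^ 2 * g1, J:] C = J ^ 2 * g1 + C * J" "poly [:x:] C = x" for x
      by simp_all
    then have "poly q C = (\<Sum>(a, b, c)\<in>S. f (a, b, c) * (J ^ 4 * g2) ^ b * (J ^ 6 * g3) ^ c * (J ^ 2 * g1 + C * J) ^ a)"
      by (simp only: q_def poly_sum case_prod_unfold poly_mult poly_power)
    then show ?thesis
      by (simp only: mult_ac)
  qed
  have "q = 0"
  proof (rule poly_eq_0_if_infinite_roots)
    have "inj (\<lambda>n. of_int (int (Suc n)) :: complex)"
      by (auto intro!: injI)
    then show "infinite (range (\<lambda>n. of_int (int (Suc n)) :: complex))"
      by (rule range_inj_infinite)
    show "poly q C = 0" if C: "C \<in> range (\<lambda>n. of_int (int (Suc n)))" for C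
    proof -
      obtain n where "C = of_int (int (Suc n))"
        using C by blast
      then show ?thesis
        using 1[of "int (Suc n)" J] unfolding q by simp
    qed
  qed
  then have "poly q ((Y - J ^ 2 * g1) / J) = 0"
    by simp
  then show ?thesis
    unfolding q g2_def g3_def using J by simp
qed

definition eis_ratios :: "complex set" where
  "eis_ratios = {app_hol (eisenstein 2) z ^ 3 / app_hol (eisenstein 3) z ^ 2 |z.
     z \<in> upper_half_plane \<and> app_hol (eisenstein 2) z \<noteq> 0 \<and> app_hol (eisenstein 3) z \<noteq> 0}"

text \<open>The ratio tends to \<open>27\<close> at the cusp, but is never equal to \<open>27\<close> near it since the discriminant does not
  vanish there.\<close>

lemma infinite_eis_ratios: "infinite eis_ratios"
proof
  assume fin: "finite eis_ratios"
  have "((\<lambda>z. app_hol (eisenstein 2) z ^ 3 / app_hol (eisenstein 3) z ^ 2) \<longlongrightarrow> eis_a 2 ^ 3 / eis_a 3 ^ 2) at_cusp"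
    using eis_a_nonzero[of 3] by (intro tendsto_intros eisenstein_at_cusp) auto
  moreover have "eis_a 2 ^ 3 / eis_a 3 ^ 2 = 27"
    by (simp add: eis_a_def eval_nat_numeral)
  ultimately have lim: "((\<lambda>z. app_hol (eisenstein 2) z ^ 3 / app_hol (eisenstein 3) z ^ 2) \<longlongrightarrow> 27) at_cusp"
    by simp
  have "eventually (\<lambda>z. app_hol (eisenstein 2) z \<noteq> 0) at_cusp" "eventually (\<lambda>z. app_hol (eisenstein 3) z \<noteq> 0) at_cusp"
    using eis_a_nonzero by (auto intro!: tendsto_imp_eventually_ne[OF eisenstein_at_cusp])
  with eventually_upper_half_plane_at_cusp discriminant_nonzero_at_cusp
  have "eventually (\<lambda>z. app_hol (eisenstein 2) z ^ 3 / app_hol (eisenstein 3) z ^ 2 \<in> eis_ratios - {27}) at_cusp"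
  proof eventually_elim
    case (elim z)
    then have "app_hol (eisenstein 2) z ^ 3 / app_hol (eisenstein 3) z ^ 2 \<noteq> 27"
      by (auto simp: discriminant_def field_simps)
    moreover have "app_hol (eisenstein 2) z ^ 3 / app_hol (eisenstein 3) z ^ 2 \<in> eis_ratios"
      using elim unfolding eis_ratios_def by blast
    ultimately show ?case
      by blast
  qed
  then have "27 \<in> eis_ratios - {27}"
    using fin lim at_cusp_neq_bot by (intro Lim_in_closed_set[of "eis_ratios - {27}"]) (auto intro: finite_imp_closed)
  then show False
    by simp
qed

text \<open>For \<open>J\<^sup>2 = x g\<^sub>2 / g\<^sub>3\<close> and \<open>r = g\<^sub>2\<^sup>3 / g\<^sub>3\<^sup>2\<close> one has \<open>J\<^sup>4 g\<^sub>2 = x\<^sup>2 r\<close> and \<open>J\<^sup>6 g\<^sub>3 = x\<^sup>3 r\<close>, so the relation becomes one between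
  the monomials \<open>Y^a x^(2 b + 3 c) r^(b + c)\<close>. Each of \<open>Y\<close>, \<open>x\<close> and \<open>r\<close> takes infinitely many values, and the three
  exponents determine \<open>(a, b, c)\<close>.\<close>

lemma eis_monomials_independent:
  assumes S: "finite S"
    and rel: "(\<Sum>(a, b, c)\<in>S. scale_hol (f (a, b, c)) (eis_monomial a b c)) = 0"
    and abc: "(a, b, c) \<in> S"
  shows "f (a, b, c) = 0"
proof -
  have 1: "(\<Sum>s\<in>S. (f s * x ^ (2 * fst (snd s) + 3 * snd (snd s)) * r ^ (fst (snd s) + snd (snd s))) * Y ^ fst s) = 0"
    if x: "x \<noteq> 0" and r: "r \<in> eis_ratios" for x r Y
  proof -
    obtain z where z: "z \<in> upper_half_plane" "app_hol (eisenstein 2) z \<noteq> 0" "app_hol (eisenstein 3) z \<noteq> 0"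
      "r = app_hol (eisenstein 2) z ^ 3 / app_hol (eisenstein 3) z ^ 2"
      using r by (auto simp: eis_ratios_def)
    define g2 g3 where "g2 = app_hol (eisenstein 2) z" and "g3 = app_hol (eisenstein 3) z"
    define J where "J = csqrt (x * g2 / g3)"
    have J2: "J ^ 2 = x * g2 / g3"
      by (simp add: J_def)
    have "J \<noteq> 0"
      using x z by (simp add: J_def g2_def g3_def)
    have J4: "J ^ 4 * g2 = x ^ 2 * r"
    proof -
      have "J ^ 4 = (J ^ 2) ^ 2"
        by (simp flip: power_mult)
      then show ?thesis
        unfolding J2 z(4) g2_def[symmetric] g3_def[symmetric] by (simp add: power_mult_distrib power_divide eval_nat_numeral)
    qed
    have J6: "J ^ 6 * g3 = x ^ 3 * r"
    proof -
      have "J ^ 6 = (J ^ 2) ^ 3"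
        by (simp flip: power_mult)
      then show ?thesis
        unfolding J2 z(4) g2_def[symmetric] g3_def[symmetric] using z(3)
        by (simp add: power_mult_distrib power_divide eval_nat_numeral g3_def)
    qed
    have "(\<Sum>(a, b, c)\<in>S. f (a, b, c) * Y ^ a * (x ^ 2 * r) ^ b * (x ^ 3 * r) ^ c) = 0"
      using eis_relation_weighted[OF S rel z(1) \<open>J \<noteq> 0\<close>, of Y] unfolding g2_def[symmetric] g3_def[symmetric] J4 J6 .
    then show ?thesis
      by (simp add: case_prod_unfold power_mult_distrib power_add power_mult mult_ac)
  qed
  define S1 where "S1 = {s \<in> S. fst s = a}"
  define S2 where "S2 = {s \<in> S1. 2 * fst (snd s) + 3 * snd (snd s) = 2 * b + 3 * c}"
  define S3 where "S3 = {s \<in> S2. fst (snd s) + snd (snd s) = b + c}"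
  have fin: "finite S1" "finite S2"
    using S by (auto simp: S1_def S2_def)
  have "(\<Sum>s\<in>S1. f s * x ^ (2 * fst (snd s) + 3 * snd (snd s)) * r ^ (fst (snd s) + snd (snd s))) = 0"
    if "x \<noteq> 0" "r \<in> eis_ratios" for x r
    unfolding S1_def by (rule power_sum_vanishes_imp[OF S infinite_UNIV_char_0]) (rule 1[OF that])
  then have 2: "(\<Sum>s\<in>S1. (f s * r ^ (fst (snd s) + snd (snd s))) * x ^ (2 * fst (snd s) + 3 * snd (snd s))) = 0"
    if "x \<in> UNIV - {0}" "r \<in> eis_ratios" for x r
    using that by (simp add: mult_ac)
  have "infinite (UNIV - {0 :: complex})"
    by (intro infinite_remove infinite_UNIV_char_0)
  then have 3: "(\<Sum>s\<in>S2. f s * r ^ (fst (snd s) + snd (snd s))) = 0" if "r \<in> eis_ratios" for r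
    unfolding S2_def by (rule power_sum_vanishes_imp[OF fin(1)]) (rule 2[OF _ that])
  have "(\<Sum>s\<in>S3. f s) = 0"
    unfolding S3_def by (rule power_sum_vanishes_imp[OF fin(2) infinite_eis_ratios]) (rule 3)
  moreover have "S3 = {(a, b, c)}"
    using abc by (auto simp: S3_def S2_def S1_def)
  ultimately show ?thesis
    by simp
qed

lemma prod_eq_eis_monomial:
  assumes "Poly_Mapping.keys e \<subseteq> {1, 2, 3}"
  shows "(\<Prod>i\<in>Poly_Mapping.keys e. eisenstein i ^ Poly_Mapping.lookup e i) =
    eis_monomial (Poly_Mapping.lookup e 1) (Poly_Mapping.lookup e 2) (Poly_Mapping.lookup e 3)"
proof -
  have "(\<Prod>i\<in>Poly_Mapping.keys e. eisenstein i ^ Poly_Mapping.lookup e i) =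
      (\<Prod>i\<in>{1, 2, 3}. eisenstein i ^ Poly_Mapping.lookup e i)"
    using assms by (intro prod.mono_neutral_left) (auto simp: in_keys_iff)
  then show ?thesis
    by (simp add: eis_monomial_def mult.assoc)
qed

lemma poly_eval_superset:
  assumes "finite S" "Poly_Mapping.keys p \<subseteq> S"
  shows "poly_eval x p = (\<Sum>e\<in>S. scale_hol (Poly_Mapping.lookup p e)
    (\<Prod>i\<in>Poly_Mapping.keys e. x i ^ Poly_Mapping.lookup e i))"
  unfolding poly_eval_def using assms by (intro sum.mono_neutral_left) (auto simp: in_keys_iff)

lemma poly_eval_add: "poly_eval x (p + q) = poly_eval x p + poly_eval x q"
proof -
  define S where "S = Poly_Mapping.keys p \<union> Poly_Mapping.keys q"
  have "finite S" "Poly_Mapping.keys p \<subseteq> S" "Poly_Mapping.keys q \<subseteq> S" "Poly_Mapping.keys (p + q) \<subseteq> S"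
    using keys_add[of p q] by (auto simp: S_def)
  then show ?thesis
    by (simp add: poly_eval_superset[of S] lookup_add hol.scale_left_distrib sum.distrib)
qed

lemma poly_eval_diff: "poly_eval x (p - q) = poly_eval x p - poly_eval x q"
  using poly_eval_add[of x "p - q" q] by simp

lemma polynomials_in_add:
  "p \<in> polynomials_in I \<Longrightarrow> q \<in> polynomials_in I \<Longrightarrow> p + q \<in> polynomials_in I"
  unfolding polynomials_in_def using keys_add[of p q] by blast

lemma polynomials_in_diff:
  "p \<in> polynomials_in I \<Longrightarrow> q \<in> polynomials_in I \<Longrightarrow> p - q \<in> polynomials_in I"
  unfolding polynomials_in_def using keys_diff[of p q] by blast

lemma algebraically_independent_eisenstein: "algebraically_independent {1, 2, 3} eisenstein"
  unfolding algebraically_independent_def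
proof (intro ballI impI)
  fix p :: "nat polynomial"
  assume p: "p \<in> polynomials_in {1, 2, 3}" and eval: "poly_eval eisenstein p = 0"
  \<comment> \<open>Exponent vectors supported in \<open>{1, 2, 3}\<close> are the same as triples.\<close>
  define \<phi> :: "(nat \<Rightarrow>\<^sub>0 nat) \<Rightarrow> nat \<times> nat \<times> nat" where
    "\<phi> = (\<lambda>e. (Poly_Mapping.lookup e 1, Poly_Mapping.lookup e 2, Poly_Mapping.lookup e 3))"
  define K where "K = Poly_Mapping.keys p"
  define f where "f = (\<lambda>t. Poly_Mapping.lookup p (the_inv_into K \<phi> t))"
  have keys: "Poly_Mapping.keys e \<subseteq> {1, 2, 3}" if "e \<in> K" for e
    using p that by (auto simp: polynomials_in_def K_def)
  have inj: "inj_on \<phi> K"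
  proof (rule inj_onI)
    fix e e' assume e: "e \<in> K" "e' \<in> K" "\<phi> e = \<phi> e'"
    show "e = e'"
    proof (rule poly_mapping_eqI)
      fix i
      show "Poly_Mapping.lookup e i = Poly_Mapping.lookup e' i"
      proof (cases "i \<in> {1, 2, 3}")
        case False
        then have "i \<notin> Poly_Mapping.keys e" "i \<notin> Poly_Mapping.keys e'"
          using keys[OF e(1)] keys[OF e(2)] by blast+
        then show ?thesis
          by (simp add: in_keys_iff)
      qed (use e(3) in \<open>auto simp: \<phi>_def\<close>)
    qed
  qed
  have "poly_eval eisenstein p = (\<Sum>e\<in>K. scale_hol (f (\<phi> e)) (case \<phi> e of (a, b, c) \<Rightarrow> eis_monomial a b c))"
    unfolding poly_eval_def K_def[symmetric]
  proof (rule sum.cong[OF refl])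
    fix e assume e: "e \<in> K"
    have "f (\<phi> e) = Poly_Mapping.lookup p e"
      by (simp add: f_def the_inv_into_f_f[OF inj e])
    then show "scale_hol (Poly_Mapping.lookup p e) (\<Prod>i\<in>Poly_Mapping.keys e. eisenstein i ^ Poly_Mapping.lookup e i) =
        scale_hol (f (\<phi> e)) (case \<phi> e of (a, b, c) \<Rightarrow> eis_monomial a b c)"
      unfolding prod_eq_eis_monomial[OF keys[OF e]] by (simp only: \<phi>_def prod.case)
  qed
  also have "\<dots> = (\<Sum>(a, b, c)\<in>\<phi> ` K. scale_hol (f (a, b, c)) (eis_monomial a b c))"
    by (simp add: sum.reindex[OF inj] case_prod_unfold)
  finally have rel: "(\<Sum>(a, b, c)\<in>\<phi> ` K. scale_hol (f (a, b, c)) (eis_monomial a b c)) = 0"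
    using eval by simp
  have "K = {}"
  proof (rule ccontr)
    assume "K \<noteq> {}"
    then obtain e where e: "e \<in> K"
      by blast
    have "finite (\<phi> ` K)"
      by (simp add: K_def)
    then have "f (\<phi> e) = 0"
      using eis_monomials_independent[OF _ rel, of "fst (\<phi> e)" "fst (snd (\<phi> e))" "snd (snd (\<phi> e))"] e by simp
    then have "Poly_Mapping.lookup p e = 0"
      by (simp add: f_def the_inv_into_f_f[OF inj e])
    with e show False
      by (simp add: K_def in_keys_iff)
  qed
  then show "p = 0"
    by (simp add: K_def)
qed

lemma inj_on_poly_eval:
  assumes "algebraically_independent I x"
  shows "inj_on (poly_eval x) (polynomials_in I)"
proof (rule inj_onI)
  fix p q assume pq: "p \<in> polynomials_in I" "q \<in> polynomials_in I" "poly_eval x p = poly_eval x q"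
  then have "p - q \<in> polynomials_in I" "poly_eval x (p - q) = 0"
    by (simp_all add: poly_eval_diff polynomials_in_diff)
  then have "p - q = 0"
    using assms unfolding algebraically_independent_def by blast
  then show "p = q"
    by simp
qed

lemma poly_eval_image: "poly_eval eisenstein ` polynomials_in {1, 2, 3} = diff_mod_form_algebra"
  unfolding diff_mod_form_algebra_eq_span
proof (rule equalityI)
  show "poly_eval eisenstein ` polynomials_in {1, 2, 3} \<subseteq> hol.span {eis_monomial a b c |a b c. True}"
  proof (rule image_subsetI)
    fix p :: "nat polynomial"
    assume p: "p \<in> polynomials_in {1, 2, 3}"
    have "(\<Prod>i\<in>Poly_Mapping.keys e. eisenstein i ^ Poly_Mapping.lookup e i) \<in> hol.span {eis_monomial a b c |a b c. True}"
      if e: "e \<in> Poly_Mapping.keys p" for e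
    proof -
      have "Poly_Mapping.keys e \<subseteq> {1, 2, 3}"
        using p e by (auto simp: polynomials_in_def)
      then have "(\<Prod>i\<in>Poly_Mapping.keys e. eisenstein i ^ Poly_Mapping.lookup e i) =
          eis_monomial (Poly_Mapping.lookup e 1) (Poly_Mapping.lookup e 2) (Poly_Mapping.lookup e 3)"
        by (rule prod_eq_eis_monomial)
      then show ?thesis
        by (intro hol.span_base) blast
    qed
    then show "poly_eval eisenstein p \<in> hol.span {eis_monomial a b c |a b c. True}"
      unfolding poly_eval_def by (intro hol.span_sum hol.span_scale)
  qed
next
  show "hol.span {eis_monomial a b c |a b c. True} \<subseteq> poly_eval eisenstein ` polynomials_in {1, 2, 3}"
  proof
    fix f assume "f \<in> hol.span {eis_monomial a b c |a b c. True}"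
    then show "f \<in> poly_eval eisenstein ` polynomials_in {1, 2, 3}"
    proof (induction rule: hol.span_induct_alt)
      case base
      have "poly_eval eisenstein (0 :: nat polynomial) = 0" "(0 :: nat polynomial) \<in> polynomials_in {1, 2, 3}"
        by (simp_all add: poly_eval_def polynomials_in_def)
      then show ?case
        by (metis image_eqI)
    next
      case (step k x y)
      then obtain a b c p where x: "x = eis_monomial a b c" and p: "p \<in> polynomials_in {1, 2, 3}" "y = poly_eval eisenstein p"
        by blast
      define e :: "nat \<Rightarrow>\<^sub>0 nat" where
        "e = Poly_Mapping.single 1 a + Poly_Mapping.single 2 b + Poly_Mapping.single 3 c"
      have e: "Poly_Mapping.lookup e 1 = a" "Poly_Mapping.lookup e 2 = b" "Poly_Mapping.lookup e 3 = c"
        by (simp_all add: e_def lookup_add lookup_single)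
      have ke: "Poly_Mapping.keys e \<subseteq> {1, 2, 3}"
        by (auto simp: e_def in_keys_iff lookup_add lookup_single when_def split: if_splits)
      have "poly_eval eisenstein (Poly_Mapping.single e k) = scale_hol k x"
        by (subst poly_eval_superset[of "{e}"]) (auto simp: prod_eq_eis_monomial[OF ke] e[unfolded One_nat_def] x)
      moreover have "Poly_Mapping.single e k \<in> polynomials_in {1, 2, 3}"
        using ke by (auto simp: polynomials_in_def)
      ultimately have "scale_hol k x + y = poly_eval eisenstein (Poly_Mapping.single e k + p)"
        "Poly_Mapping.single e k + p \<in> polynomials_in {1, 2, 3}"
        using p by (simp_all add: poly_eval_add polynomials_in_add)
      then show ?case
        by blast
    qed
  qed
qed

theorem theorem1:
  shows "algebraically_independent {1, 2, 3} eisenstein \<and>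
    freely_generated_by diff_mod_form_algebra {1, 2, 3} eisenstein \<and>
    (\<forall>n m. finite_dim_subspace (diff_mod_forms n m))"
  unfolding freely_generated_by_def bij_betw_def
  by (intro conjI allI algebraically_independent_eisenstein subalgebra_diff_mod_form_algebra
      inj_on_poly_eval[OF algebraically_independent_eisenstein] poly_eval_image finite_dim_diff_mod_forms)

end
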